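(* Let Assumption U and Assumption P (stated in the context) hold. Then there exists $(\underline{x}_*,\underline{C}_* )\in\mathcal{B}_w$ which solves the social planner problem $$V_{SP}(w)=\sup_{(\underline{x},\underline{C})\in\mathcal{B}_w}\ \sum_{i=1}^n\gamma^i U^i(x^i,C^i;C^{-i}).$$ Moreover $(\underline{x}_*,C_* )$, with $C_*=\sum_{i=1}^n C^i_*$, is unique up to indistinguishability.
   Context: Setting. Fix $0<T\le\infty$, a finite number $n\ge1$ of agents, and a filtered probability space $(\Omega,\mathcal{F},\{\mathcal{F}_t\}_{t\in[0,T]},P)$ satisfying the usual conditions of right-continuity and completeness, with expectation $E$. Let $w^i>0$ be the agents' initial wealths, $\psi_x,\psi_c$ strictly positive (forward) price processes of the private good and of contributions to the public good, and $r$ a stochastic discount rate process. A process is optional if it is measurable with respect to the sigma-field on $\Omega\times[0,T]$ generated by the right-continuous adapted processes. Here $x^i$ is agent $i$'s private consumption and $C^i$ agent $i$'s cumulative contribution to the public good. Set $$\Psi(x^i,C^i):=E\Big[\int_0^T\psi_x(t)x^i(t)\,dt+\int_0^T\psi_c(t)\,dC^i(t)\Big].$$ For a nondecreasing right-continuous $C$, $\int_0^T(\cdot)\,dC(t)$ denotes the Lebesgue–Stieltjes integral over $[0,T]$, including a possible point mass $C(0)$ at $t=0$ (convention $C(0-)=0$). The budget-feasible sets are $$\mathcal{B}_{w^i}:=\{(x^i,C^i):\Omega\times[0,T]\to\mathbb{R}_+^2\text{ optional}:\ C^i\text{ right-continuous and nondecreasing with } C^i(0-)=0\ P\text{-a.s.},\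 \Psi(x^i,C^i)\le w^i\}.$$ Payoffs: with $C:=\sum_{j=1}^n C^j$, $C^{-i}:=\sum_{j\ne i}C^j$ and instantaneous utility functions $u^i:\mathbb{R}_+^2\to\mathbb{R}_+$, $$U^i(x^i,C^i;C^{-i}):=E\Big[\int_0^T e^{-\int_0^t r(s)ds}u^i(x^i(t),C(t))\,dt\Big].$$ Social planner. Let $w:=\sum_{i=1}^n w^i$, $(\underline{x},\underline{C})=(x^1,\dots,x^n,C^1,\dots,C^n)$, and $$\mathcal{B}_w:=\{(\underline{x},\underline{C}):\Omega\times[0,T]\to\mathbb{R}_+^{2n}\text{ optional}:\ C^i\text{ right-continuous and nondecreasing with } C^i(0-)=0\ P\text{-a.s.},\ i=1,\dots,n,\ \sum_{i=1}^n\Psi(x^i,C^i)\le w\}.$$ The weights $\gamma^i$ are given, positive, and satisfy $\sum_{i=1}^n\gamma^i=1$. Assumption U. For each $i=1,\dots,n$: (i) $u^i$ is increasing and strictly concave on $\mathbb{R}_+^2$, and twice continuously differentiable on the open cone $\mathbb{R}_{++}^2$ with negative definite Hessian; moreover $\lim_{x\downarrow0}u^i_x(x,c)=+\infty$ and $\lim_{x\uparrow\infty}u^i_x(x,c)=0$ for any $c>0$. (ii) The family $e^{-\int_0^t r(\omega,s)ds}u^i(x^i(\omega,t),C(\omega,t))$, indexed by the strategy combinations $((x^j,C^j))_{j}\in\prod_{j=1}^n\mathcal{B}_{w^j}$ with $C=\sum_jC^j$, is $P\otimes dt$-uniformly integrable. Assumption P. (i) $\psi_c=\{\psi_c(t),t\in[0,T]\}$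 is adapted, right-continuous, and $\psi_c(t)=e^{-\int_0^t r_c(s)ds}\mathcal{E}_c(t)$ a.s. for every $t\in[0,T]$, with some uniformly bounded and strictly positive process $r_c=\{r_c(t),t\in[0,T]\}$ and some exponential martingale $\mathcal{E}_c=\{\mathcal{E}_c(t),t\in[0,T]\}$; moreover, if $T=\infty$, then $\psi_c(T)=0$ a.s. (ii) $\psi_x=\{\psi_x(t),t\in[0,T]\}$ is adapted, right-continuous, and $\psi_x(t)=e^{-\int_0^t r_x(s)ds}\mathcal{E}_x(t)$ a.s. for every $t\in[0,T]$, with some uniformly bounded and strictly positive process $r_x=\{r_x(t),t\in[0,T]\}$ and some exponential martingale $\mathcal{E}_x=\{\mathcal{E}_x(t),t\in[0,T]\}$. (iii) The process $r=\{r(t),t\in[0,T]\}$ is optional, strictly positive and uniformly bounded.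
   Formalization: Each u^i is also assumed continuous on the closed quadrant (existence can fail otherwise); uniqueness of x is P⊗dt-a.e. (x may be changed at one fixed time), while C is unique up to indistinguishability; for T=∞ the horizon is [0,∞). *)

theory Defs
  imports "HOL-Probability.Probability"
begin

(* Processes are written X t w (time first); only times in the horizon and points of the
   sample space matter.  Agents are the indices 1..n.  A terminal time T = \<infinity> is allowed:
   the horizon [0,T] then consists of the real times t \<ge> 0, so that cumulative contributions
   are finite at all these times but may diverge as t tends to infinity. *)

type_synonym 'a process = "real \<Rightarrow> 'a \<Rightarrow> real"

definition horizon :: "ereal \<Rightarrow> real set" where
  "horizon T = {t. 0 \<le> t \<and> ereal t \<le> T}"


section \<open>Filtration, optional processes, martingales\<close>

definition usual_filtration :: "'a measure \<Rightarrow> (real \<Rightarrow> 'a measure) \<Rightarrow> ereal \<Rightarrow> bool" where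
  "usual_filtration M F T \<longleftrightarrow>
     (\<forall>t\<in>horizon T. subalgebra M (F t)) \<and>
     (\<forall>s\<in>horizon T. \<forall>t\<in>horizon T. s \<le> t \<longrightarrow> sets (F s) \<subseteq> sets (F t)) \<and>
     (\<forall>t\<in>horizon T. ereal t < T \<longrightarrow> sets (F t) = (\<Inter>s\<in>{s \<in> horizon T. t < s}. sets (F s))) \<and>
     (\<forall>N\<in>null_sets M. \<forall>A\<subseteq>N. A \<in> sets (F 0))"

definition adapted :: "(real \<Rightarrow> 'a measure) \<Rightarrow> ereal \<Rightarrow> 'a process \<Rightarrow> bool" where
  "adapted F T X \<longleftrightarrow> (\<forall>t\<in>horizon T. X t \<in> borel_measurable (F t))"

definition right_continuous_on :: "real set \<Rightarrow> (real \<Rightarrow> real) \<Rightarrow> bool" where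
  "right_continuous_on I f \<longleftrightarrow> (\<forall>t\<in>I. continuous (at t within I \<inter> {t..}) f)"

definition right_continuous_process :: "'a measure \<Rightarrow> ereal \<Rightarrow> 'a process \<Rightarrow> bool" where
  "right_continuous_process M T X \<longleftrightarrow>
     (\<forall>\<omega>\<in>space M. right_continuous_on (horizon T) (\<lambda>t. X t \<omega>))"

definition optional_sigma :: "'a measure \<Rightarrow> (real \<Rightarrow> 'a measure) \<Rightarrow> ereal \<Rightarrow> ('a \<times> real) measure" where
  "optional_sigma M F T = sigma (space M \<times> horizon T)
     {{(\<omega>, t). \<omega> \<in> space M \<and> t \<in> horizon T \<and> X t \<omega> \<in> B} | X B.
        adapted F T X \<and> right_continuous_process M T X \<and> B \<in> sets borel}"

definition optional_process :: "'a measure \<Rightarrow> (real \<Rightarrow> 'a measure) \<Rightarrow> ereal \<Rightarrow> 'a process \<Rightarrow> bool" where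
  "optional_process M F T X \<longleftrightarrow> (\<lambda>(\<omega>, t). X t \<omega>) \<in> borel_measurable (optional_sigma M F T)"

(* the measure P \<otimes> dt *)
definition prod_time :: "'a measure \<Rightarrow> ereal \<Rightarrow> ('a \<times> real) measure" where
  "prod_time M T = M \<Otimes>\<^sub>M restrict_space lborel (horizon T)"

definition measurable_process :: "'a measure \<Rightarrow> ereal \<Rightarrow> 'a process \<Rightarrow> bool" where
  "measurable_process M T X \<longleftrightarrow> (\<lambda>(\<omega>, t). X t \<omega>) \<in> borel_measurable (prod_time M T)"

definition strictly_positive :: "'a measure \<Rightarrow> ereal \<Rightarrow> 'a process \<Rightarrow> bool" where
  "strictly_positive M T X \<longleftrightarrow> (\<forall>t\<in>horizon T. \<forall>\<omega>\<in>space M. 0 < X t \<omega>)"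

definition uniformly_bounded :: "'a measure \<Rightarrow> ereal \<Rightarrow> 'a process \<Rightarrow> bool" where
  "uniformly_bounded M T X \<longleftrightarrow> (\<exists>K. \<forall>t\<in>horizon T. \<forall>\<omega>\<in>space M. \<bar>X t \<omega>\<bar> \<le> K)"

definition martingale :: "'a measure \<Rightarrow> (real \<Rightarrow> 'a measure) \<Rightarrow> ereal \<Rightarrow> 'a process \<Rightarrow> bool" where
  "martingale M F T X \<longleftrightarrow> adapted F T X \<and> (\<forall>t\<in>horizon T. integrable M (X t)) \<and>
     (\<forall>s\<in>horizon T. \<forall>t\<in>horizon T. s \<le> t \<longrightarrow> (AE \<omega> in M. real_cond_exp M (F s) (X t) \<omega> = X s \<omega>))"

(* A martingale of the form exp X with X(0) = 0.  This covers exp (N - <N>/2) for a continuous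
   local martingale N, and every strictly positive stochastic exponential that is a true
   martingale.  For T = \<infinity> the martingale property is required on [0,\<infinity>) only. *)
definition exponential_martingale ::
    "'a measure \<Rightarrow> (real \<Rightarrow> 'a measure) \<Rightarrow> ereal \<Rightarrow> 'a process \<Rightarrow> bool" where
  "exponential_martingale M F T E \<longleftrightarrow> martingale M F T E \<and>
     (\<exists>X. adapted F T X \<and> (\<forall>\<omega>\<in>space M. X 0 \<omega> = 0) \<and>
          (\<forall>t\<in>horizon T. \<forall>\<omega>\<in>space M. E t \<omega> = exp (X t \<omega>)))"

(* exp (- \<integral>\<^sub>0\<^sup>t r(s) ds) *)
definition discount :: "'a process \<Rightarrow> 'a process" where
  "discount r t \<omega> = exp (- (LBINT s:{0..t}. r s \<omega>))"

(* Equi-integrability for measures that need not be finite: the integrable bound g takes the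
   place of the constant, as it must for P \<otimes> dt when T = \<infinity>.  On a finite measure space this is
   equivalent to the usual definition with constants. *)
definition uniformly_integrable :: "'b measure \<Rightarrow> ('b \<Rightarrow> real) set \<Rightarrow> bool" where
  "uniformly_integrable N \<F> \<longleftrightarrow> \<F> \<subseteq> borel_measurable N \<and>
     (\<forall>\<epsilon>>0. \<exists>g. integrable N g \<and> (\<forall>y\<in>space N. 0 \<le> g y) \<and>
        (\<forall>f\<in>\<F>. (\<integral>\<^sup>+y\<in>{y. g y \<le> \<bar>f y\<bar>}. ennreal \<bar>f y\<bar> \<partial>N) \<le> ennreal \<epsilon>))"


section \<open>Budgets\<close>

(* The measure dC on the horizon of a nondecreasing right-continuous path C.  The extension by 0
   to negative times puts the point mass C(0) at 0; after T the path is frozen. *)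
definition stieltjes :: "ereal \<Rightarrow> (real \<Rightarrow> real) \<Rightarrow> real measure" where
  "stieltjes T C = interval_measure
     (\<lambda>t. if t < 0 then 0 else if ereal t \<le> T then C t else C (real_of_ereal T))"

definition cost ::
    "'a measure \<Rightarrow> ereal \<Rightarrow> 'a process \<Rightarrow> 'a process \<Rightarrow> 'a process \<Rightarrow> 'a process \<Rightarrow> ennreal" where
  "cost M T \<psi>x \<psi>c x C =
     (\<integral>\<^sup>+\<omega>. ((\<integral>\<^sup>+t\<in>horizon T. ennreal (\<psi>x t \<omega> * x t \<omega>) \<partial>lborel) +
            (\<integral>\<^sup>+t\<in>horizon T. ennreal (\<psi>c t \<omega>) \<partial>(stieltjes T (\<lambda>t. C t \<omega>)))) \<partial>M)"

definition strategy ::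
    "'a measure \<Rightarrow> (real \<Rightarrow> 'a measure) \<Rightarrow> ereal \<Rightarrow> 'a process \<Rightarrow> 'a process \<Rightarrow> bool" where
  "strategy M F T x C \<longleftrightarrow> optional_process M F T x \<and> optional_process M F T C \<and>
     (\<forall>t\<in>horizon T. \<forall>\<omega>\<in>space M. 0 \<le> x t \<omega> \<and> 0 \<le> C t \<omega>) \<and>
     (AE \<omega> in M. right_continuous_on (horizon T) (\<lambda>t. C t \<omega>) \<and> mono_on (horizon T) (\<lambda>t. C t \<omega>))"

definition budget_set ::
    "'a measure \<Rightarrow> (real \<Rightarrow> 'a measure) \<Rightarrow> ereal \<Rightarrow> 'a process \<Rightarrow> 'a process \<Rightarrow> real \<Rightarrow>
     ('a process \<times> 'a process) set" where
  "budget_set M F T \<psi>x \<psi>c w = {(x, C). strategy M F T x C \<and> cost M T \<psi>x \<psi>c x C \<le> ennreal w}"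

definition planner_budget_set ::
    "'a measure \<Rightarrow> (real \<Rightarrow> 'a measure) \<Rightarrow> ereal \<Rightarrow> 'a process \<Rightarrow> 'a process \<Rightarrow> nat \<Rightarrow> real \<Rightarrow>
     ((nat \<Rightarrow> 'a process) \<times> (nat \<Rightarrow> 'a process)) set" where
  "planner_budget_set M F T \<psi>x \<psi>c n w =
     {(x, C). (\<forall>i\<in>{1..n}. strategy M F T (x i) (C i)) \<and>
              (\<Sum>i=1..n. cost M T \<psi>x \<psi>c (x i) (C i)) \<le> ennreal w}"


section \<open>Payoffs and the social planner problem\<close>

(* Utilities are nonnegative, so payoffs are taken as extended nonnegative integrals. *)
definition payoff ::
    "'a measure \<Rightarrow> ereal \<Rightarrow> 'a process \<Rightarrow> (real \<times> real \<Rightarrow> real) \<Rightarrow>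
     'a process \<Rightarrow> 'a process \<Rightarrow> 'a process \<Rightarrow> ennreal" where
  "payoff M T r ui xi Ci Cothers =
     (\<integral>\<^sup>+\<omega>. (\<integral>\<^sup>+t\<in>horizon T.
        ennreal (discount r t \<omega> * ui (xi t \<omega>, Ci t \<omega> + Cothers t \<omega>)) \<partial>lborel) \<partial>M)"

definition planner_objective ::
    "'a measure \<Rightarrow> ereal \<Rightarrow> 'a process \<Rightarrow> (nat \<Rightarrow> real \<times> real \<Rightarrow> real) \<Rightarrow> nat \<Rightarrow> (nat \<Rightarrow> real) \<Rightarrow>
     (nat \<Rightarrow> 'a process) \<times> (nat \<Rightarrow> 'a process) \<Rightarrow> ennreal" where
  "planner_objective M T r u n \<gamma> = (\<lambda>(x, C).
     \<Sum>i=1..n. ennreal (\<gamma> i) *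
       payoff M T r (u i) (x i) (C i) (\<lambda>t \<omega>. \<Sum>j\<in>{1..n} - {i}. C j t \<omega>))"

definition V_SP where
  "V_SP M F T \<psi>x \<psi>c r u n \<gamma> w =
     (SUP s\<in>planner_budget_set M F T \<psi>x \<psi>c n w. planner_objective M T r u n \<gamma> s)"

definition solves_planner where
  "solves_planner M F T \<psi>x \<psi>c r u n \<gamma> w s \<longleftrightarrow>
     s \<in> planner_budget_set M F T \<psi>x \<psi>c n w \<and>
     planner_objective M T r u n \<gamma> s = V_SP M F T \<psi>x \<psi>c r u n \<gamma> w"


section \<open>Assumptions\<close>

definition quadrant :: "(real \<times> real) set" where
  "quadrant = {0..} \<times> {0..}"

definition open_quadrant :: "(real \<times> real) set" where
  "open_quadrant = {0<..} \<times> {0<..}"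

definition strictly_concave_on :: "'b::real_vector set \<Rightarrow> ('b \<Rightarrow> real) \<Rightarrow> bool" where
  "strictly_concave_on S f \<longleftrightarrow> convex S \<and>
     (\<forall>p\<in>S. \<forall>q\<in>S. \<forall>a. p \<noteq> q \<and> 0 < a \<and> a < 1 \<longrightarrow>
        (1 - a) * f p + a * f q < f ((1 - a) *\<^sub>R p + a *\<^sub>R q))"

(* twice continuously differentiable on S with negative definite Hessian; g is the gradient and
   H the Hessian, as a bounded linear map *)
definition C2_neg_def_on :: "'b::real_inner set \<Rightarrow> ('b \<Rightarrow> real) \<Rightarrow> bool" where
  "C2_neg_def_on S f \<longleftrightarrow>
     (\<exists>(g :: 'b \<Rightarrow> 'b) (H :: 'b \<Rightarrow> 'b \<Rightarrow>\<^sub>L 'b).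
        (\<forall>p\<in>S. GDERIV f p :> g p \<and> (g has_derivative blinfun_apply (H p)) (at p) \<and>
                (\<forall>h. h \<noteq> 0 \<longrightarrow> inner h (blinfun_apply (H p) h) < 0)) \<and>
        continuous_on S H)"

(* Continuity up to the boundary of the quadrant is required explicitly, since concavity does not
   give it: a function such as sqrt x + ln (1 + c) + (if c > 0 then 1 else 0) is increasing and
   strictly concave on the quadrant, and with such jumps the supremum need not be attained. *)
definition utility_regular :: "(real \<times> real \<Rightarrow> real) \<Rightarrow> bool" where
  "utility_regular v \<longleftrightarrow>
     (\<forall>p\<in>quadrant. 0 \<le> v p) \<and>
     continuous_on quadrant v \<and>
     (\<forall>x c x' c'. 0 \<le> x \<and> x \<le> x' \<and> 0 \<le> c \<and> c \<le> c' \<longrightarrow> v (x, c) \<le> v (x', c')) \<and>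
     strictly_concave_on quadrant v \<and>
     C2_neg_def_on open_quadrant v \<and>
     (\<forall>c>0. filterlim (\<lambda>x. deriv (\<lambda>y. v (y, c)) x) at_top (at_right 0) \<and>
            ((\<lambda>x. deriv (\<lambda>y. v (y, c)) x) \<longlongrightarrow> 0) at_top)"

definition Assumption_U where
  "Assumption_U M F T \<psi>x \<psi>c r u n w \<longleftrightarrow>
     (\<forall>i\<in>{1..n}. utility_regular (u i) \<and>
        uniformly_integrable (prod_time M T)
          {(\<lambda>(\<omega>, t). discount r t \<omega> * u i (x i t \<omega>, \<Sum>j=1..n. C j t \<omega>)) | x C.
             \<forall>j\<in>{1..n}. (x j, C j) \<in> budget_set M F T \<psi>x \<psi>c (w j)})"

definition price_process ::
    "'a measure \<Rightarrow> (real \<Rightarrow> 'a measure) \<Rightarrow> ereal \<Rightarrow> 'a process \<Rightarrow> bool" where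
  "price_process M F T \<psi> \<longleftrightarrow> adapted F T \<psi> \<and> right_continuous_process M T \<psi> \<and>
     (\<exists>\<rho> E. measurable_process M T \<rho> \<and> uniformly_bounded M T \<rho> \<and> strictly_positive M T \<rho> \<and>
        exponential_martingale M F T E \<and>
        (\<forall>t\<in>horizon T. AE \<omega> in M. \<psi> t \<omega> = discount \<rho> t \<omega> * E t \<omega>))"

(* For T = \<infinity>, the terminal value \<psi>c(\<infinity>) is the limit at infinity (it exists almost surely,
   \<psi>c being a nonnegative right-continuous supermartingale). *)
definition Assumption_P where
  "Assumption_P M F T \<psi>x \<psi>c r \<longleftrightarrow>
     price_process M F T \<psi>c \<and> (T = \<infinity> \<longrightarrow> (AE \<omega> in M. ((\<lambda>t. \<psi>c t \<omega>) \<longlongrightarrow> 0) at_top)) \<and>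
     price_process M F T \<psi>x \<and>
     optional_process M F T r \<and> strictly_positive M T r \<and> uniformly_bounded M T r"

end

theory Submission
  imports Defs
begin

text \<open>Only the aggregate contribution \<open>C\<close> enters payoffs and costs, so the problem is one for
  \<open>(x, C)\<close>. Strict concavity makes Komlos-type arguments unnecessary: if two strategies are nearly
  optimal, their midpoint shows that the concavity gap of the utilities has a small integral. As the
  budget bounds strategies in measure, a maximizing sequence is Cauchy in measure, and exact maximizers
  coincide almost everywhere. A subsequence converges almost everywhere; uniform integrability gives
  upper semicontinuity of welfare, and the limit of the contributions is made right-continuous by
  Helly's selection argument.

  The price \<open>\<psi>c\<close> is only right-continuous, so the cost is not lower semicontinuous path by
  path. In expectation it is, because \<open>\<psi>c\<close> is a supermartingale: buying at the right
  endpoints of a grid is never more expensive than buying along the path, and grid costs depend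
  on finitely many times only.\<close>

section \<open>Stieltjes integrals along grids\<close>

text \<open>Two obstacles shape the details. The first is the comparison of grid costs with path
  costs. An increment bought at the right end of its cell is known at that time, so the
  supermartingale property compares the prices at earlier and later grid times; the path integral is
  reached by refining the grid. Price paths may be unbounded, so prices are truncated first, and the
  error is controlled at all grid times by the martingale factor of the price at one fixed time.
  With a single cell the inequality bounds the expectation of \<open>\<psi>c t * C t\<close> by
  wealth, which is what bounds contributions in measure. The second is a finite T. It is a dt-null
  time, invisible to convergence almost everywhere for P \<otimes> dt, yet a contribution made at T
  costs money. The limit is therefore stripped of a jump at T, and uniqueness at T has its own
  argument. Convergence in measure refers to a finite measure equivalent to P \<otimes> dt, as the
  latter is infinite for T = \<infinity>. Paths that are good only almost surely are replaced at the
  start, by completeness of the filtration.\<close>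

definition good_path :: "ereal \<Rightarrow> (real \<Rightarrow> real) \<Rightarrow> bool" where
  "good_path T c \<longleftrightarrow> right_continuous_on (horizon T) c \<and> mono_on (horizon T) c \<and>
     (\<forall>t\<in>horizon T. 0 \<le> c t)"

definition grid :: "nat \<Rightarrow> real \<Rightarrow> nat \<Rightarrow> real" where
  "grid m S j = S * real j / real m"

text \<open>The first cell includes 0 because contributions may have a point mass there; the others
  are half-open, so that their Stieltjes mass is an increment of the path.\<close>

definition cell :: "nat \<Rightarrow> real \<Rightarrow> nat \<Rightarrow> real set" where
  "cell m S j = (if j = 0 then {0..grid m S 1} else {grid m S j<..grid m S (Suc j)})"

definition grid_incr :: "nat \<Rightarrow> real \<Rightarrow> (real \<Rightarrow> real) \<Rightarrow> nat \<Rightarrow> real" where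
  "grid_incr m S c j = c (grid m S (Suc j)) - (if j = 0 then 0 else c (grid m S j))"

text \<open>Right endpoints serve two purposes: they approach a time from the side on which prices
  are continuous, and the increment over a cell is known there.\<close>

definition grid_sum :: "nat \<Rightarrow> real \<Rightarrow> (real \<Rightarrow> real) \<Rightarrow> (real \<Rightarrow> real) \<Rightarrow> real" where
  "grid_sum m S f c = (\<Sum>j<m. f (grid m S (Suc j)) * grid_incr m S c j)"

definition step_fun :: "nat \<Rightarrow> real \<Rightarrow> (real \<Rightarrow> real) \<Rightarrow> real \<Rightarrow> real" where
  "step_fun m S f t = (\<Sum>j<m. f (grid m S (Suc j)) * indicator (cell m S j) t)"

lemma horizon_le: "s \<in> horizon T \<Longrightarrow> 0 \<le> t \<Longrightarrow> t \<le> s \<Longrightarrow> t \<in> horizon T"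
  unfolding horizon_def by (auto intro: order_trans[of "ereal t" "ereal s"])

lemma zero_in_horizon: "0 < T \<Longrightarrow> 0 \<in> horizon T"
  unfolding horizon_def by (cases T) auto

lemma horizon_borel [measurable]: "horizon T \<in> sets borel"
  unfolding horizon_def by measurable

lemma right_continuous_on_LIMSEQ:
  assumes "right_continuous_on I f" "t \<in> I" "\<And>k. X k \<in> I" "\<And>k. t \<le> X k" "X \<longlonglongrightarrow> t"
  shows "(\<lambda>k. f (X k)) \<longlonglongrightarrow> f t"
proof -
  have "continuous (at t within I \<inter> {t..}) f"
    using assms(1,2) by (auto simp: right_continuous_on_def)
  then show ?thesis
    using assms unfolding continuous_within_sequentially by (auto simp: o_def)
qed

lemma right_continuous_on_comp:
  fixes g :: "real \<Rightarrow> real"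
  assumes "right_continuous_on I f" "continuous_on UNIV g"
  shows "right_continuous_on I (\<lambda>t. g (f t))"
  using assms unfolding right_continuous_on_def
  by (auto intro: continuous_within_compose3[where g = g] simp: continuous_on_eq_continuous_at)

text \<open>These are the conditions under which \<open>interval_measure\<close> gives half-open
  intervals the increments of the extended path \<open>e\<close>.\<close>

lemma good_path_extension:
  assumes "good_path T c" "0 < T"
  defines "e \<equiv> \<lambda>t. if t < 0 then 0 else if ereal t \<le> T then c t else c (real_of_ereal T)"
  shows "mono e" and "\<And>a. continuous (at_right a) e"
proof -
  have mono_c: "c s \<le> c t" if "s \<in> horizon T" "t \<in> horizon T" "s \<le> t" for s t
    using assms that by (auto simp: good_path_def mono_on_def)
  have nn: "0 \<le> c s" if "s \<in> horizon T" for s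
    using assms that by (auto simp: good_path_def)
  have TH: "real_of_ereal T \<in> horizon T" "s \<le> real_of_ereal T" 
    if "\<not> ereal t \<le> T" "ereal s \<le> T" for s t
    using that \<open>0 < T\<close> by (cases T; auto simp: horizon_def)+
  show "mono e"
  proof (rule monoI)
    fix s t :: real assume "s \<le> t"
    have a: "ereal s \<le> T" if "ereal t \<le> T" using that \<open>s \<le> t\<close> by (meson ereal_less_eq(3) order_trans)
    show "e s \<le> e t"
      using \<open>s \<le> t\<close> a TH(1)[of t s] TH(2)[of t s] TH(1)[of t "0"]  \<open>0 < T\<close>
      by (auto simp: e_def horizon_def zero_ereal_def intro!: mono_c nn)
  qed
  fix a
  show "continuous (at_right a) e"
  proof -
    \<comment> \<open>To the right of a negative time and from T on, \<open>e\<close> is locally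
      constant; in between its right-continuity is that of \<open>c\<close>.\<close>
    consider "a < 0" | "a \<ge> 0" "ereal a < T" | "T \<le> ereal a" "0 \<le> a" by (meson not_le)
    then show ?thesis
    proof cases
      case 1
      have "eventually (\<lambda>t. e t = 0) (at_right a)"
        using 1 by (auto simp: eventually_at_right e_def intro!: exI[of _ 0])
      then show ?thesis using 1
        unfolding continuous_within by (auto simp: e_def tendsto_eventually)
    next
      case 2
      then have aH: "a \<in> horizon T" by (auto simp: horizon_def)
      have "continuous (at a within horizon T \<inter> {a..}) c"
        using assms aH by (auto simp: good_path_def right_continuous_on_def)
      then have lim: "(c \<longlongrightarrow> c a) (at a within horizon T \<inter> {a..})"
        by (simp add: continuous_within)
      obtain b where b: "a < b" "ereal b < T"
        using 2 by (metis ereal_dense2 ereal_less(2) less_ereal.simps(1))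
      have le_T: "ereal t \<le> T" if "t \<le> b" for t
        using that b(2) by (intro order_trans[of "ereal t" "ereal b" T]) auto
      have "(c \<longlongrightarrow> c a) (at a within {a..b})"
        using le_T by (intro tendsto_within_subset[OF lim]) (use 2 in \<open>auto simp: horizon_def\<close>)
      then have "(e \<longlongrightarrow> c a) (at a within {a..b})"
        using le_T 2 by (elim Lim_transform_eventually) (auto simp: eventually_at_filter e_def)
      moreover have "at a within {a..b} = at_right a"
        using b by (simp add: at_within_Icc_at_right)
      moreover have "e a = c a" using 2 by (auto simp: e_def)
      ultimately show ?thesis by (simp add: continuous_within)
    next
      case 3
      then have ca: "e t = c (real_of_ereal T)" if "t \<ge> a" for t
        using that 3 \<open>0 < T\<close> by (cases T) (auto simp: e_def intro!: arg_cong[where f = c])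
      have "eventually (\<lambda>t. e t = c (real_of_ereal T)) (at_right a)"
        using eventually_at_right_less[of a] by (elim eventually_mono) (simp add: ca)
      then show ?thesis using ca[of a]
        unfolding continuous_within by (auto simp: tendsto_eventually)
    qed
  qed
qed

section \<open>Stieltjes masses of intervals and cells\<close>

lemma sets_stieltjes [simp, measurable_cong]: "sets (stieltjes T c) = sets borel"
  by (simp add: stieltjes_def)

lemma space_stieltjes [simp]: "space (stieltjes T c) = UNIV"
  by (simp add: stieltjes_def)

lemma emeasure_stieltjes_Ioc:
  assumes "good_path T c" "0 < T" "a \<in> horizon T" "b \<in> horizon T" "a \<le> b"
  shows "emeasure (stieltjes T c) {a<..b} = ennreal (c b - c a)"
  unfolding stieltjes_def using assms good_path_extension[OF assms(1,2)]
  by (subst emeasure_interval_measure_Ioc) (auto simp: mono_def horizon_def)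

text \<open>The interval is the intersection of half-open intervals with negative left ends, where
  the extended path is 0; so the point mass at 0 is counted.\<close>

lemma emeasure_stieltjes_Icc:
  assumes "good_path T c" "0 < T" "b \<in> horizon T"
  shows "emeasure (stieltjes T c) {0..b} = ennreal (c b)"
proof -
  have b0: "0 \<le> b" using assms by (auto simp: horizon_def)
  define d where "d k = - inverse (real (Suc k))" for k
  have d: "d k < 0" for k by (simp add: d_def)
  have d_mono: "d i \<le> d j" if "i \<le> j" for i j
    using that by (simp add: d_def le_imp_inverse_le)
  have 1: "emeasure (stieltjes T c) {d k<..b} = ennreal (c b)" for k
    unfolding stieltjes_def using assms good_path_extension[OF assms(1,2)] b0 d[of k]
    by (subst emeasure_interval_measure_Ioc) (auto simp: mono_def horizon_def)
  have 2: "{0..b} = (\<Inter>k. {d k<..b})"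
  proof (intro equalityI subsetI)
    fix x assume x: "x \<in> (\<Inter>k. {d k<..b})"
    have "0 \<le> x"
    proof (rule ccontr)
      assume "\<not> 0 \<le> x"
      then obtain k where "inverse (real (Suc k)) < - x"
        using reals_Archimedean[of "- x"] by auto
      moreover have "d k < x" using x by auto
      ultimately show False by (simp add: d_def)
    qed
    then show "x \<in> {0..b}" using x by auto
  next
    fix x assume "x \<in> {0..b}"
    then show "x \<in> (\<Inter>k. {d k<..b})" using d by (auto intro: less_le_trans)
  qed
  have "(INF k. emeasure (stieltjes T c) {d k<..b}) = emeasure (stieltjes T c) (\<Inter>k. {d k<..b})"
  proof (rule INF_emeasure_decseq)
    show "decseq (\<lambda>k. {d k<..b})"
      unfolding decseq_def using d_mono by (force intro: le_less_trans)
  qed (auto simp: 1)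
  then show ?thesis unfolding 2[symmetric] 1 by simp
qed

lemma cell_borel [measurable]: "cell m S j \<in> sets borel"
  by (auto simp: cell_def)

lemma grid_bounds:
  assumes "0 < S" "j \<le> m" 
  shows "0 \<le> grid m S j" "grid m S j \<le> S"
  using assms by (auto simp: grid_def divide_simps)

lemma grid_mono: "0 < S \<Longrightarrow> i \<le> j \<Longrightarrow> grid m S i \<le> grid m S j"
  by (auto simp: grid_def intro!: divide_right_mono)

lemma grid_horizon: "S \<in> horizon T \<Longrightarrow> 0 < S \<Longrightarrow> j \<le> m \<Longrightarrow> grid m S j \<in> horizon T"
  using grid_bounds horizon_le by blast

lemma grid_last: "0 < m \<Longrightarrow> grid m S m = S"
  by (simp add: grid_def)

lemma grid_incr_nonneg:
  assumes "good_path T c" "S \<in> horizon T" "0 < S" "j < m"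
  shows "0 \<le> grid_incr m S c j"
proof -
  have "grid m S (Suc j) \<in> horizon T" "grid m S j \<in> horizon T" "grid m S j \<le> grid m S (Suc j)"
    using assms by (auto intro!: grid_horizon grid_mono)
  then show ?thesis using assms unfolding grid_incr_def good_path_def mono_on_def by auto
qed

lemma emeasure_cell:
  assumes "good_path T c" "0 < T" "S \<in> horizon T" "0 < S" "j < m"
  shows "emeasure (stieltjes T c) (cell m S j) = ennreal (grid_incr m S c j)"
  unfolding cell_def grid_incr_def using assms
  by (auto intro!: emeasure_stieltjes_Icc emeasure_stieltjes_Ioc grid_horizon grid_mono)

text \<open>Exactly one cell contains \<open>t\<close>, and \<tau> is its right endpoint, at most
  one mesh away. Later limits use only this description.\<close>

lemma step_fun_eq:
  assumes S: "0 < S" and m: "0 < m" and t: "t \<in> {0..S}"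
  obtains \<tau> where "t \<le> \<tau>" "\<tau> \<le> S" "\<tau> \<le> t + S / m" "step_fun m S f t = f \<tau>"
proof -
  \<comment> \<open>In units of the mesh the cells have integer endpoints.\<close>
  define x where "x = t * m / S"
  have x: "0 \<le> x" "x \<le> m" using assms by (auto simp: x_def field_simps)
  have cell_iff: "t \<in> cell m S i \<longleftrightarrow> (if i = 0 then x \<le> 1 else i < x \<and> x \<le> i + 1)" for i
    using assms by (auto simp: cell_def grid_def x_def field_simps)
  obtain j where j: "j < m" "t \<in> cell m S j"
  proof (cases "x \<le> 1")
    case True
    then show ?thesis using m by (intro that[of 0]) (auto simp: cell_iff)
  next
    case False
    \<comment> \<open>Cells are closed on the right, hence the ceiling minus one instead of the
      floor.\<close>
    define j where "j = nat (\<lceil>x\<rceil> - 1)"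
    have "real j = \<lceil>x\<rceil> - 1" using False by (simp add: j_def)
    then have "real j < x" "x \<le> j + 1" by linarith+
    then have "j < m" using x by linarith
    moreover have "j \<noteq> 0" using False \<open>x \<le> j + 1\<close> by auto
    ultimately show ?thesis using \<open>real j < x\<close> \<open>x \<le> j + 1\<close>
      by (intro that[of j]) (auto simp: cell_iff)
  qed
  have uniq: "t \<in> cell m S i \<longleftrightarrow> i = j" for i
  proof
    assume "t \<in> cell m S i"
    then have "i = 0 \<and> x \<le> 1 \<or> real i < x \<and> x \<le> real i + 1" "j = 0 \<and> x \<le> 1 \<or> real j < x \<and> x \<le> real j + 1" 
      using j(2) unfolding cell_iff by (auto split: if_splits)
    then show "i = j" by auto
  qed (use j in auto)
  have "step_fun m S f t = (\<Sum>i<m. if i = j then f (grid m S (Suc j)) else 0)"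
    unfolding step_fun_def by (intro sum.cong) (auto simp: uniq indicator_def)
  also have "\<dots> = f (grid m S (Suc j))" using j by simp
  finally have "step_fun m S f t = f (grid m S (Suc j))" .
  moreover have "t \<le> grid m S (Suc j)" "grid m S (Suc j) \<le> t + S / m"
    using j(2) t assms by (auto simp: cell_def grid_def field_simps split: if_splits)
  moreover have "grid m S (Suc j) \<le> S" using grid_bounds j S by simp
  ultimately show ?thesis using that by blast
qed

text \<open>The sampled times tend to \<open>t\<close> from the right.\<close>

lemma step_fun_tendsto:
  assumes f: "right_continuous_on (horizon T) f" and S: "S \<in> horizon T" "0 < S"
    and t: "t \<in> {0..S}"
  shows "(\<lambda>m. step_fun (Suc m) S f t) \<longlonglongrightarrow> f t"
proof -
  have "\<forall>m. \<exists>\<tau>. t \<le> \<tau> \<and> \<tau> \<le> S \<and> \<tau> \<le> t + S / Suc m \<and> step_fun (Suc m) S f t = f \<tau>"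
    using step_fun_eq[OF S(2) _ t] by (metis zero_less_Suc)
  then obtain \<tau> where \<tau>: "\<And>m. t \<le> \<tau> m" "\<And>m. \<tau> m \<le> S" "\<And>m. \<tau> m \<le> t + S / Suc m"
    "\<And>m. step_fun (Suc m) S f t = f (\<tau> m)" by metis
  have "(\<lambda>m. t + S / Suc m) \<longlonglongrightarrow> t + 0"
    by (intro tendsto_intros LIMSEQ_Suc[OF lim_const_over_n])
  then have "\<tau> \<longlonglongrightarrow> t"
    using \<tau> by (intro tendsto_sandwich[of "\<lambda>_. t" \<tau> _ "\<lambda>m. t + S / Suc m"]) auto
  then show ?thesis unfolding \<tau>(4)
    using \<tau> t S by (intro right_continuous_on_LIMSEQ[OF f]) (auto intro!: horizon_le[OF S(1)] intro: order_trans)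
qed

lemma nn_integral_step_fun:
  assumes "good_path T c" "0 < T" "S \<in> horizon T" "0 < S" "\<And>t. t \<in> {0..S} \<Longrightarrow> 0 \<le> f t"
  shows "(\<integral>\<^sup>+t. ennreal (step_fun m S f t) \<partial>(stieltjes T c)) = ennreal (grid_sum m S f c)"
proof -
  have nn: "0 \<le> f (grid m S (Suc j))" if "j < m" for j
    using that assms by (intro assms) (auto intro!: grid_bounds)
  have "(\<integral>\<^sup>+t. ennreal (step_fun m S f t) \<partial>(stieltjes T c)) =
    (\<integral>\<^sup>+t. (\<Sum>j<m. ennreal (f (grid m S (Suc j))) * indicator (cell m S j) t) \<partial>(stieltjes T c))"
    unfolding step_fun_def using nn
    by (intro nn_integral_cong, subst sum_ennreal[symmetric])
      (simp_all add: ennreal_mult'' ennreal_indicator)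
  also have "\<dots> = (\<Sum>j<m. ennreal (f (grid m S (Suc j))) * emeasure (stieltjes T c) (cell m S j))"
    by (subst nn_integral_sum) (auto simp: nn_integral_cmult_indicator)
  also have "\<dots> = (\<Sum>j<m. ennreal (f (grid m S (Suc j)) * grid_incr m S c j))"
    using assms nn by (intro sum.cong refl) (simp add: emeasure_cell ennreal_mult grid_incr_nonneg)
  also have "\<dots> = ennreal (grid_sum m S f c)"
    unfolding grid_sum_def using nn assms
    by (subst sum_ennreal) (auto intro!: mult_nonneg_nonneg grid_incr_nonneg)
  finally show ?thesis .
qed

lemma step_fun_borel [measurable]: "step_fun m S f \<in> borel_measurable borel"
  unfolding step_fun_def[abs_def] by measurable

lemma step_fun_outside: "0 < S \<Longrightarrow> t \<notin> {0..S} \<Longrightarrow> step_fun m S f t = 0"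
proof -
  assume "0 < S" "t \<notin> {0..S}"
  then have "t \<notin> cell m S j" if "j < m" for j
    using that grid_bounds[of S j m] grid_bounds[of S "Suc j" m] grid_bounds[of S 1 m]
    by (auto simp: cell_def)
  then show "step_fun m S f t = 0" unfolding step_fun_def by (auto intro!: sum.neutral)
qed

text \<open>The step approximations are Borel and converge pointwise.\<close>

lemma right_continuous_on_borel:
  assumes f: "right_continuous_on (horizon T) f" and S: "S \<in> horizon T" "0 < S"
  shows "(\<lambda>t. f t * indicator {0..S} t) \<in> borel_measurable borel"
proof (rule borel_measurable_LIMSEQ_real)
  show "(\<lambda>m. step_fun (Suc m) S f t) \<longlonglongrightarrow> f t * indicator {0..S} t" for t
    using step_fun_tendsto[OF f S] step_fun_outside[OF S(2), of t _ f]
    by (cases "t \<in> {0..S}") auto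
qed measurable

section \<open>Integrals up to a fixed time\<close>

definition stieltjes_upto :: "ereal \<Rightarrow> real \<Rightarrow> (real \<Rightarrow> real) \<Rightarrow> (real \<Rightarrow> real) \<Rightarrow> ennreal" where
  "stieltjes_upto T S f c = (\<integral>\<^sup>+t\<in>{0..S}. ennreal (f t) \<partial>(stieltjes T c))"

text \<open>A right-continuous function may be unbounded on a compact interval, hence the bound
  \<open>a\<close>: it dominates the step functions, on an interval of finite mass
  \<open>c S\<close>. General integrands are reached by truncation.\<close>

lemma stieltjes_upto_tendsto:
  assumes c: "good_path T c" "0 < T" and f: "right_continuous_on (horizon T) f"
    and S: "S \<in> horizon T" "0 < S" and b: "\<And>t. t \<in> {0..S} \<Longrightarrow> 0 \<le> f t \<and> f t \<le> a"
  shows "(\<lambda>m. ennreal (grid_sum (Suc m) S f c)) \<longlonglongrightarrow> stieltjes_upto T S f c"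
proof -
  have [measurable]: "(\<lambda>t. f t * indicator {0..S} t) \<in> borel_measurable borel"
    using right_continuous_on_borel[OF f S] .
  have eq: "ennreal (f t) * indicator {0..S} t = ennreal (f t * indicator {0..S} t)" for t
    by (auto simp: indicator_def)
  have bd: "0 \<le> step_fun (Suc m) S f t \<and> step_fun (Suc m) S f t \<le> a * indicator {0..S} t" for m t
  proof (cases "t \<in> {0..S}")
    case True
    then obtain \<tau> where "t \<le> \<tau>" "\<tau> \<le> S" "step_fun (Suc m) S f t = f \<tau>"
      using step_fun_eq[OF S(2) _ True] by (metis zero_less_Suc)
    then show ?thesis using True b[of \<tau>] by auto
  next
    case False
    then show ?thesis using step_fun_outside[OF S(2) False] by auto
  qed
  have lim: "(\<lambda>m. step_fun (Suc m) S f t) \<longlonglongrightarrow> f t * indicator {0..S} t" for t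
    using step_fun_tendsto[OF f S] step_fun_outside[OF S(2), of t _ f]
    by (cases "t \<in> {0..S}") auto
  have a: "0 \<le> a" using b[of S] S by auto
  have "(\<lambda>m. \<integral>\<^sup>+t. ennreal (step_fun (Suc m) S f t) \<partial>(stieltjes T c)) \<longlonglongrightarrow>
     (\<integral>\<^sup>+t. ennreal (f t * indicator {0..S} t) \<partial>(stieltjes T c))"
  proof (rule nn_integral_dominated_convergence[where w = "\<lambda>t. ennreal (a * indicator {0..S} t)"])
    show "(\<integral>\<^sup>+ t. ennreal (a * indicator {0..S} t) \<partial>stieltjes T c) < \<infinity>"
      using emeasure_stieltjes_Icc[OF c S(1)]
      by (subst ennreal_mult'', simp, subst ennreal_indicator, subst nn_integral_cmult_indicator) (auto simp: ennreal_mult_less_top)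
    show "AE t in stieltjes T c. ennreal (step_fun (Suc m) S f t) \<le> ennreal (a * indicator {0..S} t)" for m
      using bd by (auto intro!: ennreal_leI AE_I2)
    show "AE t in stieltjes T c. (\<lambda>m. ennreal (step_fun (Suc m) S f t)) \<longlonglongrightarrow> ennreal (f t * indicator {0..S} t)"
      using lim by (auto intro!: tendsto_ennrealI)
  qed measurable
  moreover have "(\<integral>\<^sup>+t. ennreal (step_fun (Suc m) S f t) \<partial>(stieltjes T c)) = ennreal (grid_sum (Suc m) S f c)" for m
    by (rule nn_integral_step_fun[OF c S]) (use b in auto)
  ultimately show ?thesis unfolding stieltjes_upto_def eq by simp
qed

text \<open>Fatou's lemma takes the place of domination for an integrand that may be
  unbounded.\<close>

lemma stieltjes_upto_le_liminf:
  assumes c: "good_path T c" "0 < T" and f: "right_continuous_on (horizon T) f"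
    and S: "S \<in> horizon T" "0 < S" and b: "\<And>t. t \<in> {0..S} \<Longrightarrow> 0 \<le> f t"
  shows "stieltjes_upto T S f c \<le> liminf (\<lambda>m. ennreal (grid_sum (Suc m) S f c))"
proof -
  have eq: "ennreal (f t) * indicator {0..S} t = ennreal (f t * indicator {0..S} t)" for t
    by (auto simp: indicator_def)
  have lim: "(\<lambda>m. step_fun (Suc m) S f t) \<longlonglongrightarrow> f t * indicator {0..S} t" for t
    using step_fun_tendsto[OF f S] step_fun_outside[OF S(2), of t _ f]
    by (cases "t \<in> {0..S}") auto
  have "stieltjes_upto T S f c = (\<integral>\<^sup>+t. liminf (\<lambda>m. ennreal (step_fun (Suc m) S f t)) \<partial>(stieltjes T c))"
    unfolding stieltjes_upto_def eq
    by (intro nn_integral_cong lim_imp_Liminf[symmetric] tendsto_ennrealI lim) auto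
  also have "\<dots> \<le> liminf (\<lambda>m. \<integral>\<^sup>+t. ennreal (step_fun (Suc m) S f t) \<partial>(stieltjes T c))"
    by (rule nn_integral_liminf) measurable
  also have "\<dots> = liminf (\<lambda>m. ennreal (grid_sum (Suc m) S f c))"
    by (subst nn_integral_step_fun[OF c S]) (use b in auto)
  finally show ?thesis .
qed

lemma min_right_continuous:
  "right_continuous_on I f \<Longrightarrow> right_continuous_on I (\<lambda>t. min (f t) (a::real))"
  by (rule right_continuous_on_comp[where g = "\<lambda>x. min x a"]) (auto intro!: continuous_intros)

lemma good_path_lincomb:
  assumes "good_path T c" "good_path T d" "0 \<le> a" "0 \<le> b"
  shows "good_path T (\<lambda>t. a * c t + b * d t)"
  using assms unfolding good_path_def right_continuous_on_def mono_on_def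
  by (auto intro!: add_mono mult_left_mono continuous_intros)

lemma grid_sum_lincomb:
  "grid_sum m S f (\<lambda>t. a * c t + b * d t) = a * grid_sum m S f c + b * grid_sum m S f d"
proof -
  have "grid_incr m S (\<lambda>t. a * c t + b * d t) j = a * grid_incr m S c j + b * grid_incr m S d j" for j
    by (simp add: grid_incr_def algebra_simps)
  then show ?thesis
    by (simp add: grid_sum_def sum_distrib_left sum.distrib[symmetric] algebra_simps)
qed

lemma grid_sum_nonneg:
  assumes "good_path T c" "S \<in> horizon T" "0 < S" "\<And>t. t \<in> {0..S} \<Longrightarrow> 0 \<le> f t"
  shows "0 \<le> grid_sum m S f c"
  unfolding grid_sum_def using assms
  by (auto intro!: sum_nonneg mult_nonneg_nonneg grid_incr_nonneg assms grid_bounds)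

lemma sum_grid_incr:
  "(\<Sum>j<k. grid_incr m S c j) = (if k = 0 then 0 else c (grid m S k))"
  by (induction k) (auto simp: grid_incr_def)

lemma grid_sum_bound:
  assumes "good_path T c" "S \<in> horizon T" "0 < S" "0 < m" "\<And>t. t \<in> {0..S} \<Longrightarrow> f t \<le> a"
  shows "grid_sum m S f c \<le> a * c S"
proof -
  have "grid_sum m S f c \<le> (\<Sum>j<m. a * grid_incr m S c j)"
    unfolding grid_sum_def using assms
    by (auto intro!: sum_mono mult_right_mono grid_incr_nonneg assms grid_bounds)
  also have "\<dots> = a * (\<Sum>j<m. grid_incr m S c j)" by (simp add: sum_distrib_left)
  also have "(\<Sum>j<m. grid_incr m S c j) = c S"
    using grid_last[of m S] assms by (simp add: sum_grid_incr)
  finally show ?thesis .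
qed

section \<open>Linearity of the integral in the path\<close>

locale nonneg_integrand =
  fixes T :: ereal and f :: "real \<Rightarrow> real"
  assumes T: "0 < T" and rc: "right_continuous_on (horizon T) f"
    and nn: "\<And>t. t \<in> horizon T \<Longrightarrow> 0 \<le> f t"
begin

lemma nn_upto: "S \<in> horizon T \<Longrightarrow> t \<in> {0..S} \<Longrightarrow> 0 \<le> f t"
  by (auto intro!: nn intro: horizon_le)

lemma borel_indicator:
  assumes "S \<in> horizon T" "0 < S"
  shows "(\<lambda>t. ennreal (f t) * indicator {0..S} t) \<in> borel_measurable borel"
proof -
  have "(\<lambda>t. ennreal (f t * indicator {0..S} t)) \<in> borel_measurable borel"
    using right_continuous_on_borel[OF rc assms] by measurable
  also have "(\<lambda>t. ennreal (f t * indicator {0..S} t)) = (\<lambda>t. ennreal (f t) * indicator {0..S} t)"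
    by (auto simp: indicator_def)
  finally show ?thesis .
qed

lemma upto_min_LIMSEQ:
  assumes c: "good_path T c" and S: "S \<in> horizon T" "0 < S"
  shows "(\<lambda>n. stieltjes_upto T S (\<lambda>t. min (f t) (real n)) c) \<longlonglongrightarrow> stieltjes_upto T S f c"
  unfolding stieltjes_upto_def
proof (rule nn_integral_LIMSEQ)
  interpret m: nonneg_integrand T "\<lambda>t. min (f t) (real n)" for n
    using T nn rc by unfold_locales (auto intro: min_right_continuous)
  show "(\<lambda>t. ennreal (min (f t) (real n)) * indicator {0..S} t) \<in> borel_measurable (stieltjes T c)" for n
    using m.borel_indicator[OF S] by measurable
  show "incseq (\<lambda>n t. ennreal (min (f t) (real n)) * indicator {0..S} t)"
    by (auto simp: incseq_def le_fun_def indicator_def intro!: ennreal_leI)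
  fix t
  have "(\<lambda>n. min (f t) (real n)) \<longlonglongrightarrow> f t"
  proof (rule tendsto_eventually)
    show "\<forall>\<^sub>F n in sequentially. min (f t) (real n) = f t"
      using eventually_ge_at_top[of "nat \<lceil>f t\<rceil>"]
      by eventually_elim (rule min_absorb1, linarith)
  qed
  then show "(\<lambda>n. ennreal (min (f t) (real n)) * indicator {0..S} t) \<longlonglongrightarrow> ennreal (f t) * indicator {0..S} t"
    by (auto simp: indicator_def intro!: tendsto_ennrealI)
qed

lemma upto_min_grid_LIMSEQ:
  assumes c: "good_path T c" and S: "S \<in> horizon T" "0 < S"
  shows "(\<lambda>m. ennreal (grid_sum (Suc m) S (\<lambda>t. min (f t) (real n)) c)) \<longlonglongrightarrow>
    stieltjes_upto T S (\<lambda>t. min (f t) (real n)) c"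
  using nn_upto[OF S(1)]
  by (intro stieltjes_upto_tendsto[OF c T min_right_continuous[OF rc] S, where a = "real n"]) auto

text \<open>Grid sums are linear in the path. They converge for truncated integrands, and the
  truncation is then removed by monotone convergence.\<close>

lemma upto_lincomb:
  assumes c: "good_path T c" "good_path T d" and S: "S \<in> horizon T" "0 < S" and a: "0 \<le> a" "0 \<le> b"
  shows "stieltjes_upto T S f (\<lambda>t. a * c t + b * d t) =
    ennreal a * stieltjes_upto T S f c + ennreal b * stieltjes_upto T S f d"
proof -
  have g: "good_path T (\<lambda>t. a * c t + b * d t)" by (rule good_path_lincomb[OF c a])
  have "stieltjes_upto T S (\<lambda>t. min (f t) (real n)) (\<lambda>t. a * c t + b * d t) =
    ennreal a * stieltjes_upto T S (\<lambda>t. min (f t) (real n)) c + ennreal b * stieltjes_upto T S (\<lambda>t. min (f t) (real n)) d" for n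
  proof (rule LIMSEQ_unique[OF upto_min_grid_LIMSEQ[OF g S]])
    have nn: "0 \<le> grid_sum m S (\<lambda>t. min (f t) (real n)) c" "0 \<le> grid_sum m S (\<lambda>t. min (f t) (real n)) d" for m
      using nn_upto[OF S(1)] by (intro grid_sum_nonneg[OF _ S] c; auto)+
    show "(\<lambda>m. ennreal (grid_sum (Suc m) S (\<lambda>t. min (f t) (real n)) (\<lambda>t. a * c t + b * d t)))
      \<longlonglongrightarrow> ennreal a * stieltjes_upto T S (\<lambda>t. min (f t) (real n)) c + ennreal b * stieltjes_upto T S (\<lambda>t. min (f t) (real n)) d"
      unfolding grid_sum_lincomb using a nn
      by (auto simp: ennreal_plus ennreal_mult intro!: tendsto_add ennreal_tendsto_cmult upto_min_grid_LIMSEQ c S)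
  qed
  then have "(\<lambda>n. ennreal a * stieltjes_upto T S (\<lambda>t. min (f t) (real n)) c + ennreal b * stieltjes_upto T S (\<lambda>t. min (f t) (real n)) d)
    \<longlonglongrightarrow> stieltjes_upto T S f (\<lambda>t. a * c t + b * d t)"
    using upto_min_LIMSEQ[OF g S] by simp
  moreover have "(\<lambda>n. ennreal a * stieltjes_upto T S (\<lambda>t. min (f t) (real n)) c + ennreal b * stieltjes_upto T S (\<lambda>t. min (f t) (real n)) d)
    \<longlonglongrightarrow> ennreal a * stieltjes_upto T S f c + ennreal b * stieltjes_upto T S f d"
    by (intro tendsto_add ennreal_tendsto_cmult upto_min_LIMSEQ c S) auto
  ultimately show ?thesis by (rule LIMSEQ_unique)
qed

lemma upto_mono:
  assumes c: "good_path T c" "good_path T (\<lambda>t. d t - c t)" and S: "S \<in> horizon T" "0 < S"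
  shows "stieltjes_upto T S f c \<le> stieltjes_upto T S f d"
  using upto_lincomb[OF c S, of 1 1] by simp

end

section \<open>Integrals over the whole horizon\<close>

definition stieltjes_integral :: "ereal \<Rightarrow> (real \<Rightarrow> real) \<Rightarrow> (real \<Rightarrow> real) \<Rightarrow> ennreal" where
  "stieltjes_integral T f c = (\<integral>\<^sup>+t\<in>horizon T. ennreal (f t) \<partial>(stieltjes T c))"

text \<open>A finite T is eventually attained, so that a point mass at T is counted in the
  limit.\<close>

definition horizon_exhaust :: "ereal \<Rightarrow> nat \<Rightarrow> real" where
  "horizon_exhaust T n = (if T = \<infinity> then real (Suc n) else min (real (Suc n)) (real_of_ereal T))"

lemma horizon_exhaust:
  assumes "0 < T"
  shows "horizon_exhaust T n \<in> horizon T" "0 < horizon_exhaust T n"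
    "incseq (horizon_exhaust T)" "\<And>t. t \<in> horizon T \<Longrightarrow> \<forall>\<^sub>F n in sequentially. t \<le> horizon_exhaust T n"
proof -
  show "horizon_exhaust T n \<in> horizon T" "0 < horizon_exhaust T n" "incseq (horizon_exhaust T)"
    using assms by (cases T; auto simp: horizon_exhaust_def horizon_def incseq_def)+
  fix t assume "t \<in> horizon T"
  moreover have "\<forall>\<^sub>F n in sequentially. t \<le> real (Suc n)"
    using eventually_ge_at_top[of "nat \<lceil>t\<rceil>"] by eventually_elim linarith
  ultimately show "\<forall>\<^sub>F n in sequentially. t \<le> horizon_exhaust T n"
    using assms by (cases T) (auto simp: horizon_exhaust_def horizon_def)
qed

lemma indicator_horizon_LIMSEQ:
  assumes "0 < T"
  shows "(\<lambda>n. indicator {0..horizon_exhaust T n} t :: 'b::{topological_space,zero_neq_one}) \<longlonglongrightarrow> indicator (horizon T) t"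
proof (cases "t \<in> horizon T")
  case True
  show ?thesis
    using horizon_exhaust(4)[OF assms True] True
    by (intro tendsto_eventually) (auto simp: horizon_def elim!: eventually_mono)
next
  case False
  then have "t \<notin> {0..horizon_exhaust T n}" for n
    using horizon_exhaust(1)[OF assms, of n] horizon_le by auto
  then show ?thesis using False by simp
qed

context nonneg_integrand
begin

lemma integral_LIMSEQ:
  "(\<lambda>n. stieltjes_upto T (horizon_exhaust T n) f c) \<longlonglongrightarrow> stieltjes_integral T f c"
  unfolding stieltjes_upto_def stieltjes_integral_def
proof (rule nn_integral_LIMSEQ)
  show "(\<lambda>t. ennreal (f t) * indicator {0..horizon_exhaust T n} t) \<in> borel_measurable (stieltjes T c)" for n
    using borel_indicator[OF horizon_exhaust(1,2)[OF T]] by measurable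
  show "incseq (\<lambda>n t. ennreal (f t) * indicator {0..horizon_exhaust T n} t)"
    using horizon_exhaust(3)[OF T]
    by (auto simp: incseq_def le_fun_def indicator_def intro: order_trans)
  show "(\<lambda>n. ennreal (f t) * indicator {0..horizon_exhaust T n} t) \<longlonglongrightarrow> ennreal (f t) * indicator (horizon T) t" for t
    by (intro ennreal_tendsto_cmult indicator_horizon_LIMSEQ T) simp
qed

lemma upto_le_integral: "S \<in> horizon T \<Longrightarrow> stieltjes_upto T S f c \<le> stieltjes_integral T f c"
  unfolding stieltjes_upto_def stieltjes_integral_def
  by (intro nn_integral_mono) (auto simp: indicator_def intro: horizon_le)

lemma integral_lincomb:
  assumes c: "good_path T c" "good_path T d" and a: "0 \<le> a" "0 \<le> b"
  shows "stieltjes_integral T f (\<lambda>t. a * c t + b * d t) =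
    ennreal a * stieltjes_integral T f c + ennreal b * stieltjes_integral T f d"
  by (rule LIMSEQ_unique[OF integral_LIMSEQ])
    (auto simp: upto_lincomb[OF c horizon_exhaust(1,2)[OF T] a]
      intro!: tendsto_add ennreal_tendsto_cmult integral_LIMSEQ)

lemma integral_zero: "stieltjes_integral T f (\<lambda>t. 0) = 0"
proof -
  have "good_path T (\<lambda>t. 0)"
    by (auto simp: good_path_def right_continuous_on_def mono_on_def)
  from integral_lincomb[OF this this, of 0 0] show ?thesis by simp
qed

text \<open>The mass of the point is at most the increment over each interval from
  \<open>X k\<close> to \<open>t\<close>, and these increments vanish.\<close>

lemma emeasure_atom_zero:
  assumes c: "good_path T c" and t: "t \<in> horizon T" and X: "\<And>k. X k \<in> {0..t}" "(\<lambda>k. c (X k)) \<longlonglongrightarrow> c t"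
    "\<And>k. X k < t"
  shows "emeasure (stieltjes T c) {t} = 0"
proof -
  have XH: "X k \<in> horizon T" for k using horizon_le[OF t] X(1) by auto
  have "emeasure (stieltjes T c) {t} \<le> ennreal (c t - c (X k))" for k
  proof -
    have "emeasure (stieltjes T c) {t} \<le> emeasure (stieltjes T c) {X k<..t}"
      using X by (intro emeasure_mono) auto
    also have "\<dots> = ennreal (c t - c (X k))"
      using X by (intro emeasure_stieltjes_Ioc[OF c T XH t]) (auto simp: less_imp_le)
    finally show ?thesis .
  qed
  moreover have "(\<lambda>k. ennreal (c t - c (X k))) \<longlonglongrightarrow> ennreal (c t - c t)"
    by (intro tendsto_ennrealI tendsto_diff tendsto_const X)
  ultimately have "emeasure (stieltjes T c) {t} \<le> ennreal (c t - c t)"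
    by (intro LIMSEQ_le_const) auto
  then show ?thesis by simp
qed

end

text \<open>Integrand and measure both depend on \<omega>. Measurability is inherited from grid
  sums, which involve finitely many random variables, through the limits in the mesh, the truncation
  level and the horizon.\<close>

lemma measurable_stieltjes:
  assumes int: "\<And>\<omega>. \<omega> \<in> space M \<Longrightarrow> nonneg_integrand T (\<lambda>t. f t \<omega>)"
    and gp: "\<And>\<omega>. \<omega> \<in> space M \<Longrightarrow> good_path T (\<lambda>t. c t \<omega>)"
    and f: "\<And>t. t \<in> horizon T \<Longrightarrow> f t \<in> borel_measurable M"
    and c: "\<And>t. t \<in> horizon T \<Longrightarrow> c t \<in> borel_measurable M"
    and T: "0 < T"
  shows "S \<in> horizon T \<Longrightarrow> 0 < S \<Longrightarrow> (\<lambda>\<omega>. stieltjes_upto T S (\<lambda>t. f t \<omega>) (\<lambda>t. c t \<omega>)) \<in> borel_measurable M"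
    and "(\<lambda>\<omega>. stieltjes_integral T (\<lambda>t. f t \<omega>) (\<lambda>t. c t \<omega>)) \<in> borel_measurable M"
proof -
  show *: "(\<lambda>\<omega>. stieltjes_upto T S (\<lambda>t. f t \<omega>) (\<lambda>t. c t \<omega>)) \<in> borel_measurable M"
    if S: "S \<in> horizon T" "0 < S" for S
  proof (rule borel_measurable_LIMSEQ_order)
    show "(\<lambda>n. stieltjes_upto T S (\<lambda>t. min (f t \<omega>) (real n)) (\<lambda>t. c t \<omega>)) \<longlonglongrightarrow> stieltjes_upto T S (\<lambda>t. f t \<omega>) (\<lambda>t. c t \<omega>)"
      if "\<omega> \<in> space M" for \<omega>
      using nonneg_integrand.upto_min_LIMSEQ[OF int gp S] that by auto
    fix n
    show "(\<lambda>\<omega>. stieltjes_upto T S (\<lambda>t. min (f t \<omega>) (real n)) (\<lambda>t. c t \<omega>)) \<in> borel_measurable M"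
    proof (rule borel_measurable_LIMSEQ_order)
      show "(\<lambda>m. ennreal (grid_sum (Suc m) S (\<lambda>t. min (f t \<omega>) (real n)) (\<lambda>t. c t \<omega>))) \<longlonglongrightarrow>
          stieltjes_upto T S (\<lambda>t. min (f t \<omega>) (real n)) (\<lambda>t. c t \<omega>)"
        if "\<omega> \<in> space M" for \<omega>
        using nonneg_integrand.upto_min_grid_LIMSEQ[OF int gp S] that by auto
      fix m
      have [measurable]: "f (grid (Suc m) S j) \<in> borel_measurable M" "c (grid (Suc m) S j) \<in> borel_measurable M" if "j \<le> Suc m" for j
        using that by (auto intro!: f c grid_horizon S)
      show "(\<lambda>\<omega>. ennreal (grid_sum (Suc m) S (\<lambda>t. min (f t \<omega>) (real n)) (\<lambda>t. c t \<omega>))) \<in> borel_measurable M"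
        unfolding grid_sum_def grid_incr_def
        by (auto intro!: measurable_compose[OF _ measurable_ennreal] borel_measurable_sum borel_measurable_times borel_measurable_diff borel_measurable_min)
    qed
  qed
  show "(\<lambda>\<omega>. stieltjes_integral T (\<lambda>t. f t \<omega>) (\<lambda>t. c t \<omega>)) \<in> borel_measurable M"
  proof (rule borel_measurable_LIMSEQ_order)
    show "(\<lambda>n. stieltjes_upto T (horizon_exhaust T n) (\<lambda>t. f t \<omega>) (\<lambda>t. c t \<omega>)) \<longlonglongrightarrow> stieltjes_integral T (\<lambda>t. f t \<omega>) (\<lambda>t. c t \<omega>)"
      if "\<omega> \<in> space M" for \<omega>
      using nonneg_integrand.integral_LIMSEQ[OF int] that by auto
  qed (intro * horizon_exhaust T)
qed

section \<open>Price processes as supermartingales\<close>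

lemma discount_path:
  assumes \<rho>: "measurable_process M T \<rho>" "uniformly_bounded M T \<rho>" "strictly_positive M T \<rho>"
    and \<omega>: "\<omega> \<in> space M" and s: "0 \<le> s" "s \<le> t" and t: "t \<in> horizon T"
  shows "discount \<rho> t \<omega> \<le> discount \<rho> s \<omega>" "discount \<rho> t \<omega> \<le> 1"
proof -
  obtain K where K: "\<And>t. t \<in> horizon T \<Longrightarrow> \<bar>\<rho> t \<omega>\<bar> \<le> K"
    using \<rho>(2) \<omega> by (auto simp: uniformly_bounded_def)
  have "(\<lambda>t. (\<lambda>(\<omega>, t). \<rho> t \<omega>) (\<omega>, t)) \<in> borel_measurable (restrict_space lborel (horizon T))"
    using \<rho>(1) \<omega> unfolding measurable_process_def prod_time_def
    by (intro measurable_compose[OF measurable_Pair1']) auto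
  then have m: "(\<lambda>t. indicator (horizon T) t *\<^sub>R \<rho> t \<omega>) \<in> borel_measurable lborel"
    by (subst (asm) borel_measurable_restrict_space_iff) auto
  have sub: "{0..t'} \<subseteq> horizon T" if "t' \<le> t" for t'
    using horizon_le[OF t] that by auto
  \<comment> \<open>Without integrability the integral would take the default value 0, and the
    discount factor could fail to be monotone; the bound on \<rho> excludes this.\<close>
  have int: "integrable lborel (\<lambda>u. indicator {0..t'} u *\<^sub>R \<rho> u \<omega>)" if "t' \<le> t" for t'
  proof (rule integrableI_bounded_set[where A = "{0..t'}" and B = K])
    have "(\<lambda>u. indicator {0..t'} u *\<^sub>R (indicator (horizon T) u *\<^sub>R \<rho> u \<omega>)) \<in> borel_measurable lborel"
      using m by measurable
    also have "(\<lambda>u. indicator {0..t'} u *\<^sub>R (indicator (horizon T) u *\<^sub>R \<rho> u \<omega>)) = (\<lambda>u. indicator {0..t'} u *\<^sub>R \<rho> u \<omega>)"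
      using sub[OF that] by (auto simp: fun_eq_iff indicator_def)
    finally show "(\<lambda>u. indicator {0..t'} u *\<^sub>R \<rho> u \<omega>) \<in> borel_measurable lborel" .
    show "emeasure lborel {0..t'} < \<infinity>" by (cases "0 \<le> t'") auto
    show "AE u in lborel. u \<in> {0..t'} \<longrightarrow> norm (indicator {0..t'} u *\<^sub>R \<rho> u \<omega>) \<le> K"
      using K sub[OF that] by (intro AE_I2) (auto simp: indicator_def)
  qed auto
  have pos: "0 \<le> \<rho> u \<omega>" if "0 \<le> u" "u \<le> t" for u
    using \<rho>(3) \<omega> sub[of t] that by (auto simp: strictly_positive_def less_imp_le)
  have "(LBINT u:{0..s}. \<rho> u \<omega>) \<le> (LBINT u:{0..t}. \<rho> u \<omega>)"
    unfolding set_lebesgue_integral_def using s pos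
    by (intro integral_mono int) (auto simp: indicator_def)
  then show "discount \<rho> t \<omega> \<le> discount \<rho> s \<omega>" by (simp add: discount_def)
  have "0 \<le> (LBINT u:{0..t}. \<rho> u \<omega>)"
    unfolding set_lebesgue_integral_def using pos
    by (intro integral_nonneg_AE AE_I2) (auto simp: indicator_def)
  then show "discount \<rho> t \<omega> \<le> 1" by (simp add: discount_def)
qed

text \<open>All paths are good, not just almost all, so that pathwise facts apply without
  exceptional sets; \<open>good_version\<close> supplies such processes.\<close>

definition increasing_process :: "'a measure \<Rightarrow> (real \<Rightarrow> 'a measure) \<Rightarrow> ereal \<Rightarrow> 'a process \<Rightarrow> bool" where
  "increasing_process M F T C \<longleftrightarrow> adapted F T C \<and> (\<forall>\<omega>\<in>space M. good_path T (\<lambda>t. C t \<omega>))"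

locale filtered_space = prob_space M for M :: "'a measure" +
  fixes F :: "real \<Rightarrow> 'a measure" and T :: ereal
  assumes T: "0 < T" and filt: "usual_filtration M F T"
begin

lemma subalg: "t \<in> horizon T \<Longrightarrow> subalgebra M (F t)"
  using filt by (auto simp: usual_filtration_def)

lemma F_mono: "s \<in> horizon T \<Longrightarrow> t \<in> horizon T \<Longrightarrow> s \<le> t \<Longrightarrow> sets (F s) \<subseteq> sets (F t)"
  using filt by (auto simp: usual_filtration_def)

lemma space_F: "t \<in> horizon T \<Longrightarrow> space (F t) = space M"
  using subalg by (auto simp: subalgebra_def)

lemma measurable_F_M: "f \<in> measurable (F t) N \<Longrightarrow> t \<in> horizon T \<Longrightarrow> f \<in> measurable M N"
  using measurable_from_subalg subalg by blast

lemma measurable_F_mono: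
  "f \<in> measurable (F s) N \<Longrightarrow> s \<in> horizon T \<Longrightarrow> t \<in> horizon T \<Longrightarrow> s \<le> t \<Longrightarrow> f \<in> measurable (F t) N"
  using F_mono[of s t] space_F[of s] space_F[of t] by (simp add: measurable_def subset_iff)

text \<open>This lets an increment play the role of the known factor \<open>Z\<close> in the
  supermartingale inequality at the right end of its cell.\<close>

lemma measurable_grid_incr:
  assumes "adapted F T C" "S \<in> horizon T" "0 < S" "j < m"
  shows "(\<lambda>\<omega>. grid_incr m S (\<lambda>t. C t \<omega>) j) \<in> borel_measurable (F (grid m S (Suc j)))"
proof -
  have h: "grid m S (Suc j) \<in> horizon T" "grid m S j \<in> horizon T" "grid m S j \<le> grid m S (Suc j)"
    using assms by (auto intro!: grid_horizon grid_mono)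
  then have m: "C (grid m S j) \<in> borel_measurable (F (grid m S (Suc j)))"
     "C (grid m S (Suc j)) \<in> borel_measurable (F (grid m S (Suc j)))"
    using assms(1) measurable_F_mono[OF _ h(2,1,3)] by (auto simp: adapted_def)
  show ?thesis unfolding grid_incr_def using m by (cases "j = 0") simp_all
qed

lemma nn_integral_grid_sum:
  assumes C: "increasing_process M F T C" and S: "S \<in> horizon T" "0 < S"
    and f: "\<And>t. t \<in> horizon T \<Longrightarrow> f t \<in> borel_measurable M"
      "\<And>t \<omega>. t \<in> horizon T \<Longrightarrow> \<omega> \<in> space M \<Longrightarrow> 0 \<le> f t \<omega>"
  shows "(\<integral>\<^sup>+\<omega>. ennreal (grid_sum m S (\<lambda>t. f t \<omega>) (\<lambda>t. C t \<omega>)) \<partial>M) =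
    (\<Sum>j<m. \<integral>\<^sup>+\<omega>. ennreal (grid_incr m S (\<lambda>t. C t \<omega>) j) * ennreal (f (grid m S (Suc j)) \<omega>) \<partial>M)"
proof -
  have H: "grid m S (Suc j) \<in> horizon T" if "j < m" for j
    using that by (intro grid_horizon S) auto
  have [measurable]: "(\<lambda>\<omega>. grid_incr m S (\<lambda>t. C t \<omega>) j) \<in> borel_measurable M" if "j < m" for j
    using C measurable_F_M[OF measurable_grid_incr[OF _ S that] H[OF that]] by (simp add: increasing_process_def)
  have [measurable]: "f (grid m S (Suc j)) \<in> borel_measurable M" if "j < m" for j
    using f(1) H[OF that] .
  have "(\<integral>\<^sup>+\<omega>. ennreal (grid_sum m S (\<lambda>t. f t \<omega>) (\<lambda>t. C t \<omega>)) \<partial>M) =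
    (\<integral>\<^sup>+\<omega>. (\<Sum>j<m. ennreal (grid_incr m S (\<lambda>t. C t \<omega>) j) * ennreal (f (grid m S (Suc j)) \<omega>)) \<partial>M)"
  proof (rule nn_integral_cong)
    fix \<omega> assume \<omega>: "\<omega> \<in> space M"
    have "0 \<le> f (grid m S (Suc j)) \<omega>" "0 \<le> grid_incr m S (\<lambda>t. C t \<omega>) j" if "j < m" for j
      using f(2)[OF H[OF that] \<omega>] grid_incr_nonneg[OF _ S that] C \<omega> by (auto simp: increasing_process_def)
    then show "ennreal (grid_sum m S (\<lambda>t. f t \<omega>) (\<lambda>t. C t \<omega>)) = (\<Sum>j<m. ennreal (grid_incr m S (\<lambda>t. C t \<omega>) j) * ennreal (f (grid m S (Suc j)) \<omega>))"
      unfolding grid_sum_def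
      by (subst sum_ennreal[symmetric]) (auto simp: ennreal_mult mult.commute intro!: sum.cong)
  qed
  also have "\<dots> = (\<Sum>j<m. \<integral>\<^sup>+\<omega>. ennreal (grid_incr m S (\<lambda>t. C t \<omega>) j) * ennreal (f (grid m S (Suc j)) \<omega>) \<partial>M)"
    by (rule nn_integral_sum) auto
  finally show ?thesis .
qed

end

section \<open>The supermartingale property and the cost of buying on a grid\<close>

locale price = filtered_space +
  fixes \<psi> :: "'a process"
  assumes price: "price_process M F T \<psi>" and pos: "strictly_positive M T \<psi>"
begin

lemma psi_adapted: "t \<in> horizon T \<Longrightarrow> \<psi> t \<in> borel_measurable (F t)"
  using price by (auto simp: price_process_def adapted_def)

lemma psi_measurable: "t \<in> horizon T \<Longrightarrow> \<psi> t \<in> borel_measurable M"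
  using psi_adapted measurable_F_M by blast

lemma psi_pos: "t \<in> horizon T \<Longrightarrow> \<omega> \<in> space M \<Longrightarrow> 0 < \<psi> t \<omega>"
  using pos by (auto simp: strictly_positive_def)

lemma psi_integrand: "\<omega> \<in> space M \<Longrightarrow> nonneg_integrand T (\<lambda>t. \<psi> t \<omega>)"
  using price T psi_pos
  by unfold_locales (auto simp: price_process_def right_continuous_process_def less_imp_le)

text \<open>What later arguments use of a price: it is dominated by a positive martingale
  \<open>Y\<close> started at 1, and its ratio to \<open>Y\<close> almost surely does not increase
  between two times. The martingale property is tested against nonnegative extended
  \<open>Z\<close>, so that integrability need not be carried along.\<close>

lemma martingale_part:
  obtains Y where
    "\<And>t. t \<in> horizon T \<Longrightarrow> Y t \<in> borel_measurable (F t)"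
    "\<And>t \<omega>. t \<in> horizon T \<Longrightarrow> \<omega> \<in> space M \<Longrightarrow> 0 < Y t \<omega>"
    "\<And>\<omega>. \<omega> \<in> space M \<Longrightarrow> Y 0 \<omega> = 1"
    "\<And>t. t \<in> horizon T \<Longrightarrow> integrable M (Y t)"
    "\<And>s t Z. s \<in> horizon T \<Longrightarrow> t \<in> horizon T \<Longrightarrow> s \<le> t \<Longrightarrow> Z \<in> borel_measurable (F s) \<Longrightarrow>
      (\<integral>\<^sup>+\<omega>. Z \<omega> * ennreal (Y t \<omega>) \<partial>M) = (\<integral>\<^sup>+\<omega>. Z \<omega> * ennreal (Y s \<omega>) \<partial>M)"
    "\<And>s t. s \<in> horizon T \<Longrightarrow> t \<in> horizon T \<Longrightarrow> s \<le> t \<Longrightarrow> AE \<omega> in M. \<psi> t \<omega> \<le> \<psi> s \<omega> / Y s \<omega> * Y t \<omega>"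
    "\<And>t. t \<in> horizon T \<Longrightarrow> AE \<omega> in M. \<psi> t \<omega> \<le> Y t \<omega>"
proof -
  obtain \<rho> Y where \<rho>: "measurable_process M T \<rho>" "uniformly_bounded M T \<rho>" "strictly_positive M T \<rho>"
    and Y: "exponential_martingale M F T Y"
    and eq: "\<And>t. t \<in> horizon T \<Longrightarrow> AE \<omega> in M. \<psi> t \<omega> = discount \<rho> t \<omega> * Y t \<omega>"
    using price by (auto simp: price_process_def)
  have m: "martingale M F T Y" using Y by (auto simp: exponential_martingale_def)
  obtain X where X: "\<And>\<omega>. \<omega> \<in> space M \<Longrightarrow> X 0 \<omega> = 0" "\<And>t \<omega>. t \<in> horizon T \<Longrightarrow> \<omega> \<in> space M \<Longrightarrow> Y t \<omega> = exp (X t \<omega>)"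
    using Y by (auto simp: exponential_martingale_def)
  have Ypos: "0 < Y t \<omega>" if "t \<in> horizon T" "\<omega> \<in> space M" for t \<omega> using X that by simp
  have YF: "Y t \<in> borel_measurable (F t)" if "t \<in> horizon T" for t
    using m that by (auto simp: martingale_def adapted_def)
  have Yint: "integrable M (Y t)" if "t \<in> horizon T" for t
    using m that by (auto simp: martingale_def)
  show thesis
  proof
    show "Y 0 \<omega> = 1" if "\<omega> \<in> space M" for \<omega>
      using X that zero_in_horizon[OF T] by simp
    fix s t Z assume st: "s \<in> horizon T" "t \<in> horizon T" "s \<le> t"
    interpret sigma_finite_subalgebra M "F s"
      using subalg[OF st(1)] finite_measure_axioms
      by (intro finite_measure_subalgebra_is_sigma_finite)
        (auto simp: finite_measure_subalgebra_def finite_measure_subalgebra_axioms_def)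
    have [measurable]: "Y t \<in> borel_measurable M" "Y s \<in> borel_measurable M"
      using YF st measurable_F_M by blast+
    \<comment> \<open>\<open>real_cond_exp\<close> is the difference of the real parts of two
      nonnegative conditional expectations. To recover an equation in the extended numbers, the
      first must be finite and the second, that of the negative part, must vanish.\<close>
    have fin: "(\<integral>\<^sup>+\<omega>. ennreal (Y t \<omega>) \<partial>M) < \<infinity>"
      using Yint[OF st(2)] Ypos[OF st(2)]
      by (subst nn_integral_eq_integral) (auto intro!: AE_I2 simp: less_imp_le)
    have "(\<integral>\<^sup>+\<omega>. nn_cond_exp M (F s) (\<lambda>\<omega>. ennreal (Y t \<omega>)) \<omega> \<partial>M) < \<infinity>"
      using nn_cond_exp_intg[of "\<lambda>_. 1" "\<lambda>\<omega>. ennreal (Y t \<omega>)"] fin by simp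
    then have 1: "AE \<omega> in M. nn_cond_exp M (F s) (\<lambda>\<omega>. ennreal (Y t \<omega>)) \<omega> < \<infinity>"
      by (intro nn_integral_noteq_infinite[THEN eventually_mono]) (auto simp: top.not_eq_extremum)
    have "AE \<omega> in M. nn_cond_exp M (F s) (\<lambda>\<omega>. ennreal (- Y t \<omega>)) \<omega> = nn_cond_exp M (F s) (\<lambda>\<omega>. 0) \<omega>"
      using Ypos[OF st(2)] by (intro nn_cond_exp_cong) (auto intro!: AE_I2 ennreal_neg simp: less_imp_le)
    moreover have "AE \<omega> in M. nn_cond_exp M (F s) (\<lambda>\<omega>. 0) \<omega> = 0"
      using nn_cond_exp_F_meas[of "\<lambda>_. 0"] by (auto elim: eventually_mono)
    ultimately have 2: "AE \<omega> in M. nn_cond_exp M (F s) (\<lambda>\<omega>. ennreal (- Y t \<omega>)) \<omega> = 0"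
      by eventually_elim simp
    have "AE \<omega> in M. real_cond_exp M (F s) (Y t) \<omega> = Y s \<omega>"
      using m st by (auto simp: martingale_def)
    then have 3: "AE \<omega> in M. nn_cond_exp M (F s) (\<lambda>\<omega>. ennreal (Y t \<omega>)) \<omega> = ennreal (Y s \<omega>)"
      using 1 2 by eventually_elim (auto simp: real_cond_exp_def, metis ennreal_enn2real)
    show "(\<integral>\<^sup>+\<omega>. Z \<omega> * ennreal (Y t \<omega>) \<partial>M) = (\<integral>\<^sup>+\<omega>. Z \<omega> * ennreal (Y s \<omega>) \<partial>M)"
      if Z: "Z \<in> borel_measurable (F s)"
    proof -
      have "(\<integral>\<^sup>+\<omega>. Z \<omega> * ennreal (Y t \<omega>) \<partial>M) = (\<integral>\<^sup>+\<omega>. Z \<omega> * nn_cond_exp M (F s) (\<lambda>\<omega>. ennreal (Y t \<omega>)) \<omega> \<partial>M)"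
        using Z by (subst nn_cond_exp_intg) auto
      also have "\<dots> = (\<integral>\<^sup>+\<omega>. Z \<omega> * ennreal (Y s \<omega>) \<partial>M)"
        using 3 by (intro nn_integral_cong_AE) auto
      finally show ?thesis .
    qed
    show "AE \<omega> in M. \<psi> t \<omega> \<le> \<psi> s \<omega> / Y s \<omega> * Y t \<omega>"
      using eq[OF st(1)] eq[OF st(2)] AE_space
    proof eventually_elim
      case (elim \<omega>)
      have "0 \<le> s" using st by (auto simp: horizon_def)
      have "\<psi> s \<omega> / Y s \<omega> = discount \<rho> s \<omega>"
        using elim(1) Ypos[OF st(1) elim(3)] by simp
      moreover have "discount \<rho> t \<omega> * Y t \<omega> \<le> discount \<rho> s \<omega> * Y t \<omega>"
        using Ypos[OF st(2) elim(3)] discount_path(1)[OF \<rho> elim(3) \<open>0 \<le> s\<close> st(3,2)]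
        by (simp add: mult_right_mono)
      ultimately show ?case using elim(2) by simp
    qed
  next
    fix t assume t: "t \<in> horizon T"
    then have "0 \<le> t" by (auto simp: horizon_def)
    show "AE \<omega> in M. \<psi> t \<omega> \<le> Y t \<omega>"
      using eq[OF t] AE_space
    proof eventually_elim
      case (elim \<omega>)
      show ?case using elim(1) Ypos[OF t elim(2)] discount_path(2)[OF \<rho> elim(2) \<open>0 \<le> t\<close> order_refl t]
        by (simp add: mult_le_cancel_right1)
    qed
  qed (use YF Ypos Yint in auto)
qed

text \<open>At time \<open>s\<close> the price is \<open>D\<close> times the martingale, and at time
  \<open>t\<close> it is at most that. As \<open>D\<close> is known at \<open>s\<close>, it can join
  \<open>Z\<close> in the martingale identity.\<close>

lemma supermartingale:
  assumes st: "s \<in> horizon T" "t \<in> horizon T" "s \<le> t" and Z [measurable]: "Z \<in> borel_measurable (F s)"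
  shows "(\<integral>\<^sup>+\<omega>. Z \<omega> * ennreal (\<psi> t \<omega>) \<partial>M) \<le> (\<integral>\<^sup>+\<omega>. Z \<omega> * ennreal (\<psi> s \<omega>) \<partial>M)"
proof -
  obtain Y where Y: "\<And>t. t \<in> horizon T \<Longrightarrow> Y t \<in> borel_measurable (F t)"
    "\<And>t \<omega>. t \<in> horizon T \<Longrightarrow> \<omega> \<in> space M \<Longrightarrow> 0 < Y t \<omega>"
    "\<And>s t Z. s \<in> horizon T \<Longrightarrow> t \<in> horizon T \<Longrightarrow> s \<le> t \<Longrightarrow> Z \<in> borel_measurable (F s) \<Longrightarrow>
      (\<integral>\<^sup>+\<omega>. Z \<omega> * ennreal (Y t \<omega>) \<partial>M) = (\<integral>\<^sup>+\<omega>. Z \<omega> * ennreal (Y s \<omega>) \<partial>M)"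
    "\<And>s t. s \<in> horizon T \<Longrightarrow> t \<in> horizon T \<Longrightarrow> s \<le> t \<Longrightarrow> AE \<omega> in M. \<psi> t \<omega> \<le> \<psi> s \<omega> / Y s \<omega> * Y t \<omega>"
    by (rule martingale_part) blast
  define D where "D \<omega> = \<psi> s \<omega> / Y s \<omega>" for \<omega>
  have [measurable]: "D \<in> borel_measurable (F s)"
    unfolding D_def[abs_def] using psi_adapted[OF st(1)] Y(1)[OF st(1)] by measurable
  have D: "0 < D \<omega>" if "\<omega> \<in> space M" for \<omega>
    using Y(2)[OF st(1) that] psi_pos[OF st(1) that] by (simp add: D_def)
  have "(\<integral>\<^sup>+\<omega>. Z \<omega> * ennreal (\<psi> t \<omega>) \<partial>M) \<le> (\<integral>\<^sup>+\<omega>. Z \<omega> * ennreal (D \<omega> * Y t \<omega>) \<partial>M)"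
    using Y(4)[OF st] by (intro nn_integral_mono_AE) (auto simp: D_def intro!: mult_left_mono ennreal_leI)
  also have "\<dots> = (\<integral>\<^sup>+\<omega>. (Z \<omega> * ennreal (D \<omega>)) * ennreal (Y t \<omega>) \<partial>M)"
    using D Y(2)[OF st(2)] by (intro nn_integral_cong) (auto simp: ennreal_mult less_imp_le mult.assoc)
  also have "\<dots> = (\<integral>\<^sup>+\<omega>. (Z \<omega> * ennreal (D \<omega>)) * ennreal (Y s \<omega>) \<partial>M)"
    by (intro Y(3) st) measurable
  also have "\<dots> = (\<integral>\<^sup>+\<omega>. Z \<omega> * ennreal (\<psi> s \<omega>) \<partial>M)"
  proof (rule nn_integral_cong)
    fix \<omega> assume \<omega>: "\<omega> \<in> space M"
    have "ennreal (D \<omega>) * ennreal (Y s \<omega>) = ennreal (D \<omega> * Y s \<omega>)"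
      using D[OF \<omega>] Y(2)[OF st(1) \<omega>] by (simp add: ennreal_mult)
    also have "D \<omega> * Y s \<omega> = \<psi> s \<omega>"
      using Y(2)[OF st(1) \<omega>] by (simp add: D_def)
    finally show "Z \<omega> * ennreal (D \<omega>) * ennreal (Y s \<omega>) = Z \<omega> * ennreal (\<psi> s \<omega>)"
      by (simp add: mult.assoc)
  qed
  finally show ?thesis .
qed

text \<open>The martingale factor starts at 1 and dominates the price. Deterministic integrable
  consumption therefore has finite cost.\<close>

lemma expected_price_le_1:
  assumes t: "t \<in> horizon T"
  shows "(\<integral>\<^sup>+\<omega>. ennreal (\<psi> t \<omega>) \<partial>M) \<le> 1"
proof -
  obtain Y where Y: "\<And>\<omega>. \<omega> \<in> space M \<Longrightarrow> Y 0 \<omega> = 1"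
    "\<And>s t Z. s \<in> horizon T \<Longrightarrow> t \<in> horizon T \<Longrightarrow> s \<le> t \<Longrightarrow> Z \<in> borel_measurable (F s) \<Longrightarrow>
      (\<integral>\<^sup>+\<omega>. Z \<omega> * ennreal (Y t \<omega>) \<partial>M) = (\<integral>\<^sup>+\<omega>. Z \<omega> * ennreal (Y s \<omega>) \<partial>M)"
    "\<And>t. t \<in> horizon T \<Longrightarrow> AE \<omega> in M. \<psi> t \<omega> \<le> Y t \<omega>"
    by (rule martingale_part) blast
  have "(\<integral>\<^sup>+\<omega>. ennreal (\<psi> t \<omega>) \<partial>M) \<le> (\<integral>\<^sup>+\<omega>. 1 * ennreal (Y t \<omega>) \<partial>M)"
    using Y(3)[OF t] by (intro nn_integral_mono_AE) (auto intro!: ennreal_leI)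
  also have "\<dots> = (\<integral>\<^sup>+\<omega>. 1 * ennreal (Y 0 \<omega>) \<partial>M)"
    using t zero_in_horizon[OF T] by (intro Y(2)) (auto simp: horizon_def)
  also have "\<dots> = (\<integral>\<^sup>+\<omega>. 1 \<partial>M)" using Y(1) by (intro nn_integral_cong) auto
  also have "\<dots> = 1" by (simp add: emeasure_space_1)
  finally show ?thesis .
qed

text \<open>On the finer grid each piece of an increment is bought earlier, at a time when it is
  already known; in expectation the earlier purchase is at least as expensive.\<close>

lemma grid_sum_refine:
  assumes C: "increasing_process M F T C" and S: "S \<in> horizon T" "0 < S" and l: "0 < l"
  shows "(\<integral>\<^sup>+\<omega>. ennreal (grid_sum m S (\<lambda>t. \<psi> t \<omega>) (\<lambda>t. C t \<omega>)) \<partial>M) \<le>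
    (\<integral>\<^sup>+\<omega>. ennreal (grid_sum (m * l) S (\<lambda>t. \<psi> t \<omega>) (\<lambda>t. C t \<omega>)) \<partial>M)"
proof -
  have psi0: "0 \<le> \<psi> t \<omega>" if "t \<in> horizon T" "\<omega> \<in> space M" for t \<omega>
    using psi_pos that by (simp add: less_imp_le)
  define \<Delta> where "\<Delta> i \<omega> = grid_incr (m * l) S (\<lambda>t. C t \<omega>) i" for i \<omega>
  have \<Delta>0: "0 \<le> \<Delta> i \<omega>" if "i < m * l" "\<omega> \<in> space M" for i \<omega>
    using C S that by (auto simp: \<Delta>_def increasing_process_def intro!: grid_incr_nonneg)
  have \<Delta>F: "\<Delta> i \<in> borel_measurable (F (grid (m * l) S (Suc i)))" if "i < m * l" for i
    using C S that by (auto simp: \<Delta>_def[abs_def] increasing_process_def intro!: measurable_grid_incr)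
  have g: "grid (m * l) S (j * l) = grid m S j" for j
    using l by (simp add: grid_def)
  have split: "grid_incr m S (\<lambda>t. C t \<omega>) j = (\<Sum>i\<in>{j*l..<j*l+l}. \<Delta> i \<omega>)" for j \<omega>
  proof -
    have "(\<Sum>i\<in>{j*l..<j*l+l}. \<Delta> i \<omega>) = (\<Sum>i\<in>{0..<j*l+l}. \<Delta> i \<omega>) - (\<Sum>i\<in>{0..<j*l}. \<Delta> i \<omega>)"
      by (rule sum_diff_nat_ivl[symmetric]) auto
    also have "\<dots> = (\<Sum>i<Suc j * l. \<Delta> i \<omega>) - (\<Sum>i<j*l. \<Delta> i \<omega>)"
      by (simp add: lessThan_atLeast0 add.commute)
    also have "\<dots> = grid_incr m S (\<lambda>t. C t \<omega>) j"
      unfolding \<Delta>_def sum_grid_incr g using l by (simp add: grid_incr_def)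
    finally show ?thesis by simp
  qed
  have ij: "i < m * l \<and> grid (m * l) S (Suc i) \<le> grid m S (Suc j)"
    if "j < m" "i \<in> {j*l..<j*l+l}" for i j
  proof -
    have "Suc i \<le> Suc j * l" using that by simp
    moreover have "Suc j * l \<le> m * l" using that by (intro mult_right_mono) auto
    ultimately show ?thesis using grid_mono[OF S(2), of "Suc i" "Suc j * l" "m * l"] unfolding g by auto
  qed
  have "(\<integral>\<^sup>+\<omega>. ennreal (grid_sum m S (\<lambda>t. \<psi> t \<omega>) (\<lambda>t. C t \<omega>)) \<partial>M) =
    (\<Sum>j<m. \<integral>\<^sup>+\<omega>. ennreal (grid_incr m S (\<lambda>t. C t \<omega>) j) * ennreal (\<psi> (grid m S (Suc j)) \<omega>) \<partial>M)"
    by (rule nn_integral_grid_sum[OF C S psi_measurable psi0])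
  also have "\<dots> \<le> (\<Sum>j<m. \<Sum>i\<in>{j*l..<j*l+l}. \<integral>\<^sup>+\<omega>. ennreal (\<Delta> i \<omega>) * ennreal (\<psi> (grid (m*l) S (Suc i)) \<omega>) \<partial>M)"
  proof (rule sum_mono)
    fix j assume "j \<in> {..<m}" then have j: "j < m" by simp
    have H: "grid m S (Suc j) \<in> horizon T" using j S by (intro grid_horizon) auto
    have [measurable]: "\<psi> (grid m S (Suc j)) \<in> borel_measurable M"
      using psi_measurable H by auto
    have [measurable]: "\<Delta> i \<in> borel_measurable M" if "i \<in> {j*l..<j*l+l}" for i
      using ij[OF j that] S by (intro measurable_F_M[OF \<Delta>F] grid_horizon) auto
    have "(\<integral>\<^sup>+\<omega>. ennreal (grid_incr m S (\<lambda>t. C t \<omega>) j) * ennreal (\<psi> (grid m S (Suc j)) \<omega>) \<partial>M) =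
      (\<integral>\<^sup>+\<omega>. (\<Sum>i\<in>{j*l..<j*l+l}. ennreal (\<Delta> i \<omega>) * ennreal (\<psi> (grid m S (Suc j)) \<omega>)) \<partial>M)"
      unfolding split using ij[OF j] \<Delta>0
      by (intro nn_integral_cong) (subst sum_ennreal[symmetric], auto simp: sum_distrib_right)
    also have "\<dots> = (\<Sum>i\<in>{j*l..<j*l+l}. \<integral>\<^sup>+\<omega>. ennreal (\<Delta> i \<omega>) * ennreal (\<psi> (grid m S (Suc j)) \<omega>) \<partial>M)"
      by (rule nn_integral_sum) auto
    also have "\<dots> \<le> (\<Sum>i\<in>{j*l..<j*l+l}. \<integral>\<^sup>+\<omega>. ennreal (\<Delta> i \<omega>) * ennreal (\<psi> (grid (m*l) S (Suc i)) \<omega>) \<partial>M)"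
    proof (rule sum_mono)
      fix i assume i: "i \<in> {j*l..<j*l+l}"
      note ij[OF j i]
      moreover then have "grid (m*l) S (Suc i) \<in> horizon T" using S by (intro grid_horizon) auto
      ultimately show "(\<integral>\<^sup>+\<omega>. ennreal (\<Delta> i \<omega>) * ennreal (\<psi> (grid m S (Suc j)) \<omega>) \<partial>M)
        \<le> (\<integral>\<^sup>+\<omega>. ennreal (\<Delta> i \<omega>) * ennreal (\<psi> (grid (m*l) S (Suc i)) \<omega>) \<partial>M)"
        using H \<Delta>F[of i] by (intro supermartingale) auto
    qed
    finally show "(\<integral>\<^sup>+\<omega>. ennreal (grid_incr m S (\<lambda>t. C t \<omega>) j) * ennreal (\<psi> (grid m S (Suc j)) \<omega>) \<partial>M) \<le>
      (\<Sum>i\<in>{j*l..<j*l+l}. \<integral>\<^sup>+\<omega>. ennreal (\<Delta> i \<omega>) * ennreal (\<psi> (grid (m*l) S (Suc i)) \<omega>) \<partial>M)" .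
  qed
  also have "\<dots> = (\<Sum>i<m*l. \<integral>\<^sup>+\<omega>. ennreal (\<Delta> i \<omega>) * ennreal (\<psi> (grid (m*l) S (Suc i)) \<omega>) \<partial>M)"
    by (rule sum.nat_group)
  also have "\<dots> = (\<integral>\<^sup>+\<omega>. ennreal (grid_sum (m * l) S (\<lambda>t. \<psi> t \<omega>) (\<lambda>t. C t \<omega>)) \<partial>M)"
    unfolding \<Delta>_def by (rule nn_integral_grid_sum[OF C S psi_measurable psi0, symmetric])
  finally show ?thesis .
qed

text \<open>The positive part of \<open>Y - a\<close> is a submartingale: the event that
  \<open>Y s\<close> is at least \<open>a\<close> is known at \<open>s\<close>, and on it the
  integral of \<open>Y - a\<close> is preserved. Thus the excess of the price over a truncation
  level is bounded, at all grid times, by that of \<open>Y\<close> at one later time.\<close>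

lemma excess_mono:
  assumes C: "s \<in> horizon T" "t \<in> horizon T" "s \<le> t" and Z [measurable]: "Z \<in> borel_measurable (F s)"
    and b: "\<And>\<omega>. \<omega> \<in> space M \<Longrightarrow> Z \<omega> \<le> ennreal b"
    and a: "0 \<le> a"
    and Y: "\<And>t. t \<in> horizon T \<Longrightarrow> Y t \<in> borel_measurable (F t)"
    "\<And>t \<omega>. t \<in> horizon T \<Longrightarrow> \<omega> \<in> space M \<Longrightarrow> 0 < Y t \<omega>"
    and mart: "\<And>Z. Z \<in> borel_measurable (F s) \<Longrightarrow>
      (\<integral>\<^sup>+\<omega>. Z \<omega> * ennreal (Y t \<omega>) \<partial>M) = (\<integral>\<^sup>+\<omega>. Z \<omega> * ennreal (Y s \<omega>) \<partial>M)"
    and le: "AE \<omega> in M. \<psi> s \<omega> \<le> Y s \<omega>"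
  shows "(\<integral>\<^sup>+\<omega>. Z \<omega> * ennreal (\<psi> s \<omega> - a) \<partial>M) \<le> (\<integral>\<^sup>+\<omega>. Z \<omega> * ennreal (Y t \<omega> - a) \<partial>M)"
proof -
  define I where "I \<omega> = (if a \<le> Y s \<omega> then Z \<omega> else 0)" for \<omega>
  have YM [measurable]: "Y s \<in> borel_measurable M" "Y t \<in> borel_measurable M" "Z \<in> borel_measurable M"
    using Y(1) Z C measurable_F_M by blast+
  have YF [measurable]: "Y s \<in> borel_measurable (F s)" using Y(1) C by blast
  have IF [measurable]: "I \<in> borel_measurable (F s)" unfolding I_def[abs_def] by measurable
  have [measurable]: "I \<in> borel_measurable M" using measurable_F_M[OF IF C(1)] .
  \<comment> \<open>The bound on \<open>Z\<close> makes this term finite, so that it can be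
    cancelled below.\<close>
  have fin: "(\<integral>\<^sup>+\<omega>. I \<omega> * ennreal a \<partial>M) \<noteq> \<infinity>"
  proof -
    have "(\<integral>\<^sup>+\<omega>. I \<omega> * ennreal a \<partial>M) \<le> (\<integral>\<^sup>+\<omega>. ennreal b * ennreal a \<partial>M)"
      using b by (intro nn_integral_mono mult_right_mono) (auto simp: I_def)
    also have "\<dots> < \<infinity>" by (simp add: emeasure_space_1 ennreal_mult_less_top)
    finally show ?thesis by simp
  qed
  have "(\<integral>\<^sup>+\<omega>. I \<omega> * ennreal (Y s \<omega> - a) \<partial>M) + (\<integral>\<^sup>+\<omega>. I \<omega> * ennreal a \<partial>M) = (\<integral>\<^sup>+\<omega>. I \<omega> * ennreal (Y s \<omega>) \<partial>M)"
    using a by (subst nn_integral_add[symmetric]) (auto simp: I_def distrib_left[symmetric] ennreal_plus[symmetric] simp del: ennreal_plus intro!: nn_integral_cong)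
  also have "\<dots> = (\<integral>\<^sup>+\<omega>. I \<omega> * ennreal (Y t \<omega>) \<partial>M)"
    by (rule mart[OF IF, symmetric])
  also have "\<dots> \<le> (\<integral>\<^sup>+\<omega>. I \<omega> * ennreal (Y t \<omega> - a) + I \<omega> * ennreal a \<partial>M)"
  proof (intro nn_integral_mono)
    fix \<omega>
    have "ennreal (Y t \<omega>) \<le> ennreal (max 0 (Y t \<omega> - a) + a)" by (intro ennreal_leI) auto
    also have "\<dots> = ennreal (Y t \<omega> - a) + ennreal a" using a
      by (subst ennreal_plus) (auto simp: max_def ennreal_neg)
    finally show "I \<omega> * ennreal (Y t \<omega>) \<le> I \<omega> * ennreal (Y t \<omega> - a) + I \<omega> * ennreal a"
      by (simp add: distrib_left[symmetric] mult_left_mono)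
  qed
  also have "\<dots> = (\<integral>\<^sup>+\<omega>. I \<omega> * ennreal (Y t \<omega> - a) \<partial>M) + (\<integral>\<^sup>+\<omega>. I \<omega> * ennreal a \<partial>M)"
    by (rule nn_integral_add) auto
  finally have "(\<integral>\<^sup>+\<omega>. I \<omega> * ennreal (Y s \<omega> - a) \<partial>M) \<le> (\<integral>\<^sup>+\<omega>. I \<omega> * ennreal (Y t \<omega> - a) \<partial>M)"
    using fin by (simp add: ennreal_add_left_cancel_le add.commute)
  moreover have "(\<integral>\<^sup>+\<omega>. Z \<omega> * ennreal (\<psi> s \<omega> - a) \<partial>M) \<le> (\<integral>\<^sup>+\<omega>. I \<omega> * ennreal (Y s \<omega> - a) \<partial>M)"
    using le by (intro nn_integral_mono_AE) (auto simp: I_def ennreal_neg intro!: mult_left_mono ennreal_leI)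
  moreover have "(\<integral>\<^sup>+\<omega>. I \<omega> * ennreal (Y t \<omega> - a) \<partial>M) \<le> (\<integral>\<^sup>+\<omega>. Z \<omega> * ennreal (Y t \<omega> - a) \<partial>M)"
    by (intro nn_integral_mono) (auto simp: I_def)
  ultimately show ?thesis by order
qed

text \<open>Refinement raises the grid cost, but convergence to the path integral is known only for
  truncated prices. Since \<open>C S\<close> is bounded, the truncation error is at most
  \<open>b * ex n\<close> for every grid; so the mesh may tend to 0 first, and the truncation level
  to infinity afterwards.\<close>

lemma grid_sum_le_upto_bounded:
  assumes C: "increasing_process M F T C" and S: "S \<in> horizon T" "0 < S" and m: "0 < m"
    and b: "\<And>\<omega>. \<omega> \<in> space M \<Longrightarrow> C S \<omega> \<le> b"
  shows "(\<integral>\<^sup>+\<omega>. ennreal (grid_sum m S (\<lambda>t. \<psi> t \<omega>) (\<lambda>t. C t \<omega>)) \<partial>M) \<le>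
    (\<integral>\<^sup>+\<omega>. stieltjes_upto T S (\<lambda>t. \<psi> t \<omega>) (\<lambda>t. C t \<omega>) \<partial>M)" (is "?L \<le> ?R")
proof -
  obtain Y where Y: "\<And>t. t \<in> horizon T \<Longrightarrow> Y t \<in> borel_measurable (F t)"
    "\<And>t \<omega>. t \<in> horizon T \<Longrightarrow> \<omega> \<in> space M \<Longrightarrow> 0 < Y t \<omega>"
    and int: "\<And>t. t \<in> horizon T \<Longrightarrow> integrable M (Y t)"
    and mart: "\<And>s t Z. s \<in> horizon T \<Longrightarrow> t \<in> horizon T \<Longrightarrow> s \<le> t \<Longrightarrow> Z \<in> borel_measurable (F s) \<Longrightarrow>
      (\<integral>\<^sup>+\<omega>. Z \<omega> * ennreal (Y t \<omega>) \<partial>M) = (\<integral>\<^sup>+\<omega>. Z \<omega> * ennreal (Y s \<omega>) \<partial>M)"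
    and le: "\<And>t. t \<in> horizon T \<Longrightarrow> AE \<omega> in M. \<psi> t \<omega> \<le> Y t \<omega>"
    by (rule martingale_part) blast
  have YS [measurable]: "Y S \<in> borel_measurable M" using Y(1) S measurable_F_M by blast
  have CA: "adapted F T C" and gp: "\<And>\<omega>. \<omega> \<in> space M \<Longrightarrow> good_path T (\<lambda>t. C t \<omega>)"
    using C by (auto simp: increasing_process_def)
  have Cnn: "0 \<le> C S \<omega>" if "\<omega> \<in> space M" for \<omega> using gp[OF that] S by (auto simp: good_path_def)
  have b0: "0 \<le> b" using Cnn b not_empty by (metis ex_in_conv order_trans)
  have psi0: "0 \<le> \<psi> t \<omega>" if "t \<in> horizon T" "\<omega> \<in> space M" for t \<omega>
    using psi_pos that by (simp add: less_imp_le)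
  have min_meas: "(\<lambda>\<omega>. min (\<psi> t \<omega>) (real n)) \<in> borel_measurable M" if "t \<in> horizon T" for t n
    using psi_measurable[OF that] by measurable
  define ex where "ex n = (\<integral>\<^sup>+\<omega>. ennreal (Y S \<omega> - real n) \<partial>M)" for n
  have trunc: "(\<integral>\<^sup>+\<omega>. ennreal (grid_sum k S (\<lambda>t. \<psi> t \<omega>) (\<lambda>t. C t \<omega>)) \<partial>M) \<le>
    (\<integral>\<^sup>+\<omega>. ennreal (grid_sum k S (\<lambda>t. min (\<psi> t \<omega>) (real n)) (\<lambda>t. C t \<omega>)) \<partial>M) + ennreal b * ex n"
    if k: "0 < k" for k n
  proof -
    define \<Delta> where "\<Delta> j \<omega> = grid_incr k S (\<lambda>t. C t \<omega>) j" for j \<omega>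
    have \<Delta>0: "0 \<le> \<Delta> j \<omega>" if "j < k" "\<omega> \<in> space M" for j \<omega>
      using gp S that by (auto simp: \<Delta>_def intro!: grid_incr_nonneg)
    have \<Delta>_sum: "(\<Sum>j<k. \<Delta> j \<omega>) = C S \<omega>" for \<omega>
      unfolding \<Delta>_def sum_grid_incr using k by (simp add: grid_last)
    have \<Delta>b: "\<Delta> j \<omega> \<le> b" if "j < k" "\<omega> \<in> space M" for j \<omega>
      using member_le_sum[of j "{..<k}" "\<lambda>j. \<Delta> j \<omega>"] \<Delta>0 that b[OF that(2)] \<Delta>_sum[of \<omega>] by auto
    have H: "grid k S (Suc j) \<in> horizon T" if "j < k" for j using that S by (intro grid_horizon) auto
    have \<Delta>F: "\<Delta> j \<in> borel_measurable (F (grid k S (Suc j)))" if "j < k" for j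
      using CA S that by (auto simp: \<Delta>_def[abs_def] intro!: measurable_grid_incr)
    have [measurable]: "\<Delta> j \<in> borel_measurable M" "\<psi> (grid k S (Suc j)) \<in> borel_measurable M" if "j < k" for j
      using measurable_F_M[OF \<Delta>F H] psi_measurable[OF H] that by auto
    have "(\<integral>\<^sup>+\<omega>. ennreal (grid_sum k S (\<lambda>t. \<psi> t \<omega>) (\<lambda>t. C t \<omega>)) \<partial>M) =
      (\<Sum>j<k. \<integral>\<^sup>+\<omega>. ennreal (\<Delta> j \<omega>) * ennreal (\<psi> (grid k S (Suc j)) \<omega>) \<partial>M)"
      unfolding \<Delta>_def by (rule nn_integral_grid_sum[OF C S psi_measurable psi0])
    also have "\<dots> \<le> (\<Sum>j<k. (\<integral>\<^sup>+\<omega>. ennreal (\<Delta> j \<omega>) * ennreal (min (\<psi> (grid k S (Suc j)) \<omega>) (real n)) \<partial>M)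
      + (\<integral>\<^sup>+\<omega>. ennreal (\<Delta> j \<omega>) * ennreal (Y S \<omega> - real n) \<partial>M))"
    proof (rule sum_mono)
      fix j assume "j \<in> {..<k}" then have j: "j < k" by simp
      let ?p = "\<psi> (grid k S (Suc j))"
      have "(\<integral>\<^sup>+\<omega>. ennreal (\<Delta> j \<omega>) * ennreal (?p \<omega>) \<partial>M) \<le>
        (\<integral>\<^sup>+\<omega>. ennreal (\<Delta> j \<omega>) * ennreal (min (?p \<omega>) (real n)) + ennreal (\<Delta> j \<omega>) * ennreal (?p \<omega> - real n) \<partial>M)"
      proof (rule nn_integral_mono)
        fix \<omega> assume \<omega>: "\<omega> \<in> space M"
        have "ennreal (?p \<omega>) = ennreal (min (?p \<omega>) (real n) + max 0 (?p \<omega> - real n))"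
          by (rule arg_cong[where f = ennreal]) auto
        also have "\<dots> = ennreal (min (?p \<omega>) (real n)) + ennreal (?p \<omega> - real n)"
          using psi0[OF H[OF j] \<omega>] by (subst ennreal_plus) (auto simp: max_def ennreal_neg)
        finally show "ennreal (\<Delta> j \<omega>) * ennreal (?p \<omega>) \<le> ennreal (\<Delta> j \<omega>) * ennreal (min (?p \<omega>) (real n)) + ennreal (\<Delta> j \<omega>) * ennreal (?p \<omega> - real n)"
          by (simp add: distrib_left)
      qed
      also have "\<dots> = (\<integral>\<^sup>+\<omega>. ennreal (\<Delta> j \<omega>) * ennreal (min (?p \<omega>) (real n)) \<partial>M) + (\<integral>\<^sup>+\<omega>. ennreal (\<Delta> j \<omega>) * ennreal (?p \<omega> - real n) \<partial>M)"
        using j by (intro nn_integral_add) auto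
      also have "(\<integral>\<^sup>+\<omega>. ennreal (\<Delta> j \<omega>) * ennreal (?p \<omega> - real n) \<partial>M) \<le> (\<integral>\<^sup>+\<omega>. ennreal (\<Delta> j \<omega>) * ennreal (Y S \<omega> - real n) \<partial>M)"
      proof (rule excess_mono[where b = b and Y = Y])
        show "grid k S (Suc j) \<le> S" using S j by (intro grid_bounds) auto
        then show "(\<integral>\<^sup>+\<omega>. Z \<omega> * ennreal (Y S \<omega>) \<partial>M) = (\<integral>\<^sup>+\<omega>. Z \<omega> * ennreal (Y (grid k S (Suc j)) \<omega>) \<partial>M)"
          if "Z \<in> borel_measurable (F (grid k S (Suc j)))" for Z
          using H[OF j] S that by (intro mart) auto
      qed (use H[OF j] S \<Delta>F[OF j] \<Delta>b[OF j] Y le[OF H[OF j]] in \<open>auto intro!: ennreal_leI\<close>)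
      finally show "(\<integral>\<^sup>+\<omega>. ennreal (\<Delta> j \<omega>) * ennreal (?p \<omega>) \<partial>M) \<le>
        (\<integral>\<^sup>+\<omega>. ennreal (\<Delta> j \<omega>) * ennreal (min (?p \<omega>) (real n)) \<partial>M) + (\<integral>\<^sup>+\<omega>. ennreal (\<Delta> j \<omega>) * ennreal (Y S \<omega> - real n) \<partial>M)"
        by (simp add: add_left_mono)
    qed
    also have "\<dots> = (\<integral>\<^sup>+\<omega>. ennreal (grid_sum k S (\<lambda>t. min (\<psi> t \<omega>) (real n)) (\<lambda>t. C t \<omega>)) \<partial>M)
      + (\<Sum>j<k. \<integral>\<^sup>+\<omega>. ennreal (\<Delta> j \<omega>) * ennreal (Y S \<omega> - real n) \<partial>M)"
      unfolding sum.distrib \<Delta>_def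
      by (subst nn_integral_grid_sum[OF C S min_meas]) (auto simp: psi0)
    also have "(\<Sum>j<k. \<integral>\<^sup>+\<omega>. ennreal (\<Delta> j \<omega>) * ennreal (Y S \<omega> - real n) \<partial>M) =
      (\<integral>\<^sup>+\<omega>. (\<Sum>j<k. ennreal (\<Delta> j \<omega>) * ennreal (Y S \<omega> - real n)) \<partial>M)"
      by (rule nn_integral_sum[symmetric]) auto
    also have "\<dots> = (\<integral>\<^sup>+\<omega>. ennreal (C S \<omega>) * ennreal (Y S \<omega> - real n) \<partial>M)"
      unfolding \<Delta>_sum[symmetric] using \<Delta>0
      by (intro nn_integral_cong) (subst sum_ennreal[symmetric], auto simp: sum_distrib_right)
    also have "\<dots> \<le> (\<integral>\<^sup>+\<omega>. ennreal b * ennreal (Y S \<omega> - real n) \<partial>M)"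
      using b by (intro nn_integral_mono mult_right_mono ennreal_leI) auto
    also have "\<dots> = ennreal b * ex n" unfolding ex_def by (rule nn_integral_cmult) simp
    finally show ?thesis by (simp add: add_left_mono)
  qed
  have step: "?L \<le> ?R + ennreal b * ex n" for n
  proof -
    let ?f = "\<lambda>l \<omega>. ennreal (grid_sum (m * Suc l) S (\<lambda>t. min (\<psi> t \<omega>) (real n)) (\<lambda>t. C t \<omega>))"
    let ?g = "\<lambda>\<omega>. stieltjes_upto T S (\<lambda>t. min (\<psi> t \<omega>) (real n)) (\<lambda>t. C t \<omega>)"
    have minint: "nonneg_integrand T (\<lambda>t. min (\<psi> t \<omega>) (real n))" if "\<omega> \<in> space M" for \<omega>
    proof -
      interpret nonneg_integrand T "\<lambda>t. \<psi> t \<omega>" by (rule psi_integrand[OF that])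
      show ?thesis using T nn rc by unfold_locales (auto intro: min_right_continuous)
    qed
    have gm: "?g \<in> borel_measurable M"
      by (intro measurable_stieltjes(1) minint gp min_meas T S) (use CA in \<open>auto simp: adapted_def intro: measurable_F_M\<close>)
    have "(\<lambda>l. \<integral>\<^sup>+\<omega>. ?f l \<omega> \<partial>M) \<longlonglongrightarrow> (\<integral>\<^sup>+\<omega>. ?g \<omega> \<partial>M)"
    proof (rule nn_integral_dominated_convergence[where w = "\<lambda>_. ennreal (real n * b)"])
      show "?f l \<in> borel_measurable M" for l
      proof -
        have [measurable]: "\<psi> (grid (m * Suc l) S j) \<in> borel_measurable M" "C (grid (m * Suc l) S j) \<in> borel_measurable M" if "j \<le> m * Suc l" for j
        proof -
          have "grid (m * Suc l) S j \<in> horizon T" using that by (intro grid_horizon S)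
          then show "\<psi> (grid (m * Suc l) S j) \<in> borel_measurable M" "C (grid (m * Suc l) S j) \<in> borel_measurable M"
            using psi_measurable CA by (auto simp: adapted_def intro: measurable_F_M)
        qed
        show ?thesis unfolding grid_sum_def grid_incr_def
          by (auto intro!: measurable_compose[OF _ measurable_ennreal] borel_measurable_sum borel_measurable_times borel_measurable_diff borel_measurable_min simp del: mult_Suc_right)
      qed
      show "AE \<omega> in M. ?f l \<omega> \<le> ennreal (real n * b)" for l
      proof (rule AE_I2, rule ennreal_leI)
        fix \<omega> assume \<omega>: "\<omega> \<in> space M"
        have "grid_sum (m * Suc l) S (\<lambda>t. min (\<psi> t \<omega>) (real n)) (\<lambda>t. C t \<omega>) \<le> real n * C S \<omega>"
          using m by (intro grid_sum_bound[OF gp[OF \<omega>] S]) auto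
        also have "\<dots> \<le> real n * b" using b[OF \<omega>] by (intro mult_left_mono) auto
        finally show "grid_sum (m * Suc l) S (\<lambda>t. min (\<psi> t \<omega>) (real n)) (\<lambda>t. C t \<omega>) \<le> real n * b" .
      qed
      show "AE \<omega> in M. (\<lambda>l. ?f l \<omega>) \<longlonglongrightarrow> ?g \<omega>"
      proof (rule AE_I2)
        fix \<omega> assume \<omega>: "\<omega> \<in> space M"
        \<comment> \<open>The convergence lemma is indexed by the grid size minus one, hence the
          shift of the multiples of \<open>m\<close>.\<close>
        have "strict_mono (\<lambda>l. m * Suc l - 1)"
          using m by (auto simp: strict_mono_Suc_iff)
        from LIMSEQ_subseq_LIMSEQ[OF nonneg_integrand.upto_min_grid_LIMSEQ[OF psi_integrand[OF \<omega>] gp[OF \<omega>] S, of n] this]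
        show "(\<lambda>l. ?f l \<omega>) \<longlonglongrightarrow> ?g \<omega>"
          using m by (simp add: o_def)
      qed
    qed (use gm in \<open>auto simp: emeasure_space_1\<close>)
    then have "(\<lambda>l. (\<integral>\<^sup>+\<omega>. ?f l \<omega> \<partial>M) + ennreal b * ex n) \<longlonglongrightarrow> (\<integral>\<^sup>+\<omega>. ?g \<omega> \<partial>M) + ennreal b * ex n"
      by (intro tendsto_add tendsto_const)
    moreover have "?L \<le> (\<integral>\<^sup>+\<omega>. ?f l \<omega> \<partial>M) + ennreal b * ex n" for l
      using grid_sum_refine[OF C S, of "Suc l" m] trunc[of "m * Suc l" n] m by (auto intro: order_trans)
    ultimately have "?L \<le> (\<integral>\<^sup>+\<omega>. ?g \<omega> \<partial>M) + ennreal b * ex n"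
      by (intro LIMSEQ_le_const) auto
    also have "(\<integral>\<^sup>+\<omega>. ?g \<omega> \<partial>M) \<le> ?R"
      unfolding stieltjes_upto_def
      by (intro nn_integral_mono mult_right_mono ennreal_leI) auto
    finally show ?thesis by (simp add: add_right_mono)
  qed
  \<comment> \<open>Integrability of the martingale at the single time \<open>S\<close> makes the
    truncation error vanish.\<close>
  have "ex \<longlonglongrightarrow> (\<integral>\<^sup>+\<omega>. 0 \<partial>M)"
    unfolding ex_def
  proof (rule nn_integral_dominated_convergence[where w = "\<lambda>\<omega>. ennreal (Y S \<omega>)"])
    show "(\<integral>\<^sup>+ \<omega>. ennreal (Y S \<omega>) \<partial>M) < \<infinity>"
      using int[OF S(1)] Y(2)[OF S(1)]
      by (subst nn_integral_eq_integral) (auto intro!: AE_I2 simp: less_imp_le)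
    show "AE \<omega> in M. (\<lambda>n. ennreal (Y S \<omega> - real n)) \<longlonglongrightarrow> 0"
    proof (rule AE_I2, rule tendsto_eventually)
      fix \<omega>
      show "\<forall>\<^sub>F n in sequentially. ennreal (Y S \<omega> - real n) = 0"
        using eventually_ge_at_top[of "nat \<lceil>Y S \<omega>\<rceil>"] by eventually_elim (rule ennreal_neg, linarith)
    qed
  qed (auto intro!: ennreal_leI)
  then have "(\<lambda>n. ?R + ennreal b * ex n) \<longlonglongrightarrow> ?R + ennreal b * 0"
    by (intro tendsto_add tendsto_const ennreal_tendsto_cmult) auto
  then show ?thesis using step by (intro LIMSEQ_le_const[of _ ?R]) auto
qed

text \<open>The path is capped at \<open>n\<close>. The remainder above the cap is again a good
  path, so capping only lowers the integral, and Fatou's lemma removes the cap from the grid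
  sum.\<close>

lemma grid_sum_le_upto:
  assumes C: "increasing_process M F T C" and S: "S \<in> horizon T" "0 < S" and m: "0 < m"
  shows "(\<integral>\<^sup>+\<omega>. ennreal (grid_sum m S (\<lambda>t. \<psi> t \<omega>) (\<lambda>t. C t \<omega>)) \<partial>M) \<le>
    (\<integral>\<^sup>+\<omega>. stieltjes_upto T S (\<lambda>t. \<psi> t \<omega>) (\<lambda>t. C t \<omega>) \<partial>M)" (is "?L \<le> ?R")
proof -
  define B where "B n t \<omega> = min (C t \<omega>) (real n)" for n t \<omega>
  have CA: "adapted F T C" and gp: "\<And>\<omega>. \<omega> \<in> space M \<Longrightarrow> good_path T (\<lambda>t. C t \<omega>)"
    using C by (auto simp: increasing_process_def)
  have gB: "good_path T (\<lambda>t. B n t \<omega>)" if "\<omega> \<in> space M" for n \<omega>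
    using gp[OF that] unfolding good_path_def B_def
    by (auto intro!: min_right_continuous simp: mono_on_def min_le_iff_disj)
  have gD: "good_path T (\<lambda>t. C t \<omega> - B n t \<omega>)" if "\<omega> \<in> space M" for n \<omega>
  proof -
    have eq: "C t \<omega> - B n t \<omega> = max (C t \<omega> - real n) 0" for t by (auto simp: B_def)
    have "right_continuous_on (horizon T) (\<lambda>t. max (C t \<omega> - real n) 0)"
      using gp[OF that] by (intro right_continuous_on_comp[where g = "\<lambda>x. max (x - real n) 0"] continuous_intros) (auto simp: good_path_def)
    moreover have "mono_on (horizon T) (\<lambda>t. max (C t \<omega> - real n) 0)"
      using gp[OF that] by (fastforce simp: good_path_def mono_on_def)
    ultimately show ?thesis unfolding good_path_def eq by simp
  qed
  have B: "increasing_process M F T (B n)" for n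
    using CA gB unfolding increasing_process_def adapted_def B_def[abs_def] by auto
  have "(\<integral>\<^sup>+\<omega>. ennreal (grid_sum m S (\<lambda>t. \<psi> t \<omega>) (\<lambda>t. B n t \<omega>)) \<partial>M) \<le> ?R" for n
  proof -
    have "(\<integral>\<^sup>+\<omega>. ennreal (grid_sum m S (\<lambda>t. \<psi> t \<omega>) (\<lambda>t. B n t \<omega>)) \<partial>M) \<le>
      (\<integral>\<^sup>+\<omega>. stieltjes_upto T S (\<lambda>t. \<psi> t \<omega>) (\<lambda>t. B n t \<omega>) \<partial>M)"
      by (rule grid_sum_le_upto_bounded[OF B S m, where b = "real n"]) (simp add: B_def)
    also have "\<dots> \<le> ?R"
      using gB gD by (intro nn_integral_mono nonneg_integrand.upto_mono[OF psi_integrand _ _ S]) auto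
    finally show ?thesis .
  qed
  note le = this
  have meas: "(\<lambda>\<omega>. ennreal (grid_sum m S (\<lambda>t. \<psi> t \<omega>) (\<lambda>t. B n t \<omega>))) \<in> borel_measurable M" for n
  proof -
    have [measurable]: "\<psi> (grid m S j) \<in> borel_measurable M" "C (grid m S j) \<in> borel_measurable M" if "j \<le> m" for j
      using psi_measurable CA grid_horizon[OF S that] by (auto simp: adapted_def intro: measurable_F_M)
    show ?thesis unfolding grid_sum_def grid_incr_def B_def
      by (auto intro!: measurable_compose[OF _ measurable_ennreal] borel_measurable_sum borel_measurable_times borel_measurable_diff borel_measurable_min)
  qed
  have Blim: "(\<lambda>n. B n t \<omega>) \<longlonglongrightarrow> C t \<omega>" for t \<omega>
  proof (rule tendsto_eventually)
    show "\<forall>\<^sub>F n in sequentially. B n t \<omega> = C t \<omega>"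
      using eventually_ge_at_top[of "nat \<lceil>C t \<omega>\<rceil>"] unfolding B_def
      by eventually_elim (rule min_absorb1, linarith)
  qed
  have lim: "(\<lambda>n. ennreal (grid_sum m S (\<lambda>t. \<psi> t \<omega>) (\<lambda>t. B n t \<omega>))) \<longlonglongrightarrow> ennreal (grid_sum m S (\<lambda>t. \<psi> t \<omega>) (\<lambda>t. C t \<omega>))" for \<omega>
    unfolding grid_sum_def grid_incr_def
    by (intro tendsto_ennrealI tendsto_sum tendsto_mult tendsto_const tendsto_diff Blim) (auto intro: Blim)
  have "?L = (\<integral>\<^sup>+\<omega>. liminf (\<lambda>n. ennreal (grid_sum m S (\<lambda>t. \<psi> t \<omega>) (\<lambda>t. B n t \<omega>))) \<partial>M)"
    by (intro nn_integral_cong lim_imp_Liminf[symmetric] lim) auto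
  also have "\<dots> \<le> liminf (\<lambda>n. \<integral>\<^sup>+\<omega>. ennreal (grid_sum m S (\<lambda>t. \<psi> t \<omega>) (\<lambda>t. B n t \<omega>)) \<partial>M)"
    by (intro nn_integral_liminf meas)
  also have "\<dots> \<le> liminf (\<lambda>n. ?R)" by (intro Liminf_mono always_eventually allI le)
  also have "\<dots> = ?R" by (simp add: Liminf_const)
  finally show ?thesis .
qed

text \<open>The grid with a single cell: the whole contribution is bought at
  \<open>S\<close>.\<close>

lemma expected_level_le_upto:
  assumes C: "increasing_process M F T C" and S: "S \<in> horizon T" "0 < S"
  shows "(\<integral>\<^sup>+\<omega>. ennreal (\<psi> S \<omega> * C S \<omega>) \<partial>M) \<le>
    (\<integral>\<^sup>+\<omega>. stieltjes_upto T S (\<lambda>t. \<psi> t \<omega>) (\<lambda>t. C t \<omega>) \<partial>M)"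
  using grid_sum_le_upto[OF C S, of 1] by (simp add: grid_sum_def grid_incr_def grid_def)

end

section \<open>Optional processes and the product measure\<close>

lemma sigma_finite_restrict_lborel [simp]: "A \<in> sets borel \<Longrightarrow> sigma_finite_measure (restrict_space lborel A)"
  using sigma_finite_measure_restrict_space[OF sigma_finite_lborel] by simp

lemma space_prod_time: "space (prod_time M T) = space M \<times> horizon T"
  by (auto simp: prod_time_def space_pair_measure space_restrict_space)

lemma measurable_fst_prod_time [measurable]: "fst \<in> measurable (prod_time M T) M"
  by (simp add: prod_time_def)

lemma measurable_snd_prod_time [measurable]: "snd \<in> borel_measurable (prod_time M T)"
proof -
  have "snd \<in> measurable (prod_time M T) (restrict_space lborel (horizon T))"
    by (simp add: prod_time_def)
  from measurable_compose[OF this, of "\<lambda>x. x" borel] show ?thesis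
    by (simp add: measurable_restrict_space1)
qed

lemma nn_integral_prod_time:
  assumes "f \<in> borel_measurable (prod_time M T)"
  shows "(\<integral>\<^sup>+z. f z \<partial>(prod_time M T)) = (\<integral>\<^sup>+\<omega>. (\<integral>\<^sup>+t\<in>horizon T. f (\<omega>, t) \<partial>lborel) \<partial>M)"
proof -
  interpret R: sigma_finite_measure "restrict_space lborel (horizon T)" by simp
  show ?thesis
    using R.nn_integral_fst[of f M] assms unfolding prod_time_def
    by (simp add: nn_integral_restrict_space)
qed

lemma measurable_inner_prod_time:
  assumes "f \<in> borel_measurable (prod_time M T)"
  shows "(\<lambda>\<omega>. \<integral>\<^sup>+t\<in>horizon T. f (\<omega>, t) \<partial>lborel) \<in> borel_measurable M"
proof -
  interpret R: sigma_finite_measure "restrict_space lborel (horizon T)" by simp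
  show ?thesis
    using R.borel_measurable_nn_integral_fst[of f M] assms unfolding prod_time_def
    by (simp add: nn_integral_restrict_space)
qed

lemma (in prob_space) AE_prod_time_D:
  assumes "AE z in prod_time M T. P z"
  shows "AE \<omega> in M. AE t in lborel. t \<in> horizon T \<longrightarrow> P (\<omega>, t)"
proof -
  interpret R: sigma_finite_measure "restrict_space lborel (horizon T)" by simp
  interpret R: pair_sigma_finite M "restrict_space lborel (horizon T)" ..
  have "AE \<omega> in M. AE t in restrict_space lborel (horizon T). P (\<omega>, t)"
    by (rule R.AE_pair[OF assms[unfolded prod_time_def]])
  moreover have "horizon T \<inter> space lborel \<in> sets lborel" by simp
  ultimately show ?thesis by (simp only: AE_restrict_space_iff)
qed

lemma (in prob_space) AE_prod_time_I:
  assumes "{z \<in> space (prod_time M T). P z} \<in> sets (prod_time M T)"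
    and "AE \<omega> in M. AE t in lborel. t \<in> horizon T \<longrightarrow> P (\<omega>, t)"
  shows "AE z in prod_time M T. P z"
proof -
  interpret R: sigma_finite_measure "restrict_space lborel (horizon T)" by simp
  interpret R: pair_sigma_finite M "restrict_space lborel (horizon T)" ..
  have "horizon T \<inter> space lborel \<in> sets lborel" by simp
  then have "AE \<omega> in M. AE t in restrict_space lborel (horizon T). P (\<omega>, t)"
    using assms(2) by (simp only: AE_restrict_space_iff)
  then show ?thesis
    using assms(1) unfolding prod_time_def by (intro R.AE_pair_measure)
qed

text \<open>Turns statements about P \<otimes> dt into almost sure statements at fixed times, which
  grid arguments require.\<close>

lemma (in prob_space) AE_prod_time_swap:
  assumes meas: "{z \<in> space (prod_time M T). P z} \<in> sets (prod_time M T)"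
    and "AE z in prod_time M T. P z"
  shows "AE t in lborel. t \<in> horizon T \<longrightarrow> (AE \<omega> in M. P (\<omega>, t))"
proof -
  interpret R: sigma_finite_measure "restrict_space lborel (horizon T)" by simp
  interpret R: pair_sigma_finite M "restrict_space lborel (horizon T)" ..
  have "AE \<omega> in M. AE t in restrict_space lborel (horizon T). P (\<omega>, t)"
    by (rule R.AE_pair[OF assms(2)[unfolded prod_time_def]])
  moreover have "Measurable.pred (M \<Otimes>\<^sub>M restrict_space lborel (horizon T)) (\<lambda>x. P (fst x, snd x))"
    using meas by (simp add: pred_def prod_time_def)
  ultimately have "AE t in restrict_space lborel (horizon T). AE \<omega> in M. P (\<omega>, t)"
    using R.AE_commute[of "\<lambda>x y. P (x, y)"] by (simp add: pred_def)
  moreover have "horizon T \<inter> space lborel \<in> sets lborel" by simp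
  ultimately show ?thesis by (simp only: AE_restrict_space_iff)
qed

section \<open>Optional processes, discounting and good versions\<close>

lemma space_optional_sigma: "space (optional_sigma M F T) = space M \<times> horizon T"
  unfolding optional_sigma_def by (intro space_measure_of) auto

context filtered_space
begin

text \<open>Evaluation at the next point of a grid of mesh 1 / (k + 1) is jointly measurable, as it
  involves countably many random variables; right-continuity passes this to the limit.\<close>

lemma rc_adapted_measurable:
  assumes A: "adapted F T X" and R: "right_continuous_process M T X"
  shows "(\<lambda>(\<omega>, t). X t \<omega>) \<in> borel_measurable (prod_time M T)"
proof -
  \<comment> \<open>Grid points beyond a finite T are replaced by T. For T = \<infinity> the value 0
    merely keeps \<open>\<sigma> k i\<close> in the horizon when \<open>i\<close> is too
    negative.\<close>
  define e where "e = (if T = \<infinity> then 0 else real_of_ereal T)"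
  have e: "e \<in> horizon T" using T by (cases T) (auto simp: e_def horizon_def)
  define \<sigma> where "\<sigma> k i = (let s = (real_of_int i + 1) / real (Suc k) in if s \<in> horizon T then s else e)" for k i
  define \<tau> where "\<tau> k t = \<sigma> k \<lfloor>real (Suc k) * t\<rfloor>" for k t
  have \<sigma>H: "\<sigma> k i \<in> horizon T" for k i using e by (auto simp: \<sigma>_def Let_def)
  have \<tau>: "t \<le> \<tau> k t" "\<tau> k t \<le> t + 1 / real (Suc k)" if t: "t \<in> horizon T" for k t
  proof -
    let ?s = "(real_of_int \<lfloor>real (Suc k) * t\<rfloor> + 1) / real (Suc k)"
    have s: "t \<le> ?s" "?s \<le> t + 1 / real (Suc k)"
      by (simp add: field_simps del: of_nat_Suc; linarith)+
    have "t \<le> \<tau> k t \<and> \<tau> k t \<le> t + 1 / real (Suc k)"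
    proof (cases "?s \<in> horizon T")
      case True
      then show ?thesis using s by (simp add: \<tau>_def \<sigma>_def Let_def)
    next
      case False
      then have "\<not> ereal ?s \<le> T" using s t by (auto simp: horizon_def)
      then have "t \<le> e" "e \<le> ?s" using t T by (cases T; auto simp: e_def horizon_def)+
      then show ?thesis using s False by (simp add: \<tau>_def \<sigma>_def Let_def)
    qed
    then show "t \<le> \<tau> k t" "\<tau> k t \<le> t + 1 / real (Suc k)" by auto
  qed
  have "(\<lambda>z. X (snd z) (fst z)) \<in> borel_measurable (prod_time M T)"
  proof (rule borel_measurable_LIMSEQ_real)
    fix k
    have [measurable]: "X (\<sigma> k i) \<in> borel_measurable M" for i
      using A \<sigma>H[of k i] measurable_F_M by (auto simp: adapted_def)
    have "(\<lambda>z. (\<lambda>i z. X (\<sigma> k i) (fst z)) \<lfloor>real (Suc k) * snd z\<rfloor> z) \<in> borel_measurable (prod_time M T)"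
      by (rule measurable_compose_countable) measurable
    then show "(\<lambda>z. X (\<tau> k (snd z)) (fst z)) \<in> borel_measurable (prod_time M T)"
      by (simp add: \<tau>_def)
  next
    fix z assume "z \<in> space (prod_time M T)"
    then have z: "fst z \<in> space M" "snd z \<in> horizon T" by (auto simp: space_prod_time)
    have "(\<lambda>k. snd z + 1 / real (Suc k)) \<longlonglongrightarrow> snd z + 0"
      by (intro tendsto_intros LIMSEQ_Suc[OF lim_const_over_n])
    then have "(\<lambda>k. \<tau> k (snd z)) \<longlonglongrightarrow> snd z"
      using \<tau>[OF z(2)] by (intro tendsto_sandwich[of "\<lambda>_. snd z" "\<lambda>k. \<tau> k (snd z)" _ "\<lambda>k. snd z + 1 / real (Suc k)"]) auto
    then show "(\<lambda>k. X (\<tau> k (snd z)) (fst z)) \<longlonglongrightarrow> X (snd z) (fst z)"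
      using R z \<tau>[OF z(2)] \<sigma>H
      by (intro right_continuous_on_LIMSEQ[where I = "horizon T" and f = "\<lambda>t. X t (fst z)"])
        (auto simp: right_continuous_process_def \<tau>_def)
  qed
  then show ?thesis by (simp add: case_prod_unfold)
qed

lemma optional_measurable:
  assumes "optional_process M F T X"
  shows "(\<lambda>z. X (snd z) (fst z)) \<in> borel_measurable (prod_time M T)"
proof -
  have "(\<lambda>z. z) \<in> measurable (prod_time M T) (optional_sigma M F T)"
    unfolding optional_sigma_def
  proof (rule measurable_measure_of)
    fix y assume "y \<in> {{(\<omega>, t). \<omega> \<in> space M \<and> t \<in> horizon T \<and> X t \<omega> \<in> B} | X B.
        adapted F T X \<and> right_continuous_process M T X \<and> B \<in> sets borel}"
    then obtain X B where y: "y = {(\<omega>, t). \<omega> \<in> space M \<and> t \<in> horizon T \<and> X t \<omega> \<in> B}"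
      and X: "adapted F T X" "right_continuous_process M T X" "B \<in> sets borel" by auto
    have "(\<lambda>z. z) -` y \<inter> space (prod_time M T) = (\<lambda>(\<omega>, t). X t \<omega>) -` B \<inter> space (prod_time M T)"
      by (auto simp: y space_prod_time)
    also have "\<dots> \<in> sets (prod_time M T)"
      using measurable_sets[OF rc_adapted_measurable[OF X(1,2)] X(3)] .
    finally show "(\<lambda>z. z) -` y \<inter> space (prod_time M T) \<in> sets (prod_time M T)" .
  qed (auto simp: space_prod_time)
  from measurable_compose[OF this assms[unfolded optional_process_def]]
  show ?thesis by (simp add: case_prod_unfold)
qed

lemma optional_adapted:
  assumes X: "optional_process M F T X"
  shows "adapted F T X"
  unfolding adapted_def
proof
  fix t assume t: "t \<in> horizon T"
  have "(\<lambda>\<omega>. (\<omega>, t)) \<in> measurable (F t) (optional_sigma M F T)"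
    unfolding optional_sigma_def
  proof (rule measurable_measure_of)
    fix y assume "y \<in> {{(\<omega>, t). \<omega> \<in> space M \<and> t \<in> horizon T \<and> X t \<omega> \<in> B} | X B.
        adapted F T X \<and> right_continuous_process M T X \<and> B \<in> sets borel}"
    then obtain X B where y: "y = {(\<omega>, t). \<omega> \<in> space M \<and> t \<in> horizon T \<and> X t \<omega> \<in> B}"
      and X: "adapted F T X" "B \<in> sets borel" by auto
    have "(\<lambda>\<omega>. (\<omega>, t)) -` y \<inter> space (F t) = X t -` B \<inter> space (F t)"
      using t by (auto simp: y space_F)
    also have "\<dots> \<in> sets (F t)"
      using X t by (auto simp: adapted_def)
    finally show "(\<lambda>\<omega>. (\<omega>, t)) -` y \<inter> space (F t) \<in> sets (F t)" .
  qed (use t in \<open>auto simp: space_F\<close>)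
  from measurable_compose[OF this X[unfolded optional_process_def]]
  show "X t \<in> borel_measurable (F t)" by simp
qed

lemma optionalI:
  assumes "adapted F T X" "right_continuous_process M T X"
  shows "optional_process M F T X"
  unfolding optional_process_def
proof (rule measurableI)
  fix B :: "real set" assume B: "B \<in> sets borel"
  have "(\<lambda>(\<omega>, t). X t \<omega>) -` B \<inter> space (optional_sigma M F T) = {(\<omega>, t). \<omega> \<in> space M \<and> t \<in> horizon T \<and> X t \<omega> \<in> B}"
    by (auto simp: space_optional_sigma)
  also have "\<dots> \<in> sets (optional_sigma M F T)"
    unfolding optional_sigma_def using assms B by (subst sets_measure_of) (auto intro!: sigma_sets.Basic)
  finally show "(\<lambda>(\<omega>, t). X t \<omega>) -` B \<inter> space (optional_sigma M F T) \<in> sets (optional_sigma M F T)" .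
qed simp

lemma increasing_optional:
  "increasing_process M F T C \<Longrightarrow> optional_process M F T C"
  by (intro optionalI) (auto simp: increasing_process_def good_path_def right_continuous_process_def)

lemma optional_const_time:
  fixes f :: "real \<Rightarrow> real"
  assumes "continuous_on UNIV f"
  shows "optional_process M F T (\<lambda>t \<omega>. f t)"
  using assms
  by (intro optionalI)
    (auto simp: adapted_def right_continuous_process_def right_continuous_on_def continuous_on_eq_continuous_at
      intro: continuous_at_imp_continuous_within)

lemma discount_measurable:
  assumes r: "optional_process M F T r"
  shows "(\<lambda>z. discount r (snd z) (fst z)) \<in> borel_measurable (prod_time M T)"
proof -
  \<comment> \<open>\<open>cl\<close> maps the line into the horizon, which makes the integrand a
    total measurable function of time; on the interval of integration it is the identity.\<close>
  define cl where "cl s = (if s \<in> horizon T then s else 0)" for s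
  have [measurable]: "cl \<in> measurable borel (restrict_space lborel (horizon T))"
    using zero_in_horizon[OF T] unfolding cl_def[abs_def]
    by (intro measurable_restrict_space2) auto
  have "(\<lambda>z. r (snd z) (fst z)) \<in> borel_measurable (M \<Otimes>\<^sub>M restrict_space lborel (horizon T))"
    using optional_measurable[OF r] by (simp add: prod_time_def)
  then have [measurable]: "(\<lambda>z. r (cl (snd z)) (fst (fst z))) \<in> borel_measurable (prod_time M T \<Otimes>\<^sub>M lborel)"
    by (rule measurable_compose[of "\<lambda>z. (fst (fst z), cl (snd z))" _ _ "\<lambda>z. r (snd z) (fst z)", simplified, rotated]) measurable
  have "(\<lambda>z. exp (- (\<integral>s. indicator {s. 0 \<le> s \<and> s \<le> snd z} s *\<^sub>R r (cl s) (fst z) \<partial>lborel))) \<in> borel_measurable (prod_time M T)"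
    by measurable
  also have "?this \<longleftrightarrow> ?thesis"
  proof (rule measurable_cong)
    fix z assume "z \<in> space (prod_time M T)"
    then have z: "snd z \<in> horizon T" by (auto simp: space_prod_time)
    have "(\<integral>s. indicator {s. 0 \<le> s \<and> s \<le> snd z} s *\<^sub>R r (cl s) (fst z) \<partial>lborel) = (LBINT s:{0..snd z}. r s (fst z))"
      unfolding set_lebesgue_integral_def using horizon_le[OF z]
      by (intro Bochner_Integration.integral_cong) (auto simp: indicator_def cl_def)
    then show "exp (- (\<integral>s. indicator {s. 0 \<le> s \<and> s \<le> snd z} s *\<^sub>R r (cl s) (fst z) \<partial>lborel)) = discount r (snd z) (fst z)"
      by (simp add: discount_def)
  qed
  finally show ?thesis .
qed

lemma discount_le_1:
  assumes "strictly_positive M T r" "\<omega> \<in> space M" "t \<in> horizon T"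
  shows "discount r t \<omega> \<le> 1"
proof -
  have "0 \<le> (LBINT u:{0..t}. r u \<omega>)"
    unfolding set_lebesgue_integral_def using assms horizon_le[OF assms(3)]
    by (intro integral_nonneg_AE AE_I2) (auto simp: indicator_def strictly_positive_def less_imp_le)
  then show ?thesis by (simp add: discount_def)
qed

lemma null_set_F0: "N \<in> null_sets M \<Longrightarrow> A \<subseteq> N \<Longrightarrow> t \<in> horizon T \<Longrightarrow> A \<in> sets (F t)"
  using filt F_mono[OF zero_in_horizon[OF T], of t] unfolding usual_filtration_def
  by (auto simp: horizon_def)

lemma AE_sets_F:
  assumes "AE \<omega> in M. P \<omega>" "t \<in> horizon T"
  shows "{\<omega>\<in>space M. P \<omega>} \<in> sets (F t)"
proof -
  obtain N where N: "N \<in> null_sets M" "{\<omega>\<in>space M. \<not> P \<omega>} \<subseteq> N"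
    using assms(1) by (auto elim!: AE_E3 AE_E simp: null_sets_def)
  have "{\<omega>\<in>space M. P \<omega>} = space (F t) - {\<omega>\<in>space M. \<not> P \<omega>}"
    using space_F[OF assms(2)] by auto
  then show ?thesis using null_set_F0[OF N assms(2)] by auto
qed

text \<open>Completeness puts the set of bad paths into every \<open>F t\<close>, so setting these
  paths to 0 preserves adaptedness.\<close>

lemma good_version:
  assumes C: "adapted F T C" and gp: "AE \<omega> in M. good_path T (\<lambda>t. C t \<omega>)"
  shows "increasing_process M F T (\<lambda>t \<omega>. if good_path T (\<lambda>t. C t \<omega>) then C t \<omega> else 0)"
proof -
  have "(\<lambda>\<omega>. if good_path T (\<lambda>t. C t \<omega>) then C t \<omega> else 0) \<in> borel_measurable (F t)"
    if t: "t \<in> horizon T" for t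
    using C t AE_sets_F[OF gp t]
    by (intro measurable_If) (auto simp: adapted_def space_F[OF t])
  moreover have "good_path T (\<lambda>t. 0)"
    by (auto simp: good_path_def right_continuous_on_def mono_on_def)
  moreover have "good_path T (\<lambda>t. if good_path T (\<lambda>t. C t \<omega>) then C t \<omega> else 0)" for \<omega>
    using \<open>good_path T (\<lambda>t. 0)\<close> by (cases "good_path T (\<lambda>t. C t \<omega>)") simp_all
  ultimately show ?thesis
    by (simp add: increasing_process_def adapted_def)
qed

end

section \<open>The planner problem with one aggregate contribution\<close>

lemma quadrant_closed: "closed quadrant"
  unfolding quadrant_def by (intro closed_Times) auto

text \<open>Concavity on the segment from 0 to \<open>p\<close>, together with
  \<open>v 0 \<ge> 0\<close>.\<close>

lemma concave_scale:
  assumes v: "utility_regular v" and p: "p \<in> quadrant" and a: "0 < a" "a \<le> 1"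
  shows "a * v p \<le> v (a *\<^sub>R p)"
proof (cases "p = 0 \<or> a = 1")
  case True
  have "0 \<le> v 0" using v by (auto simp: utility_regular_def quadrant_def zero_prod_def)
  moreover have "a * v 0 \<le> 1 * v 0" using a \<open>0 \<le> v 0\<close> by (intro mult_right_mono)
  ultimately show ?thesis using True by auto
next
  case False
  have z: "0 \<in> quadrant" by (simp add: quadrant_def zero_prod_def)
  have "(1 - a) * v 0 + a * v p < v ((1 - a) *\<^sub>R 0 + a *\<^sub>R p)"
    using v p z a False unfolding utility_regular_def strictly_concave_on_def by auto
  moreover have "0 \<le> (1 - a) * v 0" using v z a by (auto simp: utility_regular_def)
  ultimately show ?thesis by simp
qed

lemma concave_midpoint:
  assumes v: "utility_regular v" and p: "p \<in> quadrant" "q \<in> quadrant"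
  shows "(v p + v q) / 2 \<le> v ((1/2) *\<^sub>R (p + q))"
    and "p \<noteq> q \<Longrightarrow> (v p + v q) / 2 < v ((1/2) *\<^sub>R (p + q))"
proof -
  show *: "(v p + v q) / 2 < v ((1/2) *\<^sub>R (p + q))" if "p \<noteq> q"
  proof -
    have "\<forall>p\<in>quadrant. \<forall>q\<in>quadrant. \<forall>a. p \<noteq> q \<and> 0 < a \<and> a < 1 \<longrightarrow>
        (1 - a) * v p + a * v q < v ((1 - a) *\<^sub>R p + a *\<^sub>R q)"
      using v by (simp add: utility_regular_def strictly_concave_on_def)
    from this[rule_format, of p q "1/2"] that p
    show ?thesis by (simp add: scaleR_add_right)
  qed
  show "(v p + v q) / 2 \<le> v ((1/2) *\<^sub>R (p + q))"
  proof (cases "p = q")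
    case True
    then have "(1/2) *\<^sub>R (p + q) = p" by (simp add: scaleR_2[symmetric])
    then show ?thesis using True by simp
  qed (use * in force)
qed

lemma optional_lincomb:
  assumes "optional_process M F T X" "optional_process M F T Y"
  shows "optional_process M F T (\<lambda>t \<omega>. a * X t \<omega> + b * Y t \<omega>)"
  using assms unfolding optional_process_def case_prod_unfold by measurable

lemma (in filtered_space) increasing_lincomb:
  assumes "increasing_process M F T C" "increasing_process M F T D" "0 \<le> a" "0 \<le> b"
  shows "increasing_process M F T (\<lambda>t \<omega>. a * C t \<omega> + b * D t \<omega>)"
proof -
  have "(\<lambda>\<omega>. a * C t \<omega> + b * D t \<omega>) \<in> borel_measurable (F t)" if "t \<in> horizon T" for t
    using assms(1,2) that unfolding increasing_process_def adapted_def
    by (intro borel_measurable_add borel_measurable_times) auto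
  then show ?thesis
    using assms unfolding increasing_process_def adapted_def by (auto intro!: good_path_lincomb)
qed

section \<open>The reduced problem and its costs\<close>

locale planner = filtered_space M F T for M :: "'a measure" and F T +
  fixes \<psi>x \<psi>c r :: "'a process" and n :: nat
    and u :: "nat \<Rightarrow> real \<times> real \<Rightarrow> real" and w \<gamma> :: "nat \<Rightarrow> real"
  assumes n: "1 \<le> n"
    and w_pos: "\<And>i. i \<in> {1..n} \<Longrightarrow> 0 < w i"
    and \<gamma>_pos: "\<And>i. i \<in> {1..n} \<Longrightarrow> 0 < \<gamma> i"
    and \<gamma>_sum: "(\<Sum>i=1..n. \<gamma> i) = 1"
    and \<psi>x_pos: "strictly_positive M T \<psi>x" and \<psi>c_pos: "strictly_positive M T \<psi>c"
    and AU: "Assumption_U M F T \<psi>x \<psi>c r u n w"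
    and AP: "Assumption_P M F T \<psi>x \<psi>c r"
begin

sublocale px: price M F T \<psi>x
  using AP \<psi>x_pos by unfold_locales (auto simp: Assumption_P_def)

sublocale pc: price M F T \<psi>c
  using AP \<psi>c_pos by unfold_locales (auto simp: Assumption_P_def)

lemma u_regular: "i \<in> {1..n} \<Longrightarrow> utility_regular (u i)"
  using AU by (auto simp: Assumption_U_def)

definition wealth :: real where "wealth = (\<Sum>i=1..n. w i)"

definition xcost :: "'a process \<Rightarrow> ennreal" where
  "xcost x = (\<integral>\<^sup>+\<omega>. (\<integral>\<^sup>+t\<in>horizon T. ennreal (\<psi>x t \<omega> * x t \<omega>) \<partial>lborel) \<partial>M)"

definition ccost :: "'a process \<Rightarrow> ennreal" where
  "ccost C = (\<integral>\<^sup>+\<omega>. stieltjes_integral T (\<lambda>t. \<psi>c t \<omega>) (\<lambda>t. C t \<omega>) \<partial>M)"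

definition consumption :: "'a process \<Rightarrow> bool" where
  "consumption x \<longleftrightarrow> optional_process M F T x \<and> (\<forall>t\<in>horizon T. \<forall>\<omega>\<in>space M. 0 \<le> x t \<omega>)"

text \<open>Costs are additive in the contributions, so only the aggregate enters the budget
  constraint.\<close>

definition feasible :: "(nat \<Rightarrow> 'a process) \<Rightarrow> 'a process \<Rightarrow> bool" where
  "feasible x C \<longleftrightarrow> (\<forall>i\<in>{1..n}. consumption (x i)) \<and> increasing_process M F T C \<and>
     (\<Sum>i=1..n. xcost (x i)) + ccost C \<le> ennreal wealth"

definition util :: "nat \<Rightarrow> 'a process \<Rightarrow> 'a process \<Rightarrow> 'a \<times> real \<Rightarrow> real" where
  "util i x C z = discount r (snd z) (fst z) * u i (x (snd z) (fst z), C (snd z) (fst z))"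

definition welfare :: "(nat \<Rightarrow> 'a process) \<Rightarrow> 'a process \<Rightarrow> ennreal" where
  "welfare x C = (\<Sum>i=1..n. ennreal (\<gamma> i) * (\<integral>\<^sup>+z. ennreal (util i (x i) C z) \<partial>(prod_time M T)))"

lemma wealth_pos: "0 < wealth"
  unfolding wealth_def using n w_pos by (intro sum_pos) auto

lemma r_optional: "optional_process M F T r" and r_pos: "strictly_positive M T r"
  using AP by (auto simp: Assumption_P_def)

lemma discount_bounds:
  "0 < discount r t \<omega>" "z \<in> space (prod_time M T) \<Longrightarrow> discount r (snd z) (fst z) \<le> 1"
  using discount_le_1[OF r_pos] by (auto simp: discount_def space_prod_time)

lemma consumption_measurable:
  "consumption x \<Longrightarrow> (\<lambda>z. x (snd z) (fst z)) \<in> borel_measurable (prod_time M T)"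
  by (auto simp: consumption_def intro: optional_measurable)

lemma increasing_consumption: "increasing_process M F T C \<Longrightarrow> consumption C"
  using increasing_optional by (auto simp: consumption_def increasing_process_def good_path_def)

lemma quadrant_process:
  "consumption x \<Longrightarrow> consumption C \<Longrightarrow> z \<in> space (prod_time M T) \<Longrightarrow>
    (x (snd z) (fst z), C (snd z) (fst z)) \<in> quadrant"
  by (auto simp: consumption_def quadrant_def space_prod_time)

lemma util_measurable:
  assumes i: "i \<in> {1..n}" and x: "consumption x" and C: "consumption C"
  shows "util i x C \<in> borel_measurable (prod_time M T)"
proof -
  note [measurable] = consumption_measurable[OF x] consumption_measurable[OF C] discount_measurable[OF r_optional]
  have "u i \<in> borel_measurable (restrict_space borel quadrant)"
    using u_regular[OF i] by (intro borel_measurable_continuous_on_restrict) (auto simp: utility_regular_def)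
  moreover have "(\<lambda>z. (x (snd z) (fst z), C (snd z) (fst z))) \<in> measurable (prod_time M T) (restrict_space borel quadrant)"
    using quadrant_process[OF x C] by (intro measurable_restrict_space2) (auto simp: borel_prod[symmetric])
  ultimately have [measurable]: "(\<lambda>z. u i (x (snd z) (fst z), C (snd z) (fst z))) \<in> borel_measurable (prod_time M T)"
    by (rule measurable_compose[rotated])
  show ?thesis unfolding util_def[abs_def] by measurable
qed

lemma util_nonneg:
  assumes "i \<in> {1..n}" "consumption x" "consumption C" "z \<in> space (prod_time M T)"
  shows "0 \<le> util i x C z"
  using u_regular[OF assms(1)] quadrant_process[OF assms(2-4)] discount_bounds(1)
  by (auto simp: util_def utility_regular_def less_imp_le)

lemma xcost_eq:
  assumes "consumption x"
  shows "xcost x = (\<integral>\<^sup>+z. ennreal (\<psi>x (snd z) (fst z)) * ennreal (x (snd z) (fst z)) \<partial>(prod_time M T))"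
    and "(\<lambda>\<omega>. \<integral>\<^sup>+t\<in>horizon T. ennreal (\<psi>x t \<omega> * x t \<omega>) \<partial>lborel) \<in> borel_measurable M"
    and "(\<lambda>z. \<psi>x (snd z) (fst z)) \<in> borel_measurable (prod_time M T)"
proof -
  show px [measurable]: "(\<lambda>z. \<psi>x (snd z) (fst z)) \<in> borel_measurable (prod_time M T)"
    using px.price by (intro optional_measurable optionalI) (auto simp: price_process_def)
  note [measurable] = consumption_measurable[OF assms]
  have m: "(\<lambda>z. ennreal (\<psi>x (snd z) (fst z) * x (snd z) (fst z))) \<in> borel_measurable (prod_time M T)"
    by measurable
  show "(\<lambda>\<omega>. \<integral>\<^sup>+t\<in>horizon T. ennreal (\<psi>x t \<omega> * x t \<omega>) \<partial>lborel) \<in> borel_measurable M"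
    using measurable_inner_prod_time[OF m] by simp
  have "xcost x = (\<integral>\<^sup>+z. ennreal (\<psi>x (snd z) (fst z) * x (snd z) (fst z)) \<partial>(prod_time M T))"
    unfolding xcost_def by (subst nn_integral_prod_time[OF m]) simp
  also have "\<dots> = (\<integral>\<^sup>+z. ennreal (\<psi>x (snd z) (fst z)) * ennreal (x (snd z) (fst z)) \<partial>(prod_time M T))"
    using assms px.psi_pos
    by (intro nn_integral_cong) (auto simp: space_prod_time consumption_def ennreal_mult less_imp_le)
  finally show "xcost x = (\<integral>\<^sup>+z. ennreal (\<psi>x (snd z) (fst z)) * ennreal (x (snd z) (fst z)) \<partial>(prod_time M T))" .
qed

lemma stieltjes_measurable:
  assumes "increasing_process M F T C"
  shows "(\<lambda>\<omega>. stieltjes_integral T (\<lambda>t. \<psi>c t \<omega>) (\<lambda>t. C t \<omega>)) \<in> borel_measurable M"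
    and "S \<in> horizon T \<Longrightarrow> 0 < S \<Longrightarrow> (\<lambda>\<omega>. stieltjes_upto T S (\<lambda>t. \<psi>c t \<omega>) (\<lambda>t. C t \<omega>)) \<in> borel_measurable M"
proof -
  have C: "C t \<in> borel_measurable M" if "t \<in> horizon T" for t
    using assms that measurable_F_M by (auto simp: increasing_process_def adapted_def)
  show "(\<lambda>\<omega>. stieltjes_integral T (\<lambda>t. \<psi>c t \<omega>) (\<lambda>t. C t \<omega>)) \<in> borel_measurable M"
    "S \<in> horizon T \<Longrightarrow> 0 < S \<Longrightarrow> (\<lambda>\<omega>. stieltjes_upto T S (\<lambda>t. \<psi>c t \<omega>) (\<lambda>t. C t \<omega>)) \<in> borel_measurable M"
    using assms by (intro measurable_stieltjes pc.psi_integrand pc.psi_measurable T C; simp add: increasing_process_def)+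
qed

text \<open>\<open>D\<close> stands for the contribution of an original strategy, whose paths are
  good only almost surely.\<close>

lemma cost_eq:
  assumes x: "consumption x" and C: "increasing_process M F T C"
    and eq: "AE \<omega> in M. \<forall>t. D t \<omega> = C t \<omega>"
  shows "cost M T \<psi>x \<psi>c x D = xcost x + ccost C"
proof -
  have "cost M T \<psi>x \<psi>c x D = (\<integral>\<^sup>+\<omega>. ((\<integral>\<^sup>+t\<in>horizon T. ennreal (\<psi>x t \<omega> * x t \<omega>) \<partial>lborel) +
            stieltjes_integral T (\<lambda>t. \<psi>c t \<omega>) (\<lambda>t. C t \<omega>)) \<partial>M)"
    unfolding cost_def stieltjes_integral_def using eq
    by (intro nn_integral_cong_AE) (auto elim!: eventually_mono)
  also have "\<dots> = xcost x + ccost C"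
    unfolding xcost_def ccost_def
    by (rule nn_integral_add[OF xcost_eq(2)[OF x] stieltjes_measurable(1)[OF C]])
  finally show ?thesis .
qed

lemma xcost_lincomb:
  assumes x: "consumption x" "consumption y" and a: "0 \<le> a" "0 \<le> b"
  shows "xcost (\<lambda>t \<omega>. a * x t \<omega> + b * y t \<omega>) = ennreal a * xcost x + ennreal b * xcost y"
    and "consumption (\<lambda>t \<omega>. a * x t \<omega> + b * y t \<omega>)"
proof -
  show c: "consumption (\<lambda>t \<omega>. a * x t \<omega> + b * y t \<omega>)"
    using x a by (auto simp: consumption_def intro!: optional_lincomb)
  note [measurable] = consumption_measurable[OF x(1)] consumption_measurable[OF x(2)] xcost_eq(3)[OF x(1)]
  have "xcost (\<lambda>t \<omega>. a * x t \<omega> + b * y t \<omega>) =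
    (\<integral>\<^sup>+z. ennreal a * (ennreal (\<psi>x (snd z) (fst z)) * ennreal (x (snd z) (fst z))) +
      ennreal b * (ennreal (\<psi>x (snd z) (fst z)) * ennreal (y (snd z) (fst z))) \<partial>(prod_time M T))"
    unfolding xcost_eq(1)[OF c] using x a
    by (intro nn_integral_cong)
      (auto simp: space_prod_time consumption_def ennreal_mult ennreal_plus distrib_left mult_ac)
  also have "\<dots> = ennreal a * xcost x + ennreal b * xcost y"
    unfolding xcost_eq(1)[OF x(1)] xcost_eq(1)[OF x(2)]
    by (simp add: nn_integral_add nn_integral_cmult)
  finally show "xcost (\<lambda>t \<omega>. a * x t \<omega> + b * y t \<omega>) = ennreal a * xcost x + ennreal b * xcost y" .
qed

lemma ccost_lincomb:
  assumes C: "increasing_process M F T C" "increasing_process M F T D" and a: "0 \<le> a" "0 \<le> b"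
  shows "ccost (\<lambda>t \<omega>. a * C t \<omega> + b * D t \<omega>) = ennreal a * ccost C + ennreal b * ccost D"
proof -
  note [measurable] = stieltjes_measurable(1)[OF C(1)] stieltjes_measurable(1)[OF C(2)]
  have "ccost (\<lambda>t \<omega>. a * C t \<omega> + b * D t \<omega>) = (\<integral>\<^sup>+\<omega>. ennreal a * stieltjes_integral T (\<lambda>t. \<psi>c t \<omega>) (\<lambda>t. C t \<omega>)
     + ennreal b * stieltjes_integral T (\<lambda>t. \<psi>c t \<omega>) (\<lambda>t. D t \<omega>) \<partial>M)"
    unfolding ccost_def using C a
    by (intro nn_integral_cong nonneg_integrand.integral_lincomb[OF pc.psi_integrand])
      (auto simp: increasing_process_def)
  also have "\<dots> = ennreal a * ccost C + ennreal b * ccost D"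
    unfolding ccost_def by (simp add: nn_integral_add nn_integral_cmult)
  finally show ?thesis .
qed

lemma increasing_zero: "increasing_process M F T (\<lambda>t \<omega>. 0)"
  by (auto simp: increasing_process_def adapted_def good_path_def right_continuous_on_def mono_on_def)

lemma increasing_sum:
  assumes "finite I" "\<And>i. i \<in> I \<Longrightarrow> increasing_process M F T (C i)"
  shows "increasing_process M F T (\<lambda>t \<omega>. \<Sum>i\<in>I. C i t \<omega>) \<and> ccost (\<lambda>t \<omega>. \<Sum>i\<in>I. C i t \<omega>) = (\<Sum>i\<in>I. ccost (C i))"
  using assms
proof (induction I)
  case empty
  show ?case using increasing_zero nonneg_integrand.integral_zero[OF pc.psi_integrand]
    by (simp add: ccost_def cong: nn_integral_cong_simp)
next
  case (insert i I)
  then have C: "increasing_process M F T (C i)" "increasing_process M F T (\<lambda>t \<omega>. \<Sum>i\<in>I. C i t \<omega>)" by auto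
  show ?case
    using insert increasing_lincomb[OF C, of 1 1] ccost_lincomb[OF C, of 1 1] by simp
qed

lemma ccost_zero: "ccost (\<lambda>t \<omega>. 0) = 0"
  using increasing_sum[of "{}"] by simp

lemma planner_objective_eq:
  assumes x: "\<And>i. i \<in> {1..n} \<Longrightarrow> consumption (x i)" and C: "increasing_process M F T C"
    and eq: "AE \<omega> in M. \<forall>t. (\<Sum>i=1..n. D i t \<omega>) = C t \<omega>"
  shows "planner_objective M T r u n \<gamma> (x, D) = welfare x C"
proof -
  have "payoff M T r (u i) (x i) (D i) (\<lambda>t \<omega>. \<Sum>j\<in>{1..n} - {i}. D j t \<omega>) = (\<integral>\<^sup>+z. ennreal (util i (x i) C z) \<partial>(prod_time M T))"
    if i: "i \<in> {1..n}" for i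
  proof -
    have "payoff M T r (u i) (x i) (D i) (\<lambda>t \<omega>. \<Sum>j\<in>{1..n} - {i}. D j t \<omega>) =
      (\<integral>\<^sup>+\<omega>. (\<integral>\<^sup>+t\<in>horizon T. ennreal (util i (x i) C (\<omega>, t)) \<partial>lborel) \<partial>M)"
    proof -
      have "D i t \<omega> + (\<Sum>j\<in>{1..n} - {i}. D j t \<omega>) = (\<Sum>i=1..n. D i t \<omega>)" for t \<omega>
        using i by (subst sum.remove[of _ i]) auto
      then show ?thesis
        unfolding payoff_def util_def using eq
        by (intro nn_integral_cong_AE) (auto elim!: eventually_mono)
    qed
    also have "\<dots> = (\<integral>\<^sup>+z. ennreal (util i (x i) C z) \<partial>(prod_time M T))"
      using util_measurable[OF i x[OF i] increasing_consumption[OF C]]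
      by (subst nn_integral_prod_time) auto
    finally show ?thesis .
  qed
  then show ?thesis by (simp add: planner_objective_def welfare_def)
qed

lemma strategy_good_version:
  assumes s: "strategy M F T x C"
  defines "D \<equiv> \<lambda>t \<omega>. if good_path T (\<lambda>t. C t \<omega>) then C t \<omega> else 0"
  shows "consumption x" "increasing_process M F T D" "AE \<omega> in M. \<forall>t. C t \<omega> = D t \<omega>"
proof -
  have gp: "AE \<omega> in M. good_path T (\<lambda>t. C t \<omega>)"
    using s AE_space unfolding strategy_def good_path_def by (auto elim: eventually_elim2)
  show "consumption x" using s by (auto simp: strategy_def consumption_def)
  show "increasing_process M F T D"
    unfolding D_def using s by (intro good_version gp optional_adapted) (auto simp: strategy_def)
  show "AE \<omega> in M. \<forall>t. C t \<omega> = D t \<omega>"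
    using gp by (auto simp: D_def elim: eventually_mono)
qed

text \<open>Aggregation loses nothing: each payoff depends on the contributions through their sum,
  and the cost of the sum is the sum of the costs.\<close>

lemma normal_form:
  assumes "(x, Cs) \<in> planner_budget_set M F T \<psi>x \<psi>c n wealth"
  obtains C where "feasible x C" "AE \<omega> in M. \<forall>t. (\<Sum>i=1..n. Cs i t \<omega>) = C t \<omega>"
    "planner_objective M T r u n \<gamma> (x, Cs) = welfare x C"
proof -
  have s: "\<And>i. i \<in> {1..n} \<Longrightarrow> strategy M F T (x i) (Cs i)"
    and c: "(\<Sum>i=1..n. cost M T \<psi>x \<psi>c (x i) (Cs i)) \<le> ennreal wealth"
    using assms by (auto simp: planner_budget_set_def)
  define D where "D i = (\<lambda>t \<omega>. if good_path T (\<lambda>t. Cs i t \<omega>) then Cs i t \<omega> else 0)" for i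
  define C where "C = (\<lambda>t \<omega>. \<Sum>i=1..n. D i t \<omega>)"
  have x: "consumption (x i)" and D: "increasing_process M F T (D i)" and eq: "AE \<omega> in M. \<forall>t. Cs i t \<omega> = D i t \<omega>"
    if "i \<in> {1..n}" for i
    using strategy_good_version[OF s[OF that]] by (auto simp: D_def)
  have C: "increasing_process M F T C" "ccost C = (\<Sum>i=1..n. ccost (D i))"
    using increasing_sum[of "{1..n}" D] D by (auto simp: C_def)
  have "(\<Sum>i=1..n. xcost (x i)) + ccost C = (\<Sum>i=1..n. cost M T \<psi>x \<psi>c (x i) (Cs i))"
    unfolding C(2) sum.distrib[symmetric] using x D eq by (intro sum.cong refl cost_eq[symmetric]) auto
  then have f: "feasible x C" using c C x by (simp add: feasible_def)
  have "AE \<omega> in M. \<forall>i\<in>{1..n}. \<forall>t. Cs i t \<omega> = D i t \<omega>"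
    using eq by (intro AE_finite_allI) auto
  then have e: "AE \<omega> in M. \<forall>t. (\<Sum>i=1..n. Cs i t \<omega>) = C t \<omega>"
    by (auto elim!: eventually_mono simp: C_def)
  show thesis
    using that[OF f e planner_objective_eq[OF x C(1) e]] .
qed

text \<open>Agent 1 makes all contributions; how the aggregate is divided affects neither total cost
  nor payoffs.\<close>

lemma from_normal_form:
  assumes "feasible x C"
  defines "Cs \<equiv> \<lambda>i. if i = 1 then C else (\<lambda>t \<omega>. 0)"
  shows "(x, Cs) \<in> planner_budget_set M F T \<psi>x \<psi>c n wealth"
    "planner_objective M T r u n \<gamma> (x, Cs) = welfare x C"
    "\<And>t \<omega>. (\<Sum>i=1..n. Cs i t \<omega>) = C t \<omega>"
proof -
  have x: "\<And>i. i \<in> {1..n} \<Longrightarrow> consumption (x i)" and C: "increasing_process M F T C"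
    using assms by (auto simp: feasible_def)
  have Cs: "increasing_process M F T (Cs i)" for i
    using C increasing_zero by (simp add: Cs_def)
  have strat: "strategy M F T (x i) (Cs i)" if "i \<in> {1..n}" for i
    using x[OF that] Cs[of i] increasing_optional[OF Cs[of i]]
    by (auto simp: strategy_def consumption_def increasing_process_def good_path_def)
  have one: "1 \<in> {1..n}" using n by auto
  have "(\<Sum>i=1..n. cost M T \<psi>x \<psi>c (x i) (Cs i)) = (\<Sum>i=1..n. xcost (x i) + ccost (Cs i))"
    using x Cs by (intro sum.cong refl cost_eq) auto
  also have "\<dots> = (\<Sum>i=1..n. xcost (x i)) + ccost C"
    using one ccost_zero by (simp add: sum.distrib Cs_def if_distrib[of ccost] cong: if_cong)
  also have "\<dots> \<le> ennreal wealth" using assms by (simp add: feasible_def)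
  finally show "(x, Cs) \<in> planner_budget_set M F T \<psi>x \<psi>c n wealth"
    using strat by (simp add: planner_budget_set_def)
  show e: "(\<Sum>i=1..n. Cs i t \<omega>) = C t \<omega>" for t \<omega>
    using one by (simp add: Cs_def if_distrib[of "\<lambda>f. f t \<omega>"] cong: if_cong)
  show "planner_objective M T r u n \<gamma> (x, Cs) = welfare x C"
    using e by (intro planner_objective_eq x C) auto
qed

end

section \<open>Compactness in measure\<close>

text \<open>Borel-Cantelli along indices at which deviations above (1/2)^j occur on sets of measure
  at most (1/2)^j. As the indices do not depend on \<open>i\<close>, one subsequence serves all
  components.\<close>

lemma AE_subseq_of_Cauchy_in_measure:
  fixes f :: "'i \<Rightarrow> nat \<Rightarrow> 'b \<Rightarrow> real"
  assumes meas: "\<And>i k. i \<in> I \<Longrightarrow> f i k \<in> borel_measurable \<mu>"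
    and Cau: "\<And>e. 0 < e \<Longrightarrow> \<exists>K. \<forall>k\<ge>K. \<forall>l\<ge>K. \<forall>i\<in>I. emeasure \<mu> {z\<in>space \<mu>. e < \<bar>f i k z - f i l z\<bar>} \<le> ennreal e"
  obtains r :: "nat \<Rightarrow> nat" where "strict_mono r" "\<And>i. i \<in> I \<Longrightarrow> AE z in \<mu>. convergent (\<lambda>j. f i (r j) z)"
proof -
  have "\<forall>j. \<exists>K. \<forall>k\<ge>K. \<forall>l\<ge>K. \<forall>i\<in>I. emeasure \<mu> {z\<in>space \<mu>. (1/2)^j < \<bar>f i k z - f i l z\<bar>} \<le> ennreal ((1/2)^j)"
    by (intro allI Cau) simp
  then obtain K where K: "\<And>j k l i. K j \<le> k \<Longrightarrow> K j \<le> l \<Longrightarrow> i \<in> I \<Longrightarrow>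
     emeasure \<mu> {z\<in>space \<mu>. (1/2)^j < \<bar>f i k z - f i l z\<bar>} \<le> ennreal ((1/2)^j)"
    by metis
  define r where "r = rec_nat (K 0) (\<lambda>j rj. max (K (Suc j)) (Suc rj))"
  have r_Suc: "r (Suc j) = max (K (Suc j)) (Suc (r j))" for j by (simp add: r_def)
  have r: "strict_mono r" by (auto simp: strict_mono_Suc_iff r_Suc)
  have rK: "K j \<le> r j" for j by (cases j) (simp_all add: r_Suc, simp add: r_def)
  have rK': "K j \<le> r (Suc j)" for j
    using rK[of j] strict_mono_leD[OF r, of j "Suc j"] by linarith
  show thesis
  proof (rule that[OF r])
    fix i assume i: "i \<in> I"
    note [measurable] = meas[OF i]
    define A where "A j = {z\<in>space \<mu>. (1/2)^j < \<bar>f i (r j) z - f i (r (Suc j)) z\<bar>}" for j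
    have A [measurable]: "A j \<in> sets \<mu>" for j unfolding A_def by measurable
    have le: "emeasure \<mu> (A j) \<le> ennreal ((1/2)^j)" for j
      unfolding A_def using K[OF rK rK' i] .
    have fin: "emeasure \<mu> (A j) < \<infinity>" for j using le[of j] by (auto intro: le_less_trans)
    have "measure \<mu> (A j) \<le> (1/2)^j" for j
      using le[of j] fin[of j] by (simp add: emeasure_eq_ennreal_measure)
    then have "summable (\<lambda>j. measure \<mu> (A j))"
      by (intro summable_comparison_test[OF _ summable_geometric[of "1/2::real"]]) auto
    then have "AE z in \<mu>. eventually (\<lambda>j. z \<in> space \<mu> - A j) sequentially"
      using A fin by (intro borel_cantelli_AE1) auto
    then show "AE z in \<mu>. convergent (\<lambda>j. f i (r j) z)"
    proof eventually_elim
      case (elim z)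
      let ?d = "\<lambda>j. f i (r (Suc j)) z - f i (r j) z"
      have "eventually (\<lambda>j. norm (?d j) \<le> (1/2)^j) sequentially"
        using elim by eventually_elim (auto simp: A_def abs_minus_commute not_less)
      then have "summable ?d"
        by (rule summable_comparison_test_ev) simp
      then have "(\<lambda>m. f i (r 0) z + (\<Sum>j<m. ?d j)) \<longlonglongrightarrow> f i (r 0) z + suminf ?d"
        by (intro tendsto_intros summable_LIMSEQ)
      then have "(\<lambda>m. f i (r m) z) \<longlonglongrightarrow> f i (r 0) z + suminf ?d"
        by (simp add: sum_lessThan_telescope[of "\<lambda>j. f i (r j) z"])
      then show ?case by (rule convergentI)
    qed
  qed
qed

text \<open>Since \<rho> is positive and the measure finite, \<rho> is at least some \<eta> > 0 off
  a set of measure below e/2; on the rest Markov's inequality applies. The radius does not depend on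
  \<open>f\<close>.\<close>

lemma bounded_in_measure:
  assumes fin: "finite_measure \<mu>" and \<rho> [measurable]: "\<rho> \<in> borel_measurable \<mu>"
    and pos: "\<And>z. z \<in> space \<mu> \<Longrightarrow> 0 < \<rho> z" and W: "0 < W" and e: "0 < (e::real)"
  obtains R where "0 < R" "\<And>f. f \<in> borel_measurable \<mu> \<Longrightarrow>
    (\<integral>\<^sup>+z. ennreal (\<rho> z) * ennreal (f z) \<partial>\<mu>) \<le> ennreal W \<Longrightarrow> emeasure \<mu> {z\<in>space \<mu>. R < f z} \<le> ennreal e"
proof -
  interpret finite_measure \<mu> by fact
  define B where "B m = {z\<in>space \<mu>. \<rho> z \<le> inverse (real (Suc m))}" for m
  have [measurable]: "B m \<in> sets \<mu>" for m unfolding B_def by measurable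
  have "(\<lambda>m. measure \<mu> (B m)) \<longlonglongrightarrow> measure \<mu> (\<Inter>m. B m)"
  proof (rule finite_Lim_measure_decseq)
    show "decseq B"
      unfolding decseq_def B_def by (auto elim!: order_trans intro!: le_imp_inverse_le)
  qed auto
  moreover have "(\<Inter>m. B m) = {}"
  proof (rule ccontr)
    assume "(\<Inter>m. B m) \<noteq> {}"
    then obtain z where z: "\<And>m. z \<in> B m" by auto
    then have "0 < \<rho> z" using pos by (auto simp: B_def)
    from reals_Archimedean[OF this] z show False by (auto simp: B_def not_le[symmetric])
  qed
  ultimately have "(\<lambda>m. measure \<mu> (B m)) \<longlonglongrightarrow> 0" by simp
  then have "eventually (\<lambda>m. measure \<mu> (B m) < e/2) sequentially"
    using e order_tendstoD(2)[of _ 0 sequentially "e/2"] by auto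
  then obtain m where m: "measure \<mu> (B m) < e/2" by (auto simp: eventually_sequentially)
  define \<eta> where "\<eta> = inverse (real (Suc m))"
  have \<eta>: "0 < \<eta>" by (simp add: \<eta>_def)
  \<comment> \<open>With this value Markov's bound W / (\<eta> R) is e/2.\<close>
  define R where "R = 2 * W / (\<eta> * e)"
  have R: "0 < R" using W \<eta> e by (simp add: R_def)
  show thesis
  proof (rule that[OF R])
    fix f assume f [measurable]: "f \<in> borel_measurable \<mu>"
      and le: "(\<integral>\<^sup>+z. ennreal (\<rho> z) * ennreal (f z) \<partial>\<mu>) \<le> ennreal W"
    have "emeasure \<mu> {z\<in>space \<mu>. R < f z} \<le> emeasure \<mu> (B m \<union> {z\<in>space \<mu>. 1 \<le> ennreal (1 / (\<eta> * R)) * (ennreal (\<rho> z) * ennreal (f z))})"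
    proof (rule emeasure_mono)
      show "{z\<in>space \<mu>. R < f z} \<subseteq> B m \<union> {z\<in>space \<mu>. 1 \<le> ennreal (1 / (\<eta> * R)) * (ennreal (\<rho> z) * ennreal (f z))}"
      proof
        fix z assume z: "z \<in> {z\<in>space \<mu>. R < f z}"
        show "z \<in> B m \<union> {z\<in>space \<mu>. 1 \<le> ennreal (1 / (\<eta> * R)) * (ennreal (\<rho> z) * ennreal (f z))}"
        proof (cases "z \<in> B m")
          case False
          then have "\<eta> \<le> \<rho> z" using z by (auto simp: B_def \<eta>_def)
          then have "\<eta> * R \<le> \<rho> z * f z" using z \<eta> R by (intro mult_mono) auto
          then have "1 \<le> 1 / (\<eta> * R) * (\<rho> z * f z)" using \<eta> R by (simp add: field_simps)
          then have "ennreal 1 \<le> ennreal (1 / (\<eta> * R) * (\<rho> z * f z))" by (rule ennreal_leI)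
          also have "\<dots> = ennreal (1 / (\<eta> * R)) * ennreal (\<rho> z * f z)"
            using z R \<eta> pos[of z] by (intro ennreal_mult) auto
          also have "ennreal (\<rho> z * f z) = ennreal (\<rho> z) * ennreal (f z)"
            using z R pos[of z] by (intro ennreal_mult) auto
          finally show ?thesis using z by simp
        qed simp
      qed
    qed measurable
    also have "\<dots> \<le> emeasure \<mu> (B m) + emeasure \<mu> {z\<in>space \<mu>. 1 \<le> ennreal (1 / (\<eta> * R)) * (ennreal (\<rho> z) * ennreal (f z))}"
      by (rule emeasure_subadditive) measurable
    also have "emeasure \<mu> (B m) \<le> ennreal (e/2)"
      using m by (simp add: emeasure_eq_measure ennreal_leI)
    also have "emeasure \<mu> {z\<in>space \<mu>. 1 \<le> ennreal (1 / (\<eta> * R)) * (ennreal (\<rho> z) * ennreal (f z))} \<le>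
      ennreal (1 / (\<eta> * R)) * (\<integral>\<^sup>+z. (ennreal (\<rho> z) * ennreal (f z)) * indicator (space \<mu>) z \<partial>\<mu>)"
      using nn_integral_Markov_inequality[of "\<lambda>z. ennreal (\<rho> z) * ennreal (f z)" "space \<mu>" \<mu> "ennreal (1 / (\<eta> * R))"]
      by simp
    also have "(\<integral>\<^sup>+z. (ennreal (\<rho> z) * ennreal (f z)) * indicator (space \<mu>) z \<partial>\<mu>) = (\<integral>\<^sup>+z. (ennreal (\<rho> z) * ennreal (f z)) \<partial>\<mu>)"
      by (intro nn_integral_cong) simp
    also note le
    also have "ennreal (1 / (\<eta> * R)) * ennreal W = ennreal (e / 2)"
      using W \<eta> e R by (simp add: ennreal_mult[symmetric] R_def)
    also have "ennreal (e/2) + ennreal (e/2) = ennreal e"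
      using e by (simp add: ennreal_plus[symmetric] del: ennreal_plus)
    finally show "emeasure \<mu> {z\<in>space \<mu>. R < f z} \<le> ennreal e"
      by (auto simp: add_mono mult_left_mono)
  qed
qed

text \<open>The gap is continuous and positive on the compact set of pairs in the ball at distance
  at least \<open>e\<close>, so it has a positive minimum. Compactness needs the boundary of the
  quadrant, hence continuity of \<open>v\<close> there.\<close>

lemma concavity_gap:
  assumes v: "utility_regular v" and e: "0 < e"
  obtains \<delta> where "0 < \<delta>" "\<And>p q. p \<in> quadrant \<Longrightarrow> q \<in> quadrant \<Longrightarrow> norm p \<le> R \<Longrightarrow> norm q \<le> R \<Longrightarrow> e \<le> dist p q \<Longrightarrow>
    \<delta> \<le> v ((1/2) *\<^sub>R (p + q)) - (v p + v q) / 2"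
proof -
  define Q where "Q = quadrant \<inter> cball 0 R"
  define K where "K = (Q \<times> Q) \<inter> {z. e \<le> dist (fst z) (snd z)}"
  define g where "g z = v ((1/2) *\<^sub>R (fst z + snd z)) - (v (fst z) + v (snd z)) / 2" for z
  have "compact Q" unfolding Q_def using quadrant_closed by (intro closed_Int_compact) auto
  moreover have "closed {z :: (real \<times> real) \<times> (real \<times> real). e \<le> dist (fst z) (snd z)}"
    by (intro closed_Collect_le continuous_intros)
  ultimately have K: "compact K" unfolding K_def by (intro compact_Int_closed compact_Times)
  have mid: "(1/2) *\<^sub>R (p + q) \<in> quadrant" if "p \<in> quadrant" "q \<in> quadrant" for p q
    using that by (auto simp: quadrant_def)
  have vc: "continuous_on quadrant v" using v by (simp add: utility_regular_def)
  have cont: "continuous_on K g"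
    unfolding g_def
  proof (intro continuous_intros continuous_on_compose2[OF vc] image_subsetI)
    fix z assume "z \<in> K"
    then have "fst z \<in> quadrant" "snd z \<in> quadrant" by (auto simp: K_def Q_def)
    then show "(1/2) *\<^sub>R (fst z + snd z) \<in> quadrant" "fst z \<in> quadrant" "snd z \<in> quadrant"
      by (auto intro: mid)
  qed auto
  show thesis
  proof (cases "K = {}")
    case True
    show thesis
    proof (rule that[of 1])
      fix p q assume "p \<in> quadrant" "q \<in> quadrant" "norm p \<le> R" "norm q \<le> R" "e \<le> dist p q"
      then have "(p, q) \<in> K" by (auto simp: K_def Q_def)
      then show "1 \<le> v ((1/2) *\<^sub>R (p + q)) - (v p + v q) / 2" using True by simp
    qed simp
  next
    case False
    obtain z where z: "z \<in> K" "\<And>y. y \<in> K \<Longrightarrow> g z \<le> g y"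
      using continuous_attains_inf[OF K False cont] by blast
    have "fst z \<noteq> snd z" using z(1) e by (auto simp: K_def)
    then have "0 < g z"
      using concave_midpoint(2)[OF v, of "fst z" "snd z"] z(1) by (auto simp: g_def K_def Q_def)
    then show thesis
    proof (rule that)
      fix p q assume "p \<in> quadrant" "q \<in> quadrant" "norm p \<le> R" "norm q \<le> R" "e \<le> dist p q"
      then have "(p, q) \<in> K" by (auto simp: K_def Q_def)
      from z(2)[OF this] show "g z \<le> v ((1/2) *\<^sub>R (p + q)) - (v p + v q) / 2" by (simp add: g_def)
    qed
  qed
qed

lemma nn_integral_exp_horizon:
  "(\<integral>\<^sup>+t\<in>horizon T. ennreal (exp (- t)) \<partial>lborel) \<le> 1"
proof -
  have "(\<integral>\<^sup>+t\<in>horizon T. ennreal (exp (- t)) \<partial>lborel) \<le> (\<integral>\<^sup>+t. ennreal (exponential_density 1 t) \<partial>lborel)"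
    by (intro nn_integral_mono) (auto simp: exponential_density_def indicator_def horizon_def)
  also have "\<dots> = emeasure (density lborel (exponential_density 1)) (space lborel)"
    by (subst emeasure_density) auto
  also have "\<dots> = 1"
    using prob_space.emeasure_space_1[OF prob_space_exponential_density[of 1]] by simp
  finally show ?thesis .
qed

lemma (in prob_space) nn_integral_prod_time_swap:
  assumes "f \<in> borel_measurable (prod_time M T)"
  shows "(\<integral>\<^sup>+z. f z \<partial>(prod_time M T)) = (\<integral>\<^sup>+t\<in>horizon T. (\<integral>\<^sup>+\<omega>. f (\<omega>, t) \<partial>M) \<partial>lborel)"
proof -
  interpret R: sigma_finite_measure "restrict_space lborel (horizon T)" by simp
  interpret R: pair_sigma_finite M "restrict_space lborel (horizon T)" ..
  show ?thesis
    using R.nn_integral_snd[of f] assms unfolding prod_time_def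
    by (simp add: nn_integral_restrict_space)
qed

section \<open>Bounds in a finite measure equivalent to P \<otimes> dt\<close>

context planner
begin

abbreviation "N \<equiv> prod_time M T"

text \<open>The exponential makes \<open>\<mu>\<close> finite even for T = \<infinity>. The discount
  factor keeps the weight below the one in the payoffs, so that small concavity gaps control
  \<open>\<mu>\<close>. Positivity keeps the null sets.\<close>

definition weight :: "'a \<times> real \<Rightarrow> real" where
  "weight z = exp (- snd z) * discount r (snd z) (fst z)"

definition \<mu> :: "('a \<times> real) measure" where
  "\<mu> = density N (\<lambda>z. ennreal (weight z))"

lemma weight_measurable [measurable]: "weight \<in> borel_measurable N"
  unfolding weight_def[abs_def] using discount_measurable[OF r_optional] by measurable

lemma sets_\<mu> [simp, measurable_cong]: "sets \<mu> = sets N" and space_\<mu> [simp]: "space \<mu> = space N"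
  by (simp_all add: \<mu>_def)

lemma weight_bounds:
  assumes "z \<in> space N"
  shows "0 < weight z" "weight z \<le> discount r (snd z) (fst z)" "weight z \<le> exp (- snd z)"
    "weight z \<le> 1"
proof -
  have t: "0 \<le> snd z" using assms by (auto simp: space_prod_time horizon_def)
  note d = discount_bounds(1)[of "snd z" "fst z"] discount_bounds(2)[OF assms]
  show "0 < weight z" using d by (simp add: weight_def)
  show *: "weight z \<le> discount r (snd z) (fst z)"
    unfolding weight_def using d t by (intro mult_left_le_one_le) auto
  show "weight z \<le> exp (- snd z)"
    unfolding weight_def using d by (simp add: mult_left_le)
  show "weight z \<le> 1" using * d by simp
qed

lemma AE_\<mu>: "(AE z in \<mu>. P z) \<longleftrightarrow> (AE z in N. P z)"
proof -
  have "AE z in N. ennreal (weight z) > 0"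
    using weight_bounds(1) by (intro AE_I2) simp
  then show ?thesis unfolding \<mu>_def by (subst AE_density) (auto elim: eventually_rev_mp intro!: eventually_subst elim!: eventually_mono)
qed

lemma nn_integral_\<mu>: "f \<in> borel_measurable N \<Longrightarrow> (\<integral>\<^sup>+z. f z \<partial>\<mu>) = (\<integral>\<^sup>+z. ennreal (weight z) * f z \<partial>N)"
  unfolding \<mu>_def by (rule nn_integral_density) auto

lemma nn_integral_exp_N: "(\<integral>\<^sup>+z. ennreal (exp (- snd z)) \<partial>N) \<le> 1"
proof -
  have "(\<integral>\<^sup>+z. ennreal (exp (- snd z)) \<partial>N) = (\<integral>\<^sup>+\<omega>. (\<integral>\<^sup>+t\<in>horizon T. ennreal (exp (- t)) \<partial>lborel) \<partial>M)"
    by (subst nn_integral_prod_time) auto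
  also have "\<dots> \<le> (\<integral>\<^sup>+\<omega>. 1 \<partial>M)"
    by (intro nn_integral_mono nn_integral_exp_horizon)
  also have "\<dots> = 1" by (simp add: emeasure_space_1)
  finally show ?thesis .
qed

lemma finite_\<mu>: "finite_measure \<mu>"
proof
  have "emeasure \<mu> (space \<mu>) = (\<integral>\<^sup>+z. ennreal (weight z) * indicator (space N) z \<partial>N)"
    unfolding \<mu>_def by (subst emeasure_density) auto
  also have "\<dots> \<le> (\<integral>\<^sup>+z. ennreal (exp (- snd z)) \<partial>N)"
    using weight_bounds(3) by (intro nn_integral_mono) (auto intro: ennreal_leI)
  also note nn_integral_exp_N
  finally show "emeasure \<mu> (space \<mu>) \<noteq> \<infinity>" by (auto simp: top_unique)
qed

lemma feasible_costs:
  assumes f: "feasible x C"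
  shows "i \<in> {1..n} \<Longrightarrow> xcost (x i) \<le> ennreal wealth" "ccost C \<le> ennreal wealth"
proof -
  have le: "(\<Sum>i=1..n. xcost (x i)) + ccost C \<le> ennreal wealth" using f by (simp add: feasible_def)
  show "ccost C \<le> ennreal wealth" using le by (meson add_increasing order_refl order_trans zero_le)
  assume i: "i \<in> {1..n}"
  have "xcost (x i) \<le> (\<Sum>i=1..n. xcost (x i))" using i by (intro member_le_sum) auto
  also have "\<dots> \<le> (\<Sum>i=1..n. xcost (x i)) + ccost C" by simp
  finally show "xcost (x i) \<le> ennreal wealth" using le by order
qed

lemma expected_level:
  assumes f: "feasible x C" and t: "t \<in> horizon T" "0 < t"
  shows "(\<integral>\<^sup>+\<omega>. ennreal (\<psi>c t \<omega> * C t \<omega>) \<partial>M) \<le> ennreal wealth"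
proof -
  have C: "increasing_process M F T C" using f by (simp add: feasible_def)
  have "(\<integral>\<^sup>+\<omega>. ennreal (\<psi>c t \<omega> * C t \<omega>) \<partial>M) \<le> (\<integral>\<^sup>+\<omega>. stieltjes_upto T t (\<lambda>t. \<psi>c t \<omega>) (\<lambda>t. C t \<omega>) \<partial>M)"
    by (rule pc.expected_level_le_upto[OF C t])
  also have "\<dots> \<le> ccost C"
    unfolding ccost_def
    by (intro nn_integral_mono nonneg_integrand.upto_le_integral[OF pc.psi_integrand t(1)])
  also have "\<dots> \<le> ennreal wealth" by (rule feasible_costs[OF f])
  finally show ?thesis .
qed

lemma \<psi>c_measurable: "(\<lambda>z. \<psi>c (snd z) (fst z)) \<in> borel_measurable N"
  using pc.price by (intro optional_measurable optionalI) (auto simp: price_process_def)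

text \<open>Costs charge increments and not levels. The level is bounded at each time by
  \<open>expected_level\<close>, and exp (- t) has integral at most 1.\<close>

lemma weighted_level:
  assumes f: "feasible x C"
  shows "(\<integral>\<^sup>+z. ennreal (\<psi>c (snd z) (fst z)) * ennreal (C (snd z) (fst z)) \<partial>\<mu>) \<le> ennreal wealth"
proof -
  have C: "increasing_process M F T C" using f by (simp add: feasible_def)
  note [measurable] = \<psi>c_measurable consumption_measurable[OF increasing_consumption[OF C]]
  have "(\<integral>\<^sup>+z. ennreal (\<psi>c (snd z) (fst z)) * ennreal (C (snd z) (fst z)) \<partial>\<mu>) =
    (\<integral>\<^sup>+z. ennreal (weight z) * (ennreal (\<psi>c (snd z) (fst z)) * ennreal (C (snd z) (fst z))) \<partial>N)"
    by (rule nn_integral_\<mu>) measurable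
  also have "\<dots> \<le> (\<integral>\<^sup>+z. ennreal (exp (- snd z)) * ennreal (\<psi>c (snd z) (fst z) * C (snd z) (fst z)) \<partial>N)"
    using weight_bounds(3) pc.psi_pos
    by (intro nn_integral_mono mult_mono)
      (auto intro!: ennreal_leI simp: space_prod_time ennreal_mult'[symmetric] less_imp_le)
  also have "\<dots> = (\<integral>\<^sup>+t\<in>horizon T. (\<integral>\<^sup>+\<omega>. ennreal (exp (- t)) * ennreal (\<psi>c t \<omega> * C t \<omega>) \<partial>M) \<partial>lborel)"
    by (subst nn_integral_prod_time_swap) auto
  also have "\<dots> \<le> (\<integral>\<^sup>+t. ennreal wealth * (ennreal (exp (- t)) * indicator (horizon T) t) \<partial>lborel)"
  proof (rule nn_integral_mono_AE)
    \<comment> \<open>Time 0 is set aside because grids need a positive end.\<close>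
    have "AE t in lborel. t \<noteq> (0::real)" by (rule AE_lborel_singleton)
    then show "AE t in lborel. (\<integral>\<^sup>+\<omega>. ennreal (exp (- t)) * ennreal (\<psi>c t \<omega> * C t \<omega>) \<partial>M) * indicator (horizon T) t
      \<le> ennreal wealth * (ennreal (exp (- t)) * indicator (horizon T) t)"
    proof eventually_elim
      case (elim t)
      show ?case
      proof (cases "t \<in> horizon T")
        case True
        then have "0 < t" using elim by (auto simp: horizon_def)
        have [measurable]: "\<psi>c t \<in> borel_measurable M" "C t \<in> borel_measurable M"
          using pc.psi_measurable[OF True] C measurable_F_M[OF _ True] True
          by (auto simp: increasing_process_def adapted_def)
        have "(\<integral>\<^sup>+\<omega>. ennreal (exp (- t)) * ennreal (\<psi>c t \<omega> * C t \<omega>) \<partial>M) = ennreal (exp (- t)) * (\<integral>\<^sup>+\<omega>. ennreal (\<psi>c t \<omega> * C t \<omega>) \<partial>M)"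
          by (rule nn_integral_cmult) measurable
        also have "\<dots> \<le> ennreal (exp (- t)) * ennreal wealth"
          by (intro mult_left_mono expected_level[OF f True \<open>0 < t\<close>]) simp
        finally show ?thesis using True by (simp add: mult.commute)
      qed simp
    qed
  qed
  also have "\<dots> = ennreal wealth * (\<integral>\<^sup>+t\<in>horizon T. ennreal (exp (- t)) \<partial>lborel)"
    by (rule nn_integral_cmult) measurable
  also have "\<dots> \<le> ennreal wealth * 1"
    by (intro mult_left_mono nn_integral_exp_horizon) simp
  finally show ?thesis by simp
qed

lemma weighted_consumption:
  assumes f: "feasible x C" and i: "i \<in> {1..n}"
  shows "(\<integral>\<^sup>+z. ennreal (\<psi>x (snd z) (fst z)) * ennreal (x i (snd z) (fst z)) \<partial>\<mu>) \<le> ennreal wealth"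
proof -
  have x: "consumption (x i)" using f i by (simp add: feasible_def)
  note [measurable] = xcost_eq(3)[OF x] consumption_measurable[OF x]
  have "(\<integral>\<^sup>+z. ennreal (\<psi>x (snd z) (fst z)) * ennreal (x i (snd z) (fst z)) \<partial>\<mu>) =
    (\<integral>\<^sup>+z. ennreal (weight z) * (ennreal (\<psi>x (snd z) (fst z)) * ennreal (x i (snd z) (fst z))) \<partial>N)"
    by (rule nn_integral_\<mu>) measurable
  also have "\<dots> \<le> (\<integral>\<^sup>+z. 1 * (ennreal (\<psi>x (snd z) (fst z)) * ennreal (x i (snd z) (fst z))) \<partial>N)"
    using weight_bounds(4) by (intro nn_integral_mono mult_right_mono) auto
  also have "\<dots> = xcost (x i)" by (simp add: xcost_eq(1)[OF x])
  also have "\<dots> \<le> ennreal wealth" by (rule feasible_costs(1)[OF f i])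
  finally show ?thesis .
qed

end

section \<open>Uniform integrability and the concavity gap\<close>

context planner
begin

text \<open>The share of total wealth owned by the poorest agent: scaled by it, the planner's entire
  expenditure fits into any single budget.\<close>

definition lam :: real where "lam = Min (w ` {1..n}) / wealth"

lemma lam: "0 < lam" "lam \<le> 1" "i \<in> {1..n} \<Longrightarrow> lam * wealth \<le> w i"
proof -
  have ne: "w ` {1..n} \<noteq> {}" using n by auto
  have "Min (w ` {1..n}) \<in> w ` {1..n}" using ne by (intro Min_in) auto
  then show "0 < lam" unfolding lam_def using w_pos wealth_pos by auto
  have *: "lam * wealth \<le> w i" if "i \<in> {1..n}" for i
    unfolding lam_def using wealth_pos that by (simp add: Min_le)
  then show "i \<in> {1..n} \<Longrightarrow> lam * wealth \<le> w i" .
  have one: "1 \<in> {1..n}" using n by auto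
  have "w 1 \<le> wealth"
    unfolding wealth_def using one w_pos by (intro member_le_sum) (auto intro: less_imp_le)
  then have "lam * wealth \<le> 1 * wealth" using *[OF one] by simp
  then show "lam \<le> 1" using wealth_pos by (simp add: mult_le_cancel_right)
qed

text \<open>As the whole scaled expenditure is affordable to each agent, agent 1 can carry all
  contributions in addition to private consumption.\<close>

lemma scaled_in_budgets:
  assumes f: "feasible x C" and j: "j \<in> {1..n}"
  shows "((\<lambda>t \<omega>. lam * x j t \<omega>), (if j = 1 then (\<lambda>t \<omega>. lam * C t \<omega>) else (\<lambda>t \<omega>. 0))) \<in> budget_set M F T \<psi>x \<psi>c (w j)"
proof -
  have x: "consumption (x j)" and C: "increasing_process M F T C" using f j by (auto simp: feasible_def)
  let ?C = "if j = 1 then (\<lambda>t \<omega>. lam * C t \<omega>) else (\<lambda>t \<omega>. 0)"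
  have x': "consumption (\<lambda>t \<omega>. lam * x j t \<omega>)" "xcost (\<lambda>t \<omega>. lam * x j t \<omega>) = ennreal lam * xcost (x j)"
    using xcost_lincomb[OF x x, of lam 0] lam by simp_all
  have "increasing_process M F T (\<lambda>t \<omega>. lam * C t \<omega>)" "ccost (\<lambda>t \<omega>. lam * C t \<omega>) = ennreal lam * ccost C"
    using increasing_lincomb[OF C C, of lam 0] ccost_lincomb[OF C C, of lam 0] lam by simp_all
  then have C': "increasing_process M F T ?C" "ccost ?C \<le> ennreal lam * ccost C"
    using increasing_zero ccost_zero by simp_all
  have s: "strategy M F T (\<lambda>t \<omega>. lam * x j t \<omega>) ?C"
    using x'(1) C'(1) increasing_optional[OF C'(1)]
    unfolding strategy_def consumption_def increasing_process_def good_path_def by auto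
  have "cost M T \<psi>x \<psi>c (\<lambda>t \<omega>. lam * x j t \<omega>) ?C = xcost (\<lambda>t \<omega>. lam * x j t \<omega>) + ccost ?C"
    by (rule cost_eq[OF x'(1) C'(1)]) simp
  also have "\<dots> \<le> ennreal lam * (xcost (x j) + ccost C)"
    unfolding x'(2) distrib_left by (intro add_left_mono C'(2))
  also have "xcost (x j) + ccost C \<le> (\<Sum>i=1..n. xcost (x i)) + ccost C"
    using j by (intro add_right_mono member_le_sum) auto
  also have "\<dots> \<le> ennreal wealth" using f by (simp add: feasible_def)
  also have "ennreal lam * ennreal wealth = ennreal (lam * wealth)"
    using lam(1) wealth_pos by (simp add: ennreal_mult)
  also have "\<dots> \<le> ennreal (w j)" by (intro ennreal_leI lam j)
  finally show ?thesis using s by (simp add: budget_set_def mult_left_mono)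
qed

text \<open>Scaling by \<open>lam\<close> moves the planner's budget into the product of the individual budgets, and
  concavity with \<open>u i \<ge> 0\<close> bounds the utility by \<open>1 / lam\<close> times the utility after scaling; this
  is how uniform integrability carries over to the planner.\<close>

lemma uniform_integrability:
  assumes i: "i \<in> {1..n}" and e: "0 < (e::real)"
  obtains g where "integrable N g" "\<And>z. z \<in> space N \<Longrightarrow> 0 \<le> g z"
    "\<And>x C. feasible x C \<Longrightarrow> (\<integral>\<^sup>+z. ennreal (util i (x i) C z - g z) \<partial>N) \<le> ennreal e"
proof -
  define FAM where "FAM = {(\<lambda>(\<omega>, t). discount r t \<omega> * u i (x i t \<omega>, \<Sum>j=1..n. C j t \<omega>)) | x C.
             \<forall>j\<in>{1..n}. (x j, C j) \<in> budget_set M F T \<psi>x \<psi>c (w j)}"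
  have UI: "uniformly_integrable N FAM"
    using AU[unfolded Assumption_U_def, rule_format, OF i] unfolding FAM_def by (rule conjunct2)
  \<comment> \<open>The tolerance is scaled to offset the factor 1 / lam coming from
    concavity.\<close>
  have "0 < lam * e" using lam e by simp
  obtain g where g: "integrable N g" "\<And>z. z \<in> space N \<Longrightarrow> 0 \<le> g z"
    and le: "\<And>f. f \<in> FAM \<Longrightarrow> (\<integral>\<^sup>+y\<in>{y. g y \<le> \<bar>f y\<bar>}. ennreal \<bar>f y\<bar> \<partial>N) \<le> ennreal (lam * e)"
    using UI[unfolded uniformly_integrable_def, THEN conjunct2, rule_format, OF \<open>0 < lam * e\<close>] by auto
  have [measurable]: "g \<in> borel_measurable N" using g by auto
  show thesis
  proof (rule that[of "\<lambda>z. g z / lam"])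
    show "integrable N (\<lambda>z. g z / lam)" using g by auto
    show "0 \<le> g z / lam" if "z \<in> space N" for z using g(2)[OF that] lam by simp
    fix x C assume f: "feasible x C"
    have x: "consumption (x i)" and C: "increasing_process M F T C" using f i by (auto simp: feasible_def)
    define h where "h = util i (\<lambda>t \<omega>. lam * x i t \<omega>) (\<lambda>t \<omega>. lam * C t \<omega>)"
    have cx: "consumption (\<lambda>t \<omega>. lam * x i t \<omega>)" "consumption (\<lambda>t \<omega>. lam * C t \<omega>)"
      using xcost_lincomb(2)[OF x x, of lam 0] xcost_lincomb(2)[OF increasing_consumption[OF C] increasing_consumption[OF C], of lam 0] lam by simp_all
    have [measurable]: "h \<in> borel_measurable N" unfolding h_def by (rule util_measurable[OF i cx])
    have one: "1 \<in> {1..n}" using n by auto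
    have "h \<in> FAM"
    proof -
      let ?C = "\<lambda>j. if j = 1 then (\<lambda>t \<omega>. lam * C t \<omega>) else (\<lambda>t \<omega>. 0)"
      have "(\<Sum>j=1..n. ?C j t \<omega>) = lam * C t \<omega>" for t \<omega>
        using one by (simp add: if_distrib[of "\<lambda>f. f t \<omega>"] cong: if_cong)
      then have "h = (\<lambda>(\<omega>, t). discount r t \<omega> * u i (lam * x i t \<omega>, \<Sum>j=1..n. ?C j t \<omega>))"
        by (auto simp: h_def util_def fun_eq_iff)
      then show ?thesis unfolding FAM_def using scaled_in_budgets[OF f]
        by (intro CollectI exI[of _ "\<lambda>j t \<omega>. lam * x j t \<omega>"] exI[of _ ?C]) auto
    qed
    have le_h: "util i (x i) C z \<le> h z / lam" if z: "z \<in> space N" for z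
    proof -
      let ?p = "(x i (snd z) (fst z), C (snd z) (fst z))"
      have "lam * u i ?p \<le> u i (lam *\<^sub>R ?p)"
        by (rule concave_scale[OF u_regular[OF i] quadrant_process[OF x increasing_consumption[OF C] z] lam(1,2)])
      then have "discount r (snd z) (fst z) * (lam * u i ?p) \<le> discount r (snd z) (fst z) * u i (lam *\<^sub>R ?p)"
        using discount_bounds(1) by (intro mult_left_mono) (auto simp: less_imp_le)
      then show ?thesis using lam by (simp add: h_def util_def field_simps)
    qed
    have "(\<integral>\<^sup>+z. ennreal (util i (x i) C z - g z / lam) \<partial>N) \<le>
      (\<integral>\<^sup>+z. ennreal (1 / lam) * (ennreal \<bar>h z\<bar> * indicator {y. g y \<le> \<bar>h y\<bar>} z) \<partial>N)"
    proof (rule nn_integral_mono)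
      fix z assume z: "z \<in> space N"
      show "ennreal (util i (x i) C z - g z / lam) \<le> ennreal (1 / lam) * (ennreal \<bar>h z\<bar> * indicator {y. g y \<le> \<bar>h y\<bar>} z)"
      \<comment> \<open>An excess over \<open>g z / lam\<close> occurs only where \<open>h\<close>
        exceeds \<open>g\<close>, which is the set on which uniform integrability bounds
        \<open>h\<close>.\<close>
      proof (cases "util i (x i) C z \<le> g z / lam")
        case True
        then show ?thesis by (simp add: ennreal_neg)
      next
        case False
        then have "g z / lam < h z / lam" using le_h[OF z] by linarith
        then have gh: "g z < h z" using lam by (simp add: divide_less_cancel)
        have "0 \<le> g z / lam" using g(2)[OF z] lam(1) by simp
        then have "util i (x i) C z - g z / lam \<le> (1 / lam) * \<bar>h z\<bar>"
          using le_h[OF z] g(2)[OF z] gh by simp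
        then have "ennreal (util i (x i) C z - g z / lam) \<le> ennreal ((1 / lam) * \<bar>h z\<bar>)" by (rule ennreal_leI)
        also have "\<dots> = ennreal (1 / lam) * ennreal \<bar>h z\<bar>" using lam by (intro ennreal_mult) auto
        finally show ?thesis using gh by simp
      qed
    qed
    also have "\<dots> = ennreal (1 / lam) * (\<integral>\<^sup>+y\<in>{y. g y \<le> \<bar>h y\<bar>}. ennreal \<bar>h y\<bar> \<partial>N)"
      by (rule nn_integral_cmult) measurable
    also have "\<dots> \<le> ennreal (1 / lam) * ennreal (lam * e)"
      by (intro mult_left_mono le \<open>h \<in> FAM\<close>) simp
    also have "\<dots> = ennreal e" using lam e by (simp add: ennreal_mult[symmetric])
    finally show "(\<integral>\<^sup>+z. ennreal (util i (x i) C z - g z / lam) \<partial>N) \<le> ennreal e" .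
  qed
qed

lemma uniform_integrability_family:
  assumes e: "0 < (e::real)"
  obtains g where "\<And>i. i \<in> {1..n} \<Longrightarrow> integrable N (g i)"
    "\<And>i z. i \<in> {1..n} \<Longrightarrow> z \<in> space N \<Longrightarrow> 0 \<le> g i z"
    "\<And>i x C. i \<in> {1..n} \<Longrightarrow> feasible x C \<Longrightarrow> (\<integral>\<^sup>+z. ennreal (util i (x i) C z - g i z) \<partial>N) \<le> ennreal e"
proof -
  define P where "P i g \<longleftrightarrow> integrable N g \<and> (\<forall>z\<in>space N. 0 \<le> g z) \<and>
     (\<forall>x C. feasible x C \<longrightarrow> (\<integral>\<^sup>+z. ennreal (util i (x i) C z - g z) \<partial>N) \<le> ennreal e)" for i g
  have "\<exists>g. P i g" if i: "i \<in> {1..n}" for i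
  proof -
    obtain g where "integrable N g" "\<And>z. z \<in> space N \<Longrightarrow> 0 \<le> g z"
      "\<And>x C. feasible x C \<Longrightarrow> (\<integral>\<^sup>+z. ennreal (util i (x i) C z - g z) \<partial>N) \<le> ennreal e"
      by (rule uniform_integrability[OF i e]) (rule that)
    then show ?thesis by (auto simp: P_def intro!: exI[of _ g])
  qed
  then have "P i (SOME g. P i g)" if "i \<in> {1..n}" for i
    using someI_ex[of "P i"] that by blast
  then show thesis
    by (intro that[of "\<lambda>i. SOME g. P i g"]) (auto simp: P_def)
qed

lemma (in -) ennreal_half_add: "ennreal (1/2) * c + ennreal (1/2) * c = c"
proof -
  have "ennreal (1/2) + ennreal (1/2) = ennreal (1/2 + 1/2)" by (rule ennreal_plus[symmetric]) auto
  then have "ennreal (1/2) + ennreal (1/2) = 1" by simp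
  then show ?thesis by (simp only: distrib_right[symmetric] mult_1_left)
qed

text \<open>As \<open>ennreal\<close> sends negative numbers to 0, the last term is a positive part:
  a payoff splits into a dominated part and its excess.\<close>

lemma (in -) split_min:
  assumes "0 \<le> a" "0 \<le> b"
  shows "ennreal a \<le> ennreal (min a b) + ennreal (a - b)"
  using assms by (cases "a \<le> b") (auto simp: ennreal_neg ennreal_plus[symmetric] simp del: ennreal_plus)

section \<open>Finiteness and upper semicontinuity of welfare\<close>

definition max_welfare :: ennreal where
  "max_welfare = (SUP (x, C)\<in>{(x, C). feasible x C}. welfare x C)"

lemma welfare_le: "feasible x C \<Longrightarrow> welfare x C \<le> max_welfare"
  unfolding max_welfare_def by (rule SUP_upper2[of "(x, C)"]) auto

lemma sum_\<gamma>_const: "(\<Sum>i=1..n. ennreal (\<gamma> i) * c) = c"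
proof -
  have "(\<Sum>i=1..n. ennreal (\<gamma> i) * c) = (\<Sum>i=1..n. ennreal (\<gamma> i)) * c" by (simp add: sum_distrib_right)
  also have "(\<Sum>i=1..n. ennreal (\<gamma> i)) = 1"
    using \<gamma>_pos \<gamma>_sum by (subst sum_ennreal) (auto simp: less_imp_le)
  finally show ?thesis by simp
qed

text \<open>Uniform integrability with tolerance 1 bounds each payoff by the integral of
  \<open>g i\<close> plus 1. Finiteness is what permits cancellation in
  \<open>gap_bound\<close>.\<close>

lemma max_welfare_finite: "max_welfare < \<infinity>"
proof -
  obtain g where g: "\<And>i. i \<in> {1..n} \<Longrightarrow> integrable N (g i)" "\<And>i z. i \<in> {1..n} \<Longrightarrow> z \<in> space N \<Longrightarrow> 0 \<le> g i z"
    and le: "\<And>i x C. i \<in> {1..n} \<Longrightarrow> feasible x C \<Longrightarrow> (\<integral>\<^sup>+z. ennreal (util i (x i) C z - g i z) \<partial>N) \<le> ennreal 1"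
    by (rule uniform_integrability_family[OF zero_less_one]) (rule that)
  define B where "B = (\<Sum>i=1..n. ennreal (\<gamma> i) * ((\<integral>\<^sup>+z. ennreal (g i z) \<partial>N) + 1))"
  have "(\<integral>\<^sup>+z. ennreal (g i z) \<partial>N) < \<infinity>" if "i \<in> {1..n}" for i
    using g(1)[OF that] g(2)[OF that] by (subst nn_integral_eq_integral) (auto intro!: AE_I2)
  then have "B < \<infinity>" unfolding B_def by (auto simp: ennreal_mult_less_top)
  moreover have "welfare x C \<le> B" if f: "feasible x C" for x C
    unfolding welfare_def B_def
  proof (intro sum_mono mult_left_mono)
    fix i assume i: "i \<in> {1..n}"
    have x: "consumption (x i)" "consumption C"
      using f i increasing_consumption by (auto simp: feasible_def)
    have [measurable]: "util i (x i) C \<in> borel_measurable N" by (rule util_measurable[OF i x])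
    have [measurable]: "g i \<in> borel_measurable N" using g(1)[OF i] by auto
    have "(\<integral>\<^sup>+z. ennreal (util i (x i) C z) \<partial>N) \<le> (\<integral>\<^sup>+z. ennreal (g i z) + ennreal (util i (x i) C z - g i z) \<partial>N)"
    proof (rule nn_integral_mono)
      fix z assume z: "z \<in> space N"
      have "ennreal (util i (x i) C z) \<le> ennreal (min (util i (x i) C z) (g i z)) + ennreal (util i (x i) C z - g i z)"
        by (rule split_min[OF util_nonneg[OF i x z] g(2)[OF i z]])
      also have "\<dots> \<le> ennreal (g i z) + ennreal (util i (x i) C z - g i z)"
        by (intro add_right_mono ennreal_leI) simp
      finally show "ennreal (util i (x i) C z) \<le> ennreal (g i z) + ennreal (util i (x i) C z - g i z)" .
    qed
    also have "\<dots> = (\<integral>\<^sup>+z. ennreal (g i z) \<partial>N) + (\<integral>\<^sup>+z. ennreal (util i (x i) C z - g i z) \<partial>N)"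
      by (rule nn_integral_add) measurable
    also have "\<dots> \<le> (\<integral>\<^sup>+z. ennreal (g i z) \<partial>N) + 1"
      using le[OF i f] by (intro add_left_mono) simp
    finally show "(\<integral>\<^sup>+z. ennreal (util i (x i) C z) \<partial>N) \<le> (\<integral>\<^sup>+z. ennreal (g i z) \<partial>N) + 1" .
  qed simp
  ultimately show ?thesis
    unfolding max_welfare_def by (intro le_less_trans[OF SUP_least]) auto
qed

text \<open>Each utility is cut at \<open>g i\<close>: the cut part converges by dominated
  convergence, and the excess integrates to at most \<open>e\<close> for all \<open>k\<close>. The
  weights sum to 1, so the total error is again \<open>e\<close>.\<close>

lemma welfare_upper_semicontinuous:
  assumes f: "\<And>k. feasible (X k) (D k)"
    and x: "\<And>i. i \<in> {1..n} \<Longrightarrow> consumption (x i)" "consumption C"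
    and lim: "\<And>i. i \<in> {1..n} \<Longrightarrow> AE z in N. (\<lambda>k. util i (X k i) (D k) z) \<longlonglongrightarrow> util i (x i) C z"
    and V: "(\<lambda>k. welfare (X k) (D k)) \<longlonglongrightarrow> V"
  shows "V \<le> welfare x C"
proof (rule ennreal_le_epsilon)
  fix e :: real assume e: "0 < e"
  obtain g where g: "\<And>i. i \<in> {1..n} \<Longrightarrow> integrable N (g i)" "\<And>i z. i \<in> {1..n} \<Longrightarrow> z \<in> space N \<Longrightarrow> 0 \<le> g i z"
    and le: "\<And>i x C. i \<in> {1..n} \<Longrightarrow> feasible x C \<Longrightarrow> (\<integral>\<^sup>+z. ennreal (util i (x i) C z - g i z) \<partial>N) \<le> ennreal e"
    by (rule uniform_integrability_family[OF e]) (rule that)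
  have xk: "consumption (X k i)" "consumption (D k)" if "i \<in> {1..n}" for k i
    using f[of k] that increasing_consumption by (auto simp: feasible_def)
  define I where "I k i = (\<integral>\<^sup>+z. ennreal (min (util i (X k i) (D k) z) (g i z)) \<partial>N)" for k i
  define J where "J i = (\<integral>\<^sup>+z. ennreal (min (util i (x i) C z) (g i z)) \<partial>N)" for i
  have IJ: "(\<lambda>k. I k i) \<longlonglongrightarrow> J i" if i: "i \<in> {1..n}" for i
    unfolding I_def J_def
  proof (rule nn_integral_dominated_convergence[where w = "\<lambda>z. ennreal (g i z)"])
    have [measurable]: "g i \<in> borel_measurable N" using g(1)[OF i] by auto
    note [measurable] = util_measurable[OF i xk[OF i]] util_measurable[OF i x(1)[OF i] x(2)]
    show "(\<lambda>z. ennreal (min (util i (X k i) (D k) z) (g i z))) \<in> borel_measurable N" for k by measurable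
    show "(\<lambda>z. ennreal (min (util i (x i) C z) (g i z))) \<in> borel_measurable N" by measurable
    show "(\<lambda>z. ennreal (g i z)) \<in> borel_measurable N" by measurable
    show "(\<integral>\<^sup>+z. ennreal (g i z) \<partial>N) < \<infinity>"
      using g(1)[OF i] g(2)[OF i] by (subst nn_integral_eq_integral) (auto intro!: AE_I2)
    show "AE z in N. ennreal (min (util i (X k i) (D k) z) (g i z)) \<le> ennreal (g i z)" for k
      by (intro AE_I2 ennreal_leI) simp
    show "AE z in N. (\<lambda>k. ennreal (min (util i (X k i) (D k) z) (g i z))) \<longlonglongrightarrow> ennreal (min (util i (x i) C z) (g i z))"
      using lim[OF i] by eventually_elim (intro tendsto_ennrealI tendsto_min tendsto_const)
  qed
  have "welfare (X k) (D k) \<le> (\<Sum>i=1..n. ennreal (\<gamma> i) * (I k i + ennreal e))" for k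
    unfolding welfare_def
  proof (intro sum_mono mult_left_mono)
    fix i assume i: "i \<in> {1..n}"
    note [measurable] = util_measurable[OF i xk[OF i]]
    have [measurable]: "g i \<in> borel_measurable N" using g(1)[OF i] by auto
    have "(\<integral>\<^sup>+z. ennreal (util i (X k i) (D k) z) \<partial>N) \<le>
      (\<integral>\<^sup>+z. ennreal (min (util i (X k i) (D k) z) (g i z)) + ennreal (util i (X k i) (D k) z - g i z) \<partial>N)"
      using util_nonneg[OF i xk[OF i]] g(2)[OF i] by (intro nn_integral_mono split_min)
    also have "\<dots> = I k i + (\<integral>\<^sup>+z. ennreal (util i (X k i) (D k) z - g i z) \<partial>N)"
      unfolding I_def by (rule nn_integral_add) measurable
    also have "\<dots> \<le> I k i + ennreal e" by (intro add_left_mono le[OF i f])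
    finally show "(\<integral>\<^sup>+z. ennreal (util i (X k i) (D k) z) \<partial>N) \<le> I k i + ennreal e" .
  qed simp
  moreover have "(\<lambda>k. \<Sum>i=1..n. ennreal (\<gamma> i) * (I k i + ennreal e)) \<longlonglongrightarrow> (\<Sum>i=1..n. ennreal (\<gamma> i) * (J i + ennreal e))"
    by (intro tendsto_sum ennreal_tendsto_cmult tendsto_add IJ tendsto_const) auto
  ultimately have "V \<le> (\<Sum>i=1..n. ennreal (\<gamma> i) * (J i + ennreal e))"
    by (intro LIMSEQ_le[OF V]) auto
  also have "\<dots> = (\<Sum>i=1..n. ennreal (\<gamma> i) * J i) + ennreal e"
    unfolding distrib_left sum.distrib sum_\<gamma>_const ..
  also have "(\<Sum>i=1..n. ennreal (\<gamma> i) * J i) \<le> welfare x C"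
    unfolding welfare_def J_def by (intro sum_mono mult_left_mono nn_integral_mono ennreal_leI) auto
  finally show "V \<le> welfare x C + ennreal e" by (simp add: add_right_mono)
qed

section \<open>Welfare of midpoints\<close>

definition midp :: "'a process \<Rightarrow> 'a process \<Rightarrow> 'a process" where
  "midp x y = (\<lambda>t \<omega>. (1/2) * x t \<omega> + (1/2) * y t \<omega>)"

lemma feasible_midp:
  assumes "feasible x C" "feasible y D"
  shows "feasible (\<lambda>i. midp (x i) (y i)) (midp C D)"
proof -
  have x: "consumption (x i)" "consumption (y i)" if "i \<in> {1..n}" for i using assms that by (auto simp: feasible_def)
  have C: "increasing_process M F T C" "increasing_process M F T D" using assms by (auto simp: feasible_def)
  have "(\<Sum>i=1..n. xcost (midp (x i) (y i))) + ccost (midp C D) =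
    ennreal (1/2) * ((\<Sum>i=1..n. xcost (x i)) + ccost C) + ennreal (1/2) * ((\<Sum>i=1..n. xcost (y i)) + ccost D)"
  proof -
    have "(\<Sum>i=1..n. xcost (midp (x i) (y i))) = (\<Sum>i=1..n. ennreal (1/2) * xcost (x i) + ennreal (1/2) * xcost (y i))"
      unfolding midp_def by (intro sum.cong refl xcost_lincomb x) auto
    moreover have "ccost (midp C D) = ennreal (1/2) * ccost C + ennreal (1/2) * ccost D"
      unfolding midp_def by (rule ccost_lincomb[OF C]) auto
    ultimately show ?thesis by (simp only: sum.distrib sum_distrib_left[symmetric] distrib_left ac_simps)
  qed
  also have "\<dots> \<le> ennreal (1/2) * ennreal wealth + ennreal (1/2) * ennreal wealth"
    using assms by (intro add_mono mult_left_mono) (auto simp: feasible_def)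
  also have "\<dots> = ennreal wealth"
    by (rule ennreal_half_add)
  finally have "(\<Sum>i=1..n. xcost (midp (x i) (y i))) + ccost (midp C D) \<le> ennreal wealth" .
  moreover have "consumption (midp (x i) (y i))" if "i \<in> {1..n}" for i
    unfolding midp_def by (rule xcost_lincomb(2)[OF x[OF that]]) auto
  moreover have "increasing_process M F T (midp C D)"
    unfolding midp_def by (rule increasing_lincomb[OF C]) auto
  ultimately show ?thesis unfolding feasible_def by auto
qed

definition gap :: "nat \<Rightarrow> 'a process \<Rightarrow> 'a process \<Rightarrow> 'a process \<Rightarrow> 'a process \<Rightarrow> 'a \<times> real \<Rightarrow> real" where
  "gap i x C y D z = util i (midp x y) (midp C D) z - (util i x C z + util i y D z) / 2"

lemma gap_eq:
  fixes x C y D z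
  defines "p \<equiv> (x (snd z) (fst z), C (snd z) (fst z))" and "q \<equiv> (y (snd z) (fst z), D (snd z) (fst z))"
  shows "gap i x C y D z = discount r (snd z) (fst z) * (u i ((1/2) *\<^sub>R (p + q)) - (u i p + u i q) / 2)"
  by (simp add: gap_def util_def midp_def p_def q_def field_simps)

lemma gap_nonneg:
  assumes i: "i \<in> {1..n}" and c: "consumption x" "consumption C" "consumption y" "consumption D" and z: "z \<in> space N"
  shows "0 \<le> gap i x C y D z"
  unfolding gap_eq
  using concave_midpoint(1)[OF u_regular[OF i] quadrant_process[OF c(1,2) z] quadrant_process[OF c(3,4) z]] discount_bounds(1)
  by (intro mult_nonneg_nonneg) (auto simp: less_imp_le)

lemma consumption_midp: "consumption x \<Longrightarrow> consumption y \<Longrightarrow> consumption (midp x y)"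
  unfolding midp_def by (rule xcost_lincomb(2)) auto

lemma gap_measurable:
  assumes i: "i \<in> {1..n}" and c: "consumption x" "consumption C" "consumption y" "consumption D"
  shows "gap i x C y D \<in> borel_measurable N"
proof -
  note [measurable] = util_measurable[OF i c(1,2)] util_measurable[OF i c(3,4)]
    util_measurable[OF i consumption_midp[OF c(1,3)] consumption_midp[OF c(2,4)]]
  show ?thesis unfolding gap_def[abs_def] by measurable
qed

text \<open>The midpoint is feasible, and its welfare is the average of the two welfares plus the
  weighted integrals of the gaps. The average is already within \<open>e\<close> of the
  maximum.\<close>

lemma gap_bound:
  assumes f: "feasible x C" "feasible y D" and e: "0 \<le> e"
    and near: "max_welfare \<le> welfare x C + ennreal e" "max_welfare \<le> welfare y D + ennreal e"
  shows "(\<Sum>i=1..n. ennreal (\<gamma> i) * (\<integral>\<^sup>+z. ennreal (gap i (x i) C (y i) D z) \<partial>N)) \<le> ennreal e"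
proof -
  define h where "h = ennreal (1/2)"
  define G where "G = (\<Sum>i=1..n. ennreal (\<gamma> i) * (\<integral>\<^sup>+z. ennreal (gap i (x i) C (y i) D z) \<partial>N))"
  have "(\<integral>\<^sup>+z. ennreal (util i (midp (x i) (y i)) (midp C D) z) \<partial>N) =
    (\<integral>\<^sup>+z. ennreal (gap i (x i) C (y i) D z) \<partial>N) + (h * (\<integral>\<^sup>+z. ennreal (util i (x i) C z) \<partial>N) + h * (\<integral>\<^sup>+z. ennreal (util i (y i) D z) \<partial>N))"
    if i: "i \<in> {1..n}" for i
  proof -
    have c: "consumption (x i)" "consumption C" "consumption (y i)" "consumption D"
      using f i increasing_consumption by (auto simp: feasible_def)
    note [measurable] = util_measurable[OF i c(1,2)] util_measurable[OF i c(3,4)] gap_measurable[OF i c]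
    have "(\<integral>\<^sup>+z. ennreal (util i (midp (x i) (y i)) (midp C D) z) \<partial>N) =
      (\<integral>\<^sup>+z. ennreal (gap i (x i) C (y i) D z) + (h * ennreal (util i (x i) C z) + h * ennreal (util i (y i) D z)) \<partial>N)"
    proof (rule nn_integral_cong)
      fix z assume z: "z \<in> space N"
      have nn: "0 \<le> gap i (x i) C (y i) D z" "0 \<le> util i (x i) C z" "0 \<le> util i (y i) D z"
        using gap_nonneg[OF i c z] util_nonneg[OF i c(1,2) z] util_nonneg[OF i c(3,4) z] by auto
      have "util i (midp (x i) (y i)) (midp C D) z = gap i (x i) C (y i) D z + ((1/2) * util i (x i) C z + (1/2) * util i (y i) D z)"
        by (simp add: gap_def field_simps)
      then have "ennreal (util i (midp (x i) (y i)) (midp C D) z) =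
        ennreal (gap i (x i) C (y i) D z + ((1/2) * util i (x i) C z + (1/2) * util i (y i) D z))"
        by (rule arg_cong)
      also have "\<dots> = ennreal (gap i (x i) C (y i) D z) + (ennreal ((1/2) * util i (x i) C z) + ennreal ((1/2) * util i (y i) D z))"
        using nn by simp
        also have "ennreal ((1/2) * util i (x i) C z) = h * ennreal (util i (x i) C z)"
          unfolding h_def using nn by (intro ennreal_mult) auto
        also have "ennreal ((1/2) * util i (y i) D z) = h * ennreal (util i (y i) D z)"
          unfolding h_def using nn by (intro ennreal_mult) auto
      finally show "ennreal (util i (midp (x i) (y i)) (midp C D) z) = ennreal (gap i (x i) C (y i) D z) + (h * ennreal (util i (x i) C z) + h * ennreal (util i (y i) D z))" .
    qed
    also have "\<dots> = (\<integral>\<^sup>+z. ennreal (gap i (x i) C (y i) D z) \<partial>N) + (h * (\<integral>\<^sup>+z. ennreal (util i (x i) C z) \<partial>N) + h * (\<integral>\<^sup>+z. ennreal (util i (y i) D z) \<partial>N))"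
      by (simp add: nn_integral_add nn_integral_cmult)
    finally show ?thesis .
  qed
  then have "welfare (\<lambda>i. midp (x i) (y i)) (midp C D) = (\<Sum>i=1..n. ennreal (\<gamma> i) *
     ((\<integral>\<^sup>+z. ennreal (gap i (x i) C (y i) D z) \<partial>N) + (h * (\<integral>\<^sup>+z. ennreal (util i (x i) C z) \<partial>N) + h * (\<integral>\<^sup>+z. ennreal (util i (y i) D z) \<partial>N))))"
    unfolding welfare_def by (intro sum.cong) auto
  also have "\<dots> = G + (h * welfare x C + h * welfare y D)"
    unfolding G_def welfare_def by (simp only: distrib_left sum.distrib sum_distrib_left mult.left_commute)
  finally have "G + (h * welfare x C + h * welfare y D) \<le> max_welfare"
    using welfare_le[OF feasible_midp[OF f]] by (simp only:)
  also have "max_welfare = h * max_welfare + h * max_welfare"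
    unfolding h_def by (rule ennreal_half_add[symmetric])
  also have "\<dots> \<le> h * (welfare x C + ennreal e) + h * (welfare y D + ennreal e)"
    by (intro add_mono mult_left_mono near) auto
  also have "\<dots> = (h * ennreal e + h * ennreal e) + (h * welfare x C + h * welfare y D)"
    by (simp only: distrib_left ac_simps)
  also have "h * ennreal e + h * ennreal e = ennreal e"
    unfolding h_def by (rule ennreal_half_add)
  finally have "(h * welfare x C + h * welfare y D) + G \<le> (h * welfare x C + h * welfare y D) + ennreal e"
    by (simp only: add.commute)
  \<comment> \<open>Cancellation in the extended numbers requires a finite average.\<close>
  moreover have "h * welfare x C + h * welfare y D \<noteq> \<infinity>"
    using le_less_trans[OF welfare_le[OF f(1)] max_welfare_finite] le_less_trans[OF welfare_le[OF f(2)] max_welfare_finite]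
    by (auto simp: ennreal_mult_eq_top_iff h_def)
  ultimately show ?thesis
    using ennreal_add_left_cancel_le unfolding G_def[symmetric] by blast
qed

end

section \<open>Uniqueness\<close>

text \<open>An open interval has positive measure, so it is not contained in the exceptional null
  set.\<close>

lemma AE_lborel_Ioo:
  fixes a b :: real
  assumes "AE t in lborel. P t" "a < b"
  obtains t where "a < t" "t < b" "P t"
proof -
  have "\<exists>t. a < t \<and> t < b \<and> P t"
  proof (rule ccontr)
    assume "\<not> ?thesis"
    then have "AE t in lborel. t \<notin> {a<..<b}" using assms(1) by (auto elim!: eventually_mono)
    then have "{a<..<b} \<in> null_sets lborel" by (subst AE_iff_null_sets) auto
    then show False using assms(2) by (simp add: null_sets_def ennreal_eq_0_iff)
  qed
  then show thesis using that by blast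
qed

lemma right_continuous_onI:
  assumes "\<And>t X. t \<in> I \<Longrightarrow> (\<And>k. X k \<in> I) \<Longrightarrow> (\<And>k. t \<le> X k) \<Longrightarrow> X \<longlonglongrightarrow> t \<Longrightarrow> (\<lambda>k. f (X k)) \<longlonglongrightarrow> f t"
  shows "right_continuous_on I f"
  unfolding right_continuous_on_def continuous_within_sequentially using assms by (auto simp: o_def)

text \<open>For finite \<open>T\<close> the value at \<open>T\<close> is replaced by the left limit: a contribution
  made at \<open>T\<close> costs money but does not enter the payoff.\<close>

definition remove_jump :: "ereal \<Rightarrow> (real \<Rightarrow> real) \<Rightarrow> real \<Rightarrow> real" where
  "remove_jump T c t = (if ereal t = T then (SUP s\<in>{s\<in>\<rat>. 0 \<le> s \<and> ereal s < T}. c s) else c t)"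

text \<open>By monotonicity the supremum over rational times is the left limit; being countable, it
  also keeps the value at T measurable. The bound in the fifth claim is for that measurability, the
  sequence in the last one for the absence of an atom.\<close>

lemma remove_jump:
  assumes c: "good_path T c" and T: "0 < T"
  shows "good_path T (remove_jump T c)" "good_path T (\<lambda>t. c t - remove_jump T c t)"
    and "\<And>t. ereal t \<noteq> T \<Longrightarrow> remove_jump T c t = c t"
    and "\<And>t. ereal t = T \<Longrightarrow> emeasure (stieltjes T (remove_jump T c)) {t} = 0"
    and "\<And>t. ereal t = T \<Longrightarrow> bdd_above (c ` {s\<in>\<rat>. 0 \<le> s \<and> ereal s < T})"
    and "\<And>t. ereal t = T \<Longrightarrow> \<exists>X. (\<forall>k. 0 \<le> X k \<and> X k < t) \<and> (\<lambda>k. c (X k)) \<longlonglongrightarrow> remove_jump T c t"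
proof -
  let ?d = "remove_jump T c"
  define Q where "Q = {s\<in>\<rat>. 0 \<le> s \<and> ereal s < T}"
  have mono: "c s \<le> c t" if "0 \<le> s" "s \<le> t" "t \<in> horizon T" for s t
    using c that horizon_le[OF that(3), of s] by (auto simp: good_path_def mono_on_def)
  have Q0: "0 \<in> Q" using T by (auto simp: Q_def zero_ereal_def[symmetric])
  show eq: "?d t = c t" if "ereal t \<noteq> T" for t using that by (simp add: remove_jump_def)
  have bdd: "bdd_above (c ` Q)" and d_le: "?d t \<le> c t" and le_d: "\<And>s. 0 \<le> s \<Longrightarrow> s < t \<Longrightarrow> c s \<le> ?d t"
    and tH: "t \<in> horizon T" if t: "ereal t = T" for t
  proof -
    show tH: "t \<in> horizon T" using t T by (auto simp: horizon_def zero_ereal_def)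
    have le: "c s \<le> c t" if "s \<in> Q" for s using that t tH by (intro mono) (auto simp: Q_def)
    then show bdd: "bdd_above (c ` Q)" by (intro bdd_aboveI[of _ "c t"]) auto
    have d_eq: "?d t = (SUP s\<in>Q. c s)" using t by (simp add: remove_jump_def Q_def)
    show "?d t \<le> c t" unfolding d_eq using Q0 by (intro cSUP_least le) auto
    fix s assume s: "0 \<le> s" "s < t"
    obtain q where q: "q \<in> \<rat>" "s < q" "q < t" using Rats_dense_in_real[OF s(2)] by auto
    have qQ: "q \<in> Q" using q s t by (auto simp: Q_def)
    have "c s \<le> c q" using q s tH by (intro mono horizon_le[OF tH]) auto
    also have "\<dots> \<le> ?d t" unfolding d_eq by (rule cSUP_upper[OF qQ bdd])
    finally show "c s \<le> ?d t" .
  qed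
  have lt: "t < t'" if "ereal t' = T" "t \<in> horizon T" "ereal t \<noteq> T" for t t'
    using that by (auto simp: horizon_def)
  \<comment> \<open>Right-continuity ignores the value at a finite T: before T, times close enough
    on the right stay below T, and at T itself no later times are left.\<close>
  have rc_of: "right_continuous_on (horizon T) g"
    if g: "\<And>t. t \<in> horizon T \<Longrightarrow> ereal t \<noteq> T \<Longrightarrow> g t = h t" and h: "right_continuous_on (horizon T) h" for g h :: "real \<Rightarrow> real"
  proof (rule right_continuous_onI)
    fix t X assume t: "t \<in> horizon T" and X: "\<And>k. X k \<in> horizon T" "\<And>k. t \<le> X k" "X \<longlonglongrightarrow> t"
    show "(\<lambda>k. g (X k)) \<longlonglongrightarrow> g t"
    proof (cases "ereal t = T")
      case True
      have "X k = t" for k using X(1)[of k] X(2)[of k] True by (auto simp: horizon_def)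
      then show ?thesis by simp
    next
      case False
      have "eventually (\<lambda>k. ereal (X k) \<noteq> T) sequentially"
      proof (cases T)
        case (real T')
        then have "t < T'" using lt[of T' t] t False by simp
        from order_tendstoD(2)[OF X(3) this] show ?thesis by eventually_elim (simp add: real)
      qed auto
      then have "eventually (\<lambda>k. h (X k) = g (X k)) sequentially"
        by eventually_elim (simp add: g X(1))
      moreover have "(\<lambda>k. h (X k)) \<longlonglongrightarrow> h t" by (rule right_continuous_on_LIMSEQ[OF h t X])
      ultimately have "(\<lambda>k. g (X k)) \<longlonglongrightarrow> h t" by (rule Lim_transform_eventually[rotated])
      then show ?thesis using g[OF t False] by simp
    qed
  qed
  have nn: "0 \<le> c t" if "t \<in> horizon T" for t using c that by (auto simp: good_path_def)
  have rc: "right_continuous_on (horizon T) ?d"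
  proof (rule rc_of[where h = c])
    show "right_continuous_on (horizon T) c" using c by (simp add: good_path_def)
  qed (rule eq)
  have t0: "0 < t" if "ereal t = T" for t using that[symmetric] T by (simp add: zero_ereal_def)
  show "good_path T ?d"
    unfolding good_path_def
  proof (intro conjI rc mono_onI ballI)
    fix r s assume rs: "r \<in> horizon T" "s \<in> horizon T" "r \<le> s"
    then have "0 \<le> r" by (auto simp: horizon_def)
    show "?d r \<le> ?d s"
    proof (cases "ereal s = T")
      case True
      then show ?thesis using le_d[OF True \<open>0 \<le> r\<close>] eq[of r] rs by (cases "r = s") auto
    next
      case False
      then have "ereal r \<noteq> T" using rs by (auto simp: horizon_def)
      then show ?thesis using False eq mono[OF \<open>0 \<le> r\<close> rs(3,2)] by simp
    qed
  next
    fix t assume t: "t \<in> horizon T"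
    show "0 \<le> ?d t"
    proof (cases "ereal t = T")
      case True
      have "0 \<le> c 0" using nn zero_in_horizon[OF T] by auto
      also have "\<dots> \<le> ?d t" using le_d[OF True, of 0] t0[OF True] by auto
      finally show ?thesis .
    qed (use t nn eq in auto)
  qed
  show "good_path T (\<lambda>t. c t - ?d t)"
    unfolding good_path_def
  proof (intro conjI mono_onI ballI)
    show "right_continuous_on (horizon T) (\<lambda>t. c t - ?d t)"
    proof (rule rc_of[where h = "\<lambda>t. 0"])
      show "c t - ?d t = 0" if "ereal t \<noteq> T" for t using eq[OF that] by simp
    qed (simp add: right_continuous_on_def)
    fix r s assume rs: "r \<in> horizon T" "s \<in> horizon T" "r \<le> s"
    show "c r - ?d r \<le> c s - ?d s"
      using eq[of r] eq[of s] d_le[of s] lt[of r s] rs by (cases "ereal r = T"; cases "ereal s = T") (auto simp: horizon_def)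
  next
    fix t assume "t \<in> horizon T"
    show "0 \<le> c t - ?d t" using eq[of t] d_le[of t] by (cases "ereal t = T") auto
  qed
  show bdd': "bdd_above (c ` {s\<in>\<rat>. 0 \<le> s \<and> ereal s < T})" if "ereal t = T" for t
    using bdd[OF that] by (simp add: Q_def)
  show ex: "\<exists>X. (\<forall>k. 0 \<le> X k \<and> X k < t) \<and> (\<lambda>k. c (X k)) \<longlonglongrightarrow> ?d t" if t: "ereal t = T" for t
  proof -
    have "\<exists>s\<in>Q. ?d t - 1 / real (Suc k) < c s" for k
    proof -
      have "?d t - 1 / real (Suc k) < (SUP s\<in>Q. c s)" using t by (simp add: remove_jump_def Q_def)
      then show ?thesis using Q0 bdd[OF t] by (subst (asm) less_cSUP_iff) auto
    qed
    then obtain X where X: "\<And>k. X k \<in> Q" "\<And>k. ?d t - 1 / real (Suc k) < c (X k)" by metis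
    have XQ: "0 \<le> X k \<and> X k < t" for k using X(1)[of k] t by (auto simp: Q_def)
    have "(\<lambda>k. ?d t - 1 / real (Suc k)) \<longlonglongrightarrow> ?d t - 0"
      by (intro tendsto_intros LIMSEQ_Suc[OF lim_const_over_n])
    then have lower: "(\<lambda>k. ?d t - 1 / real (Suc k)) \<longlonglongrightarrow> ?d t" by simp
    have "(\<lambda>k. c (X k)) \<longlonglongrightarrow> ?d t"
    proof (rule tendsto_sandwich[OF _ _ lower tendsto_const])
      show "\<forall>\<^sub>F k in sequentially. ?d t - 1 / real (Suc k) \<le> c (X k)"
        by (intro always_eventually allI less_imp_le X(2))
      show "\<forall>\<^sub>F k in sequentially. c (X k) \<le> ?d t"
        using XQ by (intro always_eventually allI le_d[OF t]) auto
    qed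
    then show ?thesis using XQ by auto
  qed
  show "emeasure (stieltjes T ?d) {t} = 0" if t: "ereal t = T" for t
  proof -
    obtain X where X: "\<And>k. 0 \<le> X k \<and> X k < t" "(\<lambda>k. c (X k)) \<longlonglongrightarrow> ?d t" using ex[OF t] by blast
    have "?d (X k) = c (X k)" for k using X(1)[of k] t by (intro eq) auto
    then have "(\<lambda>k. ?d (X k)) \<longlonglongrightarrow> ?d t" using X(2) by simp
    \<comment> \<open>The lemma on atoms belongs to a locale with an integrand; the zero function
      serves as one.\<close>
    moreover have "nonneg_integrand T (\<lambda>t. 0)" using T by unfold_locales (auto simp: right_continuous_on_def)
    moreover have "X k \<in> {0..t}" for k using X(1)[of k] by auto
    ultimately show ?thesis
      using X(1) nonneg_integrand.emeasure_atom_zero[OF _ \<open>good_path T ?d\<close> tH[OF t], of "\<lambda>t. 0" X] by blast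
  qed
qed

text \<open>Intervals that stay below a finite T miss only the point T, which carries no mass. The
  end points in \<open>ccost_limit_le\<close> are of this kind, as they have to be chosen among
  generic times.\<close>

lemma (in nonneg_integrand) integral_LIMSEQ_no_atom:
  assumes c: "good_path T c" and S: "incseq S" "\<And>k. S k \<in> horizon T" "\<And>k. 0 < S k"
    and ex: "\<And>t. 0 \<le> t \<Longrightarrow> ereal t < T \<Longrightarrow> \<forall>\<^sub>F k in sequentially. t \<le> S k"
    and lt: "\<And>k. ereal (S k) < T"
    and na: "\<And>t. ereal t = T \<Longrightarrow> emeasure (stieltjes T c) {t} = 0"
  shows "(\<lambda>k. stieltjes_upto T (S k) f c) \<longlonglongrightarrow> stieltjes_integral T f c"
proof -
  let ?H = "{t. 0 \<le> t \<and> ereal t < T}"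
  have "(\<lambda>k. stieltjes_upto T (S k) f c) \<longlonglongrightarrow> (\<integral>\<^sup>+t\<in>?H. ennreal (f t) \<partial>(stieltjes T c))"
    unfolding stieltjes_upto_def
  proof (rule nn_integral_LIMSEQ)
    show "(\<lambda>t. ennreal (f t) * indicator {0..S k} t) \<in> borel_measurable (stieltjes T c)" for k
      using borel_indicator[OF S(2,3)] by measurable
    show "incseq (\<lambda>k t. ennreal (f t) * indicator {0..S k} t)"
      using S(1) by (auto simp: incseq_def le_fun_def indicator_def intro: order_trans)
    show "(\<lambda>k. ennreal (f t) * indicator {0..S k} t) \<longlonglongrightarrow> ennreal (f t) * indicator ?H t" for t
    proof (cases "t \<in> ?H")
      case True
      then have "\<forall>\<^sub>F k in sequentially. ennreal (f t) * indicator {0..S k} t = ennreal (f t) * indicator ?H t"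
        using ex[of t] by (auto elim!: eventually_mono)
      then show ?thesis by (rule tendsto_eventually)
    next
      case False
      have "t \<notin> {0..S k}" for k
      proof
        assume "t \<in> {0..S k}"
        then have "ereal t \<le> ereal (S k)" "0 \<le> t" by auto
        then show False using le_less_trans[OF _ lt[of k], of "ereal t"] False by auto
      qed
      then show ?thesis using False by simp
    qed
  qed
  also have "(\<integral>\<^sup>+t\<in>?H. ennreal (f t) \<partial>(stieltjes T c)) = stieltjes_integral T f c"
    unfolding stieltjes_integral_def
  proof (rule nn_integral_cong_AE)
    have "AE t in stieltjes T c. ereal t \<noteq> T"
    proof (cases T)
      case (real T')
      then have "{T'} \<in> null_sets (stieltjes T c)" using na[of T'] by (auto intro!: null_setsI)
      then show ?thesis using real by (intro AE_I'[of "{T'}"]) auto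
    qed auto
    then show "AE t in stieltjes T c. ennreal (f t) * indicator ?H t = ennreal (f t) * indicator (horizon T) t"
      by eventually_elim (auto simp: indicator_def horizon_def)
  qed
  finally show ?thesis .
qed

section \<open>Closeness of near-maximizers and agreement of maximizers\<close>

context planner
begin

text \<open>The product measure is not zero, so a contradiction almost everywhere is a
  contradiction.\<close>

lemma AE_N_nonempty: "\<not> (AE z in N. False)"
proof
  assume "AE z in N. False"
  from AE_prod_time_D[OF this] have "AE \<omega> in M. AE t in lborel. t \<notin> horizon T" by simp
  then obtain \<omega> where "AE t in lborel. t \<notin> horizon T"
    using AE_contr by (metis (mono_tags, lifting) eventually_mono)
  moreover obtain b where b: "0 < b" "ereal b < T" using ereal_dense2[OF T] by auto
  ultimately obtain t where "0 < t" "t < b" "t \<notin> horizon T" using AE_lborel_Ioo by blast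
  then show False using le_less_trans[OF _ b(2), of "ereal t"] by (auto simp: horizon_def)
qed

definition pt :: "'a process \<Rightarrow> 'a process \<Rightarrow> 'a \<times> real \<Rightarrow> real \<times> real" where
  "pt x C z = (x (snd z) (fst z), C (snd z) (fst z))"

lemma pt_measurable: "consumption x \<Longrightarrow> consumption C \<Longrightarrow> pt x C \<in> borel_measurable N"
  unfolding pt_def[abs_def] using consumption_measurable[of x] consumption_measurable[of C]
  by (auto simp: borel_prod[symmetric])

lemma norm_bounded_in_measure:
  assumes e: "0 < (e::real)"
  obtains R where "\<And>x C i. feasible x C \<Longrightarrow> i \<in> {1..n} \<Longrightarrow>
    emeasure \<mu> {z\<in>space N. R < norm (pt (x i) C z)} \<le> ennreal e"
proof -
  have e2: "0 < e/2" using e by simp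
  have m: "(\<lambda>z. \<psi>x (snd z) (fst z)) \<in> borel_measurable \<mu>" "(\<lambda>z. \<psi>c (snd z) (fst z)) \<in> borel_measurable \<mu>"
    using xcost_eq(3)[OF increasing_consumption[OF increasing_zero]] \<psi>c_measurable by simp_all
  have px: "\<And>z. z \<in> space \<mu> \<Longrightarrow> 0 < \<psi>x (snd z) (fst z)" and pc: "\<And>z. z \<in> space \<mu> \<Longrightarrow> 0 < \<psi>c (snd z) (fst z)"
    using px.psi_pos pc.psi_pos by (auto simp: space_prod_time)
  obtain R1 where R1: "0 < R1" "\<And>f. f \<in> borel_measurable \<mu> \<Longrightarrow>
    (\<integral>\<^sup>+z. ennreal (\<psi>x (snd z) (fst z)) * ennreal (f z) \<partial>\<mu>) \<le> ennreal wealth \<Longrightarrow> emeasure \<mu> {z\<in>space \<mu>. R1 < f z} \<le> ennreal (e/2)"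
    by (rule bounded_in_measure[OF finite_\<mu> m(1) px wealth_pos e2]) (assumption, rule that)
  obtain R2 where R2: "0 < R2" "\<And>f. f \<in> borel_measurable \<mu> \<Longrightarrow>
    (\<integral>\<^sup>+z. ennreal (\<psi>c (snd z) (fst z)) * ennreal (f z) \<partial>\<mu>) \<le> ennreal wealth \<Longrightarrow> emeasure \<mu> {z\<in>space \<mu>. R2 < f z} \<le> ennreal (e/2)"
    by (rule bounded_in_measure[OF finite_\<mu> m(2) pc wealth_pos e2]) (assumption, rule that)
  show thesis
  proof (rule that[of "R1 + R2"])
    fix x C i assume f: "feasible x C" and i: "i \<in> {1..n}"
    have c: "consumption (x i)" "consumption C" using f i increasing_consumption by (auto simp: feasible_def)
    note [measurable] = consumption_measurable[OF c(1)] consumption_measurable[OF c(2)]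
    let ?A = "{z\<in>space \<mu>. R1 < x i (snd z) (fst z)}" and ?B = "{z\<in>space \<mu>. R2 < C (snd z) (fst z)}"
    have "emeasure \<mu> {z\<in>space N. R1 + R2 < norm (pt (x i) C z)} \<le> emeasure \<mu> (?A \<union> ?B)"
    proof (rule emeasure_mono)
      show "{z\<in>space N. R1 + R2 < norm (pt (x i) C z)} \<subseteq> ?A \<union> ?B"
      proof
        fix z assume "z \<in> {z\<in>space N. R1 + R2 < norm (pt (x i) C z)}"
        then have z: "z \<in> space N" "R1 + R2 < norm (pt (x i) C z)" by auto
        have "norm (pt (x i) C z) \<le> \<bar>x i (snd z) (fst z)\<bar> + \<bar>C (snd z) (fst z)\<bar>"
          unfolding pt_def using norm_Pair_le[of "x i (snd z) (fst z)" "C (snd z) (fst z)"] by simp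
        then show "z \<in> ?A \<union> ?B" using z c by (auto simp: consumption_def space_prod_time)
      qed
    qed measurable
    also have "\<dots> \<le> emeasure \<mu> ?A + emeasure \<mu> ?B" by (rule emeasure_subadditive) measurable
    also have "\<dots> \<le> ennreal (e/2) + ennreal (e/2)"
      using weighted_consumption[OF f i] weighted_level[OF f] by (intro add_mono R1(2) R2(2)) auto
    also have "\<dots> = ennreal (e/2 + e/2)" using e by (intro ennreal_plus[symmetric]) auto
    finally show "emeasure \<mu> {z\<in>space N. R1 + R2 < norm (pt (x i) C z)} \<le> ennreal e" by simp
  qed
qed

text \<open>Up to measure e/4 for each plan, the points lie in a ball of radius \<open>R\<close>.
  There, points at distance \<open>e\<close> have concavity gap at least \<delta>, and
  near-optimality makes the integral of the gap small.\<close>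

lemma close_in_measure_single:
  assumes e: "0 < (e::real)" and i: "i \<in> {1..n}"
  obtains d where "0 < d" "\<And>x C y D. feasible x C \<Longrightarrow> feasible y D \<Longrightarrow>
    max_welfare \<le> welfare x C + ennreal d \<Longrightarrow> max_welfare \<le> welfare y D + ennreal d \<Longrightarrow>
    emeasure \<mu> {z\<in>space N. e \<le> dist (pt (x i) C z) (pt (y i) D z)} \<le> ennreal e"
proof -
  have e4: "0 < e/4" using e by simp
  obtain R where R: "\<And>x C i. feasible x C \<Longrightarrow> i \<in> {1..n} \<Longrightarrow>
    emeasure \<mu> {z\<in>space N. R < norm (pt (x i) C z)} \<le> ennreal (e/4)"
    by (rule norm_bounded_in_measure[OF e4]) (rule that)
  obtain \<delta> where \<delta>: "0 < \<delta>" "\<And>p q. p \<in> quadrant \<Longrightarrow> q \<in> quadrant \<Longrightarrow> norm p \<le> R \<Longrightarrow> norm q \<le> R \<Longrightarrow> e \<le> dist p q \<Longrightarrow>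
    \<delta> \<le> u i ((1/2) *\<^sub>R (p + q)) - (u i p + u i q) / 2"
    by (rule concavity_gap[OF u_regular[OF i] e]) (rule that)
  have \<gamma>i: "0 < \<gamma> i" using \<gamma>_pos i by simp
  \<comment> \<open>By \<open>gap_bound\<close> the gap of agent \<open>i\<close> integrates to at
    most \<open>d / \<gamma> i\<close>, so the set with gap at least \<delta> has
    \<open>\<mu>\<close>-measure at most \<open>d / (\<delta> * \<gamma> i)\<close>, which is
    e/2.\<close>
  define d where "d = \<gamma> i * \<delta> * (e/2)"
  have d: "0 < d" using \<gamma>i \<delta> e by (simp add: d_def)
  show thesis
  proof (rule that[OF d])
    fix x C y D
    assume f: "feasible x C" "feasible y D" and near: "max_welfare \<le> welfare x C + ennreal d" "max_welfare \<le> welfare y D + ennreal d"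
    have c: "consumption (x i)" "consumption C" "consumption (y i)" "consumption D"
      using f i increasing_consumption by (auto simp: feasible_def)
    note [measurable] = pt_measurable[OF c(1,2)] pt_measurable[OF c(3,4)] gap_measurable[OF i c]
    let ?p = "pt (x i) C" and ?q = "pt (y i) D"
    let ?A = "{z\<in>space N. R < norm (?p z)}" and ?B = "{z\<in>space N. R < norm (?q z)}"
    let ?G = "{z\<in>space N. norm (?p z) \<le> R \<and> norm (?q z) \<le> R \<and> e \<le> dist (?p z) (?q z)}"
    have G: "emeasure \<mu> ?G \<le> ennreal (e/2)"
    proof -
      let ?I = "\<integral>\<^sup>+z. ennreal (gap i (x i) C (y i) D z) \<partial>N"
      have "emeasure \<mu> ?G = (\<integral>\<^sup>+z. ennreal (weight z) * indicator ?G z \<partial>N)"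
        unfolding \<mu>_def by (subst emeasure_density) auto
      also have "\<dots> \<le> (\<integral>\<^sup>+z. ennreal (1/\<delta>) * ennreal (gap i (x i) C (y i) D z) \<partial>N)"
      proof (rule nn_integral_mono)
        fix z assume z: "z \<in> space N"
        show "ennreal (weight z) * indicator ?G z \<le> ennreal (1/\<delta>) * ennreal (gap i (x i) C (y i) D z)"
        proof (cases "z \<in> ?G")
          case True
          have "?p z \<in> quadrant" "?q z \<in> quadrant"
            unfolding pt_def using quadrant_process[OF c(1,2) z] quadrant_process[OF c(3,4) z] by auto
          then have "\<delta> \<le> u i ((1/2) *\<^sub>R (?p z + ?q z)) - (u i (?p z) + u i (?q z)) / 2"
            using True by (intro \<delta>(2)) auto
          then have "weight z * \<delta> \<le> discount r (snd z) (fst z) * (u i ((1/2) *\<^sub>R (?p z + ?q z)) - (u i (?p z) + u i (?q z)) / 2)"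
            using weight_bounds(1,2)[OF z] \<delta>(1) by (intro mult_mono) auto
          then have "weight z * \<delta> \<le> gap i (x i) C (y i) D z" by (simp add: gap_eq pt_def)
          then have "weight z \<le> (1/\<delta>) * gap i (x i) C (y i) D z" using \<delta>(1) by (simp add: field_simps)
          then have "ennreal (weight z) \<le> ennreal ((1/\<delta>) * gap i (x i) C (y i) D z)" by (rule ennreal_leI)
          also have "\<dots> = ennreal (1/\<delta>) * ennreal (gap i (x i) C (y i) D z)"
            using \<delta>(1) gap_nonneg[OF i c z] by (intro ennreal_mult) auto
          finally show ?thesis using True by simp
        qed simp
      qed
      also have "\<dots> = ennreal (1/\<delta>) * ?I" by (rule nn_integral_cmult) measurable
      also have "\<dots> = ennreal (1/(\<delta> * \<gamma> i)) * (ennreal (\<gamma> i) * ?I)"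
        using \<delta>(1) \<gamma>i by (simp add: mult.assoc[symmetric] ennreal_mult[symmetric])
      also have "ennreal (\<gamma> i) * ?I \<le> (\<Sum>i=1..n. ennreal (\<gamma> i) * (\<integral>\<^sup>+z. ennreal (gap i (x i) C (y i) D z) \<partial>N))"
        using i by (intro member_le_sum) auto
      also have "\<dots> \<le> ennreal d" using d by (intro gap_bound f near) auto
      also have "ennreal (1/(\<delta> * \<gamma> i)) * ennreal d = ennreal (e/2)"
        using \<delta>(1) \<gamma>i d by (simp add: ennreal_mult[symmetric] d_def)
      finally show ?thesis by (simp add: mult_left_mono)
    qed
    have "emeasure \<mu> {z\<in>space N. e \<le> dist (?p z) (?q z)} \<le> emeasure \<mu> ((?A \<union> ?B) \<union> ?G)"
      by (rule emeasure_mono) (auto, measurable)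
    also have "\<dots> \<le> emeasure \<mu> (?A \<union> ?B) + emeasure \<mu> ?G" by (rule emeasure_subadditive) measurable
    also have "\<dots> \<le> (emeasure \<mu> ?A + emeasure \<mu> ?B) + emeasure \<mu> ?G"
      by (intro add_right_mono emeasure_subadditive) measurable
    also have "\<dots> \<le> (ennreal (e/4) + ennreal (e/4)) + ennreal (e/2)"
      by (intro add_mono R f i G)
    also have "\<dots> = ennreal (e/4 + e/4 + e/2)" using e by (subst ennreal_plus, simp, simp, subst ennreal_plus) auto
    finally show "emeasure \<mu> {z\<in>space N. e \<le> dist (?p z) (?q z)} \<le> ennreal e" by simp
  qed
qed

text \<open>\<open>gap_bound\<close> with tolerance 0 makes the gap vanish almost everywhere, and
  strict concavity then forces the points to coincide.\<close>

lemma maximizers_agree: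
  assumes f: "feasible x C" "feasible y D" and max: "max_welfare \<le> welfare x C" "max_welfare \<le> welfare y D"
    and i: "i \<in> {1..n}"
  shows "AE z in N. pt (x i) C z = pt (y i) D z"
proof -
  have c: "consumption (x i)" "consumption C" "consumption (y i)" "consumption D"
    using f i increasing_consumption by (auto simp: feasible_def)
  have "(\<Sum>i=1..n. ennreal (\<gamma> i) * (\<integral>\<^sup>+z. ennreal (gap i (x i) C (y i) D z) \<partial>N)) \<le> ennreal 0"
    by (rule gap_bound[OF f]) (use max in auto)
  then have "ennreal (\<gamma> i) * (\<integral>\<^sup>+z. ennreal (gap i (x i) C (y i) D z) \<partial>N) = 0"
    using i by (simp add: sum_eq_0_iff)
  then have "(\<integral>\<^sup>+z. ennreal (gap i (x i) C (y i) D z) \<partial>N) = 0"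
    using \<gamma>_pos[OF i] by simp
  then have "AE z in N. ennreal (gap i (x i) C (y i) D z) = 0"
    using gap_measurable[OF i c] by (subst (asm) nn_integral_0_iff_AE) auto
  then show ?thesis
    using AE_space
  proof eventually_elim
    case (elim z)
    show ?case
    proof (rule ccontr)
      assume ne: "pt (x i) C z \<noteq> pt (y i) D z"
      have "0 < gap i (x i) C (y i) D z"
        unfolding gap_eq
        using concave_midpoint(2)[OF u_regular[OF i] quadrant_process[OF c(1,2) elim(2)] quadrant_process[OF c(3,4) elim(2)]] ne discount_bounds(1)
        by (intro mult_pos_pos) (auto simp: pt_def)
      then show False using elim(1) by (simp add: ennreal_eq_0_iff)
    qed
  qed
qed

text \<open>Almost every pair of paths agrees at almost all times, and right-continuity extends this
  to every time before T. At T there are no later times to approach from.\<close>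

lemma agree_before_T:
  assumes C: "increasing_process M F T C" "increasing_process M F T D"
    and eq: "AE z in N. C (snd z) (fst z) = D (snd z) (fst z)"
  shows "AE \<omega> in M. \<forall>t. 0 \<le> t \<and> ereal t < T \<longrightarrow> C t \<omega> = D t \<omega>"
  using AE_prod_time_D[OF eq] AE_space
proof eventually_elim
  case (elim \<omega>)
  show ?case
  proof (intro allI impI, elim conjE)
    fix t assume t: "0 \<le> t" "ereal t < T"
    obtain b where b: "t < b" "ereal b < T" using ereal_dense2[OF t(2)] by auto
    have "\<exists>s. t < s \<and> s < min b (t + 1 / real (Suc k)) \<and> (s \<in> horizon T \<longrightarrow> C s \<omega> = D s \<omega>)" for k
    proof -
      have "t < min b (t + 1 / real (Suc k))" using b by simp
      from AE_lborel_Ioo[OF elim(1) this] show ?thesis by auto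
    qed
    then obtain X where X: "\<And>k. t < X k" "\<And>k. X k < min b (t + 1 / real (Suc k))" "\<And>k. X k \<in> horizon T \<Longrightarrow> C (X k) \<omega> = D (X k) \<omega>"
      by metis
    have bH: "b \<in> horizon T" using b t by (auto simp: horizon_def)
    have XH: "X k \<in> horizon T" for k using X(1)[of k] X(2)[of k] t by (intro horizon_le[OF bH]) auto
    have tH: "t \<in> horizon T" using t by (auto simp: horizon_def)
    have "(\<lambda>k. t + 1 / real (Suc k)) \<longlonglongrightarrow> t + 0"
      by (intro tendsto_intros LIMSEQ_Suc[OF lim_const_over_n])
    then have upper: "(\<lambda>k. t + 1 / real (Suc k)) \<longlonglongrightarrow> t" by simp
    have "X k \<le> t + 1 / real (Suc k)" for k using X(2)[of k] by simp
    then have Xt: "X \<longlonglongrightarrow> t"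
      using X(1) by (intro tendsto_sandwich[OF _ _ tendsto_const upper] always_eventually allI) (auto intro: less_imp_le)
    have rc: "right_continuous_on (horizon T) (\<lambda>t. C t \<omega>)" "right_continuous_on (horizon T) (\<lambda>t. D t \<omega>)"
      using C elim(2) by (auto simp: increasing_process_def good_path_def)
    have tX: "t \<le> X k" for k using X(1)[of k] by simp
    have "(\<lambda>k. C (X k) \<omega>) \<longlonglongrightarrow> C t \<omega>" "(\<lambda>k. D (X k) \<omega>) \<longlonglongrightarrow> D t \<omega>"
      using right_continuous_on_LIMSEQ[OF rc(1) tH XH tX Xt] right_continuous_on_LIMSEQ[OF rc(2) tH XH tX Xt] by auto
    moreover have "(\<lambda>k. C (X k) \<omega>) = (\<lambda>k. D (X k) \<omega>)" using X(3)[OF XH] by auto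
    ultimately show "C t \<omega> = D t \<omega>" by (auto dest: LIMSEQ_unique)
  qed
qed

text \<open>A strictly positive consumption plan of cost at most 1, on which money saved elsewhere
  can be spent.\<close>

lemma xcost_exp: "xcost (\<lambda>t \<omega>. exp (- t)) \<le> 1" "consumption (\<lambda>t \<omega>. exp (- t))"
proof -
  show c: "consumption (\<lambda>t \<omega>. exp (- t))"
    unfolding consumption_def by (auto intro!: optional_const_time continuous_intros)
  note [measurable] = xcost_eq(3)[OF c]
  have "xcost (\<lambda>t \<omega>. exp (- t)) = (\<integral>\<^sup>+t\<in>horizon T. (\<integral>\<^sup>+\<omega>. ennreal (\<psi>x t \<omega>) * ennreal (exp (- t)) \<partial>M) \<partial>lborel)"
    unfolding xcost_eq(1)[OF c] by (subst nn_integral_prod_time_swap) auto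
  also have "\<dots> \<le> (\<integral>\<^sup>+t\<in>horizon T. ennreal (exp (- t)) \<partial>lborel)"
  proof (rule nn_integral_mono)
    fix t
    show "(\<integral>\<^sup>+\<omega>. ennreal (\<psi>x t \<omega>) * ennreal (exp (- t)) \<partial>M) * indicator (horizon T) t \<le> ennreal (exp (- t)) * indicator (horizon T) t"
    proof (cases "t \<in> horizon T")
      case True
      note [measurable] = px.psi_measurable[OF True]
      have "(\<integral>\<^sup>+\<omega>. ennreal (\<psi>x t \<omega>) * ennreal (exp (- t)) \<partial>M) = (\<integral>\<^sup>+\<omega>. ennreal (\<psi>x t \<omega>) \<partial>M) * ennreal (exp (- t))"
        by (rule nn_integral_multc) measurable
      also have "\<dots> \<le> 1 * ennreal (exp (- t))"
        by (intro mult_right_mono px.expected_price_le_1[OF True]) simp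
      finally show ?thesis using True by simp
    qed simp
  qed
  also have "\<dots> \<le> 1" by (rule nn_integral_exp_horizon)
  finally show "xcost (\<lambda>t \<omega>. exp (- t)) \<le> 1" .
qed

section \<open>Contributions at a finite terminal time\<close>

definition no_jump :: "'a process \<Rightarrow> 'a process" where
  "no_jump C t \<omega> = remove_jump T (\<lambda>t. C t \<omega>) t"

lemma no_jump:
  assumes C: "increasing_process M F T C"
  shows "increasing_process M F T (no_jump C)" "increasing_process M F T (\<lambda>t \<omega>. C t \<omega> - no_jump C t \<omega>)"
    "AE z in N. no_jump C (snd z) (fst z) = C (snd z) (fst z)"
proof -
  have gp: "good_path T (\<lambda>t. C t \<omega>)" if "\<omega> \<in> space M" for \<omega> using C that by (auto simp: increasing_process_def)
  have CF: "C s \<in> borel_measurable (F t)" if "s \<in> horizon T" "t \<in> horizon T" "s \<le> t" for s t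
    using C measurable_F_mono[OF _ that] that by (auto simp: increasing_process_def adapted_def)
  have nF: "no_jump C t \<in> borel_measurable (F t)" if t: "t \<in> horizon T" for t
  proof (cases "ereal t = T")
    case True
    have "(\<lambda>\<omega>. SUP s\<in>{s\<in>\<rat>. 0 \<le> s \<and> ereal s < T}. C s \<omega>) \<in> borel_measurable (F t)"
    proof (rule borel_measurable_cSUP)
      show "countable {s\<in>\<rat>. 0 \<le> s \<and> ereal s < T}" by (rule countable_subset[OF _ countable_rat]) auto
      show "C s \<in> borel_measurable (F t)" if "s \<in> {s\<in>\<rat>. 0 \<le> s \<and> ereal s < T}" for s
        using that t True by (intro CF) (auto simp: horizon_def)
      show "bdd_above ((\<lambda>s. C s \<omega>) ` {s\<in>\<rat>. 0 \<le> s \<and> ereal s < T})" if "\<omega> \<in> space (F t)" for \<omega>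
        using remove_jump(5)[OF gp T True] that space_F[OF t] by auto
    qed
    then show ?thesis using True by (simp add: no_jump_def[abs_def] remove_jump_def)
  next
    case False
    then show ?thesis using CF[OF t t] by (simp add: no_jump_def[abs_def] remove_jump_def)
  qed
  show inc: "increasing_process M F T (no_jump C)"
    using nF remove_jump(1)[OF gp T] by (auto simp: increasing_process_def adapted_def no_jump_def)
  have "(\<lambda>\<omega>. C t \<omega> - no_jump C t \<omega>) \<in> borel_measurable (F t)" if "t \<in> horizon T" for t
    using nF[OF that] CF[OF that that] by (intro borel_measurable_diff) auto
  then show "increasing_process M F T (\<lambda>t \<omega>. C t \<omega> - no_jump C t \<omega>)"
    using remove_jump(2)[OF gp T] by (auto simp: increasing_process_def adapted_def no_jump_def)
  note [measurable] = consumption_measurable[OF increasing_consumption[OF C]] consumption_measurable[OF increasing_consumption[OF inc]]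
  show "AE z in N. no_jump C (snd z) (fst z) = C (snd z) (fst z)"
  proof (rule AE_prod_time_I)
    show "{z \<in> space N. no_jump C (snd z) (fst z) = C (snd z) (fst z)} \<in> sets N" by measurable
    have "AE t in lborel. ereal t \<noteq> T"
    proof (cases T)
      case (real T')
      have "AE t in lborel. t \<noteq> T'" by (rule AE_lborel_singleton)
      then show ?thesis using real by auto
    qed auto
    then have "AE t in lborel. t \<in> horizon T \<longrightarrow>
      no_jump C (snd (\<omega>, t)) (fst (\<omega>, t)) = C (snd (\<omega>, t)) (fst (\<omega>, t))" for \<omega>
      by eventually_elim (simp add: no_jump_def remove_jump_def)
    then show "AE \<omega> in M. AE t in lborel. t \<in> horizon T \<longrightarrow>
      no_jump C (snd (\<omega>, t)) (fst (\<omega>, t)) = C (snd (\<omega>, t)) (fst (\<omega>, t))"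
      by (rule AE_I2)
  qed
qed

lemma welfare_mono:
  assumes "\<And>i. i \<in> {1..n} \<Longrightarrow> AE z in N. util i (x i) C z \<le> util i (y i) D z"
  shows "welfare x C \<le> welfare y D"
  unfolding welfare_def
proof (intro sum_mono mult_left_mono nn_integral_mono_AE)
  fix i assume "i \<in> {1..n}"
  from assms[OF this] show "AE z in N. ennreal (util i (x i) C z) \<le> ennreal (util i (y i) D z)"
    by eventually_elim (rule ennreal_leI)
qed simp

lemma util_mono:
  assumes i: "i \<in> {1..n}" and x: "consumption x" "consumption C" and z: "z \<in> space N"
    and le: "x (snd z) (fst z) \<le> y (snd z) (fst z)" "C (snd z) (fst z) = D (snd z) (fst z)"
  shows "util i x C z \<le> util i y D z"
proof -
  have "u i (x (snd z) (fst z), C (snd z) (fst z)) \<le> u i (y (snd z) (fst z), D (snd z) (fst z))"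
    using u_regular[OF i] quadrant_process[OF x z] le by (auto simp: utility_regular_def quadrant_def)
  then show ?thesis unfolding util_def using discount_bounds(1)[of "snd z" "fst z"] by (simp add: mult_left_mono)
qed

text \<open>Money spent on a jump at \<open>T\<close> could be moved to agent 1's consumption; the new
  strategy would be a maximizer with a different consumption process.\<close>

lemma maximizer_no_jump:
  assumes f: "feasible x C" and max: "max_welfare \<le> welfare x C"
  shows "AE \<omega> in M. \<forall>t\<in>horizon T. C t \<omega> = no_jump C t \<omega>"
proof (cases "\<exists>T'. ereal T' = T")
  case False
  then show ?thesis by (auto simp: no_jump_def remove_jump_def)
next
  case True
  then obtain T' where T': "ereal T' = T" by blast
  have C: "increasing_process M F T C" and x: "\<And>i. i \<in> {1..n} \<Longrightarrow> consumption (x i)"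
    using f by (auto simp: feasible_def)
  have T'H: "T' \<in> horizon T" "0 < T'" using T'[symmetric] T by (auto simp: horizon_def zero_ereal_def)
  define J where "J t \<omega> = C t \<omega> - no_jump C t \<omega>" for t \<omega>
  have J: "increasing_process M F T J" and NJ: "increasing_process M F T (no_jump C)"
    using no_jump[OF C] by (auto simp: J_def[abs_def])
  have [measurable]: "J T' \<in> borel_measurable M" "\<psi>c T' \<in> borel_measurable M"
    using J pc.psi_measurable[OF T'H(1)] measurable_F_M[OF _ T'H(1)] T'H(1) by (auto simp: increasing_process_def adapted_def)
  have J0: "0 \<le> J T' \<omega>" if "\<omega> \<in> space M" for \<omega>
    using J that T'H by (auto simp: increasing_process_def good_path_def)
  \<comment> \<open>A lower bound for the money saved by dropping the jump at T.\<close>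
  define \<sigma> where "\<sigma> = (\<integral>\<^sup>+\<omega>. ennreal (\<psi>c T' \<omega> * J T' \<omega>) \<partial>M)"
  have cost: "ccost C = ccost (no_jump C) + ccost J"
    using ccost_lincomb[OF NJ J, of 1 1] by (simp add: J_def)
  have "\<sigma> \<le> (\<integral>\<^sup>+\<omega>. stieltjes_upto T T' (\<lambda>t. \<psi>c t \<omega>) (\<lambda>t. J t \<omega>) \<partial>M)"
    unfolding \<sigma>_def by (rule pc.expected_level_le_upto[OF J T'H])
  also have "\<dots> \<le> ccost J"
    unfolding ccost_def by (intro nn_integral_mono nonneg_integrand.upto_le_integral[OF pc.psi_integrand T'H(1)])
  finally have \<sigma>J: "\<sigma> \<le> ccost J" .
  have "\<sigma> \<le> ccost C" using \<sigma>J cost by (simp add: add_increasing)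
  then have \<sigma>_fin: "\<sigma> < \<infinity>" using le_less_trans[OF order_trans[OF _ feasible_costs(2)[OF f]] ennreal_less_top] by simp
  have "\<sigma> = 0"
  proof (rule ccontr)
    assume "\<sigma> \<noteq> 0"
    define s where "s = enn2real \<sigma>"
    have s: "0 < s" "ennreal s = \<sigma>"
      using \<open>\<sigma> \<noteq> 0\<close> \<sigma>_fin by (auto simp: s_def enn2real_positive_iff zero_less_iff_neq_zero)
    have one: "1 \<in> {1..n}" using n by auto
    \<comment> \<open>By \<open>xcost_exp\<close> the additional consumption costs at most the
      saving. Utilities are increasing and the no-jump process differs at a null time only, so this
      plan is again optimal, although its first consumption is larger everywhere.\<close>
    define y where "y i = (if i = 1 then (\<lambda>t \<omega>. 1 * x 1 t \<omega> + s * exp (- t)) else x i)" for i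
    have y1: "xcost (y 1) = xcost (x 1) + \<sigma> * xcost (\<lambda>t \<omega>. exp (- t))" "consumption (y 1)"
      using xcost_lincomb[OF x[OF one] xcost_exp(2), of 1 s] s by (auto simp: y_def)
    have y: "consumption (y i)" if "i \<in> {1..n}" for i
      using x[OF that] y1(2) by (cases "i = 1") (auto simp: y_def)
    have "(\<Sum>i=1..n. xcost (y i)) \<le> (\<Sum>i=1..n. xcost (x i)) + \<sigma>"
    proof -
      have "(\<Sum>i=1..n. xcost (y i)) = xcost (y 1) + (\<Sum>i\<in>{1..n}-{1}. xcost (x i))"
        using one by (subst sum.remove[of _ 1]) (auto simp: y_def intro!: sum.cong)
      also have "xcost (y 1) \<le> xcost (x 1) + \<sigma> * 1"
        unfolding y1(1) by (intro add_left_mono mult_left_mono xcost_exp) simp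
      also have "xcost (x 1) + \<sigma> * 1 + (\<Sum>i\<in>{1..n}-{1}. xcost (x i)) = (\<Sum>i=1..n. xcost (x i)) + \<sigma>"
        using one by (subst (2) sum.remove[of _ 1]) (auto simp: ac_simps)
      finally show ?thesis by (simp add: add_right_mono)
    qed
    then have "(\<Sum>i=1..n. xcost (y i)) + ccost (no_jump C) \<le> (\<Sum>i=1..n. xcost (x i)) + (ccost (no_jump C) + \<sigma>)"
      by (simp add: add_right_mono ac_simps)
    also have "\<dots> \<le> (\<Sum>i=1..n. xcost (x i)) + ccost C"
      unfolding cost by (intro add_left_mono \<sigma>J)
    also have "\<dots> \<le> ennreal wealth" using f by (simp add: feasible_def)
    finally have fy: "feasible y (no_jump C)" using y NJ by (auto simp: feasible_def)
    have "welfare x C \<le> welfare y (no_jump C)"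
    proof (rule welfare_mono)
      fix i assume i: "i \<in> {1..n}"
      show "AE z in N. util i (x i) C z \<le> util i (y i) (no_jump C) z"
        using no_jump(3)[OF C] AE_space
      proof eventually_elim
        case (elim z)
        show ?case using s
          by (intro util_mono[OF i x[OF i] increasing_consumption[OF C] elim(2)]) (auto simp: y_def elim(1))
      qed
    qed
    then have "max_welfare \<le> welfare y (no_jump C)" using max by (rule order_trans[rotated])
    from maximizers_agree[OF f fy max this one] have "AE z in N. False"
      by eventually_elim (use s in \<open>auto simp: pt_def y_def\<close>)
    then show False using AE_N_nonempty by blast
  qed
  then have "AE \<omega> in M. ennreal (\<psi>c T' \<omega> * J T' \<omega>) = 0"
    unfolding \<sigma>_def by (subst (asm) nn_integral_0_iff_AE) auto
  then show ?thesis
    using AE_space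
  proof eventually_elim
    case (elim \<omega>)
    have "J T' \<omega> = 0"
    proof (rule ccontr)
      assume "J T' \<omega> \<noteq> 0"
      then have "0 < J T' \<omega>" using J0[OF elim(2)] by simp
      from mult_pos_pos[OF pc.psi_pos[OF T'H(1) elim(2)] this] elim(1) show False
        by (simp add: ennreal_eq_0_iff)
    qed
    then have "C t \<omega> = no_jump C t \<omega>" for t
      using T' by (cases "t = T'") (auto simp: J_def no_jump_def remove_jump_def)
    then show ?case by simp
  qed
qed

text \<open>Before a finite T the contributions agree by right-continuity; at T both equal the left
  limits of the same path.\<close>

lemma maximizers_unique:
  assumes f: "feasible x C" "feasible y D" and max: "max_welfare \<le> welfare x C" "max_welfare \<le> welfare y D"
  shows "i \<in> {1..n} \<Longrightarrow> AE z in N. x i (snd z) (fst z) = y i (snd z) (fst z)"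
    and "AE \<omega> in M. \<forall>t\<in>horizon T. C t \<omega> = D t \<omega>"
proof -
  show "AE z in N. x i (snd z) (fst z) = y i (snd z) (fst z)" if "i \<in> {1..n}" for i
    using maximizers_agree[OF f max that] by eventually_elim (simp add: pt_def)
  have C: "increasing_process M F T C" "increasing_process M F T D" using f by (auto simp: feasible_def)
  have "1 \<in> {1..n}" using n by auto
  from maximizers_agree[OF f max this] have "AE z in N. C (snd z) (fst z) = D (snd z) (fst z)"
    by eventually_elim (simp add: pt_def)
  from agree_before_T[OF C this] maximizer_no_jump[OF f(1) max(1)] maximizer_no_jump[OF f(2) max(2)]
  show "AE \<omega> in M. \<forall>t\<in>horizon T. C t \<omega> = D t \<omega>"
  proof eventually_elim
    case (elim \<omega>)
    show ?case
    proof
      fix t assume t: "t \<in> horizon T"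
      show "C t \<omega> = D t \<omega>"
      proof (cases "ereal t = T")
        case True
        have "no_jump C t \<omega> = no_jump D t \<omega>"
          unfolding no_jump_def remove_jump_def using True elim(1) by (auto intro!: SUP_cong)
        then show ?thesis using elim(2,3) t by simp
      next
        case False
        then show ?thesis using elim(1) t by (auto simp: horizon_def)
      qed
    qed
  qed
qed

end

section \<open>Existence\<close>

text \<open>Helly selection for one path; \<open>A\<close> is a dense set of times before \<open>T\<close>. At \<open>T\<close>
  itself any value above the left limit would do.\<close>

definition helly_limit :: "ereal \<Rightarrow> real set \<Rightarrow> (nat \<Rightarrow> real \<Rightarrow> real) \<Rightarrow> real \<Rightarrow> real" where
  "helly_limit T A c t = (if ereal t = T then enn2real (liminf (\<lambda>j. ennreal (c j t)))
     else INF d\<in>{d\<in>A. t < d}. lim (\<lambda>j. c j d))"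

text \<open>With an infinite limit inferior at T the conversion \<open>enn2real\<close> would return
  0 and could destroy monotonicity; \<open>fin\<close> excludes this.\<close>

locale path_limit =
  fixes T :: ereal and A :: "real set" and c :: "nat \<Rightarrow> real \<Rightarrow> real"
  assumes T: "0 < T" and gp: "\<And>j. good_path T (c j)"
    and A: "\<And>d. d \<in> A \<Longrightarrow> 0 < d \<and> ereal d < T"
    and dense: "\<And>a b. 0 \<le> a \<Longrightarrow> a < b \<Longrightarrow> ereal a < T \<Longrightarrow> \<exists>d\<in>A. a < d \<and> d < b"
    and conv: "\<And>d. d \<in> A \<Longrightarrow> convergent (\<lambda>j. c j d)"
    and fin: "\<And>t. ereal t = T \<Longrightarrow> liminf (\<lambda>j. ennreal (c j t)) < \<infinity>"
begin

definition L where "L d = lim (\<lambda>j. c j d)"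
abbreviation "C \<equiv> helly_limit T A c"

lemma L: "d \<in> A \<Longrightarrow> (\<lambda>j. c j d) \<longlonglongrightarrow> L d"
  unfolding L_def using conv convergent_LIMSEQ_iff by blast

lemma AH: "d \<in> A \<Longrightarrow> d \<in> horizon T"
  using A[of d] by (auto simp: horizon_def)

lemma c_mono: "s \<in> horizon T \<Longrightarrow> t \<in> horizon T \<Longrightarrow> s \<le> t \<Longrightarrow> c j s \<le> c j t"
  using gp[of j] by (auto simp: good_path_def mono_on_def)

lemma c_nonneg: "t \<in> horizon T \<Longrightarrow> 0 \<le> c j t"
  using gp[of j] by (auto simp: good_path_def)

lemma L_nonneg: "d \<in> A \<Longrightarrow> 0 \<le> L d"
  by (rule LIMSEQ_le_const[OF L]) (auto intro!: c_nonneg AH)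

lemma bdd: "bdd_below (L ` {d\<in>A. t < d})"
  by (rule bdd_belowI[of _ 0]) (auto intro: L_nonneg)

lemma C_eq: "ereal t \<noteq> T \<Longrightarrow> C t = (INF d\<in>{d\<in>A. t < d}. L d)"
  by (simp add: helly_limit_def L_def)

lemma C_le: "d \<in> A \<Longrightarrow> t < d \<Longrightarrow> C t \<le> L d"
  using A[of d] by (subst C_eq) (auto intro!: cINF_lower bdd)

lemma ne: "0 \<le> t \<Longrightarrow> ereal t < T \<Longrightarrow> {d\<in>A. t < d} \<noteq> {}"
  using dense[of t "t + 1"] by auto

lemma C_less: "0 \<le> t \<Longrightarrow> ereal t < T \<Longrightarrow> C t < a \<Longrightarrow> \<exists>d\<in>A. t < d \<and> L d < a"
  using cINF_less_iff[OF ne bdd, of t a] C_eq[of t] by auto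

lemma C_ge: "0 \<le> t \<Longrightarrow> ereal t < T \<Longrightarrow> (\<And>d. d \<in> A \<Longrightarrow> t < d \<Longrightarrow> a \<le> L d) \<Longrightarrow> a \<le> C t"
  using C_eq[of t] ne[of t] by (auto intro!: cINF_greatest)

text \<open>At T the levels \<open>c j t\<close> dominate those at \<open>d\<close> before the limit
  inferior is taken; before T all later limits dominate \<open>L d\<close>.\<close>

lemma L_le_C: "d \<in> A \<Longrightarrow> d \<le> t \<Longrightarrow> t \<in> horizon T \<Longrightarrow> L d \<le> C t"
proof (cases "ereal t = T")
  case True
  assume d: "d \<in> A" "d \<le> t" and t: "t \<in> horizon T"
  have "(\<lambda>j. ennreal (c j d)) \<longlonglongrightarrow> ennreal (L d)" by (intro tendsto_ennrealI L d)
  then have "ennreal (L d) = liminf (\<lambda>j. ennreal (c j d))" by (rule lim_imp_Liminf[rotated, symmetric]) simp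
  also have "\<dots> \<le> liminf (\<lambda>j. ennreal (c j t))"
    by (intro Liminf_mono always_eventually allI ennreal_leI c_mono AH d t)
  also have "\<dots> = ennreal (C t)" using True fin[OF True] by (simp add: helly_limit_def)
  finally show "L d \<le> C t"
    using True by (subst (asm) ennreal_le_iff) (auto simp: helly_limit_def)
next
  case False
  assume d: "d \<in> A" "d \<le> t" and t: "t \<in> horizon T"
  show "L d \<le> C t"
  proof (rule C_ge)
    show "0 \<le> t" "ereal t < T" using t False by (auto simp: horizon_def)
    fix d' assume "d' \<in> A" "t < d'"
    then show "L d \<le> L d'"
      using d by (intro LIMSEQ_le[OF L L] exI[of _ 0] allI impI c_mono AH) auto
  qed
qed

lemma C_mono:
  assumes "s \<in> horizon T" "t \<in> horizon T" "s \<le> t"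
  shows "C s \<le> C t"
proof (cases "s = t")
  case False
  then have s: "0 \<le> s" "ereal s < T" "s < t"
    using assms by (auto simp: horizon_def intro: less_le_trans[of "ereal s" "ereal t"])
  obtain d where d: "d \<in> A" "s < d" "d < t" using dense[OF s(1,3,2)] by auto
  have "C s \<le> L d" by (rule C_le[OF d(1,2)])
  also have "\<dots> \<le> C t" using d assms by (intro L_le_C) auto
  finally show ?thesis .
qed simp

text \<open>Right-continuity comes from taking the infimum over strictly later times: a time
  \<open>d\<close> that nearly attains it at \<open>t\<close> also lies beyond all times close to
  \<open>t\<close>.\<close>

lemma good_path: "good_path T C"
  unfolding good_path_def
proof (intro conjI mono_onI ballI)
  show "right_continuous_on (horizon T) C"
  proof (rule right_continuous_onI)
    fix t X assume t: "t \<in> horizon T" and X: "\<And>k. X k \<in> horizon T" "\<And>k. t \<le> X k" "X \<longlonglongrightarrow> t"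
    show "(\<lambda>k. C (X k)) \<longlonglongrightarrow> C t"
    proof (cases "ereal t = T")
      case True
      have "X k = t" for k using X(1)[of k] X(2)[of k] True by (auto simp: horizon_def)
      then show ?thesis by simp
    next
      case False
      then have t': "0 \<le> t" "ereal t < T" using t by (auto simp: horizon_def)
      show ?thesis
      proof (rule order_tendstoI)
        fix a assume "a < C t"
        then have "a < C (X k)" for k using C_mono[OF t X(1) X(2), of k] by simp
        then show "eventually (\<lambda>k. a < C (X k)) sequentially" by simp
      next
        fix a assume "C t < a"
        then obtain d where d: "d \<in> A" "t < d" "L d < a" using C_less[OF t'] by blast
        have "eventually (\<lambda>k. X k < d) sequentially" by (rule order_tendstoD(2)[OF X(3) d(2)])
        then show "eventually (\<lambda>k. C (X k) < a) sequentially"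
          by eventually_elim (use C_le[OF d(1)] d(3) in \<open>auto intro: le_less_trans\<close>)
      qed
    qed
  qed
  show "C r \<le> C s" if "r \<in> horizon T" "s \<in> horizon T" "r \<le> s" for r s by (rule C_mono[OF that])
  fix t assume t: "t \<in> horizon T"
  show "0 \<le> C t"
  proof (cases "ereal t = T")
    case False
    then show ?thesis using t by (intro C_ge L_nonneg) (auto simp: horizon_def)
  qed (simp add: helly_limit_def)
qed

text \<open>The value at \<open>t\<close> is determined by times before any given s > t. This makes
  the limit adapted, as the filtration is right-continuous.\<close>

lemma C_local:
  assumes "0 \<le> t" "t < s" "ereal t < T"
  shows "C t = (INF d\<in>{d\<in>A. t < d \<and> d < s}. L d)"
proof (rule antisym)
  have ne': "{d\<in>A. t < d \<and> d < s} \<noteq> {}" using dense[OF assms] by auto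
  have bdd': "bdd_below (L ` {d\<in>A. t < d \<and> d < s})"
    by (rule bdd_belowI[of _ 0]) (auto intro: L_nonneg)
  show "C t \<le> (INF d\<in>{d\<in>A. t < d \<and> d < s}. L d)"
    using ne' by (intro cINF_greatest) (auto intro: C_le)
  show "(INF d\<in>{d\<in>A. t < d \<and> d < s}. L d) \<le> C t"
  proof (rule C_ge[OF assms(1,3)])
    fix d assume d: "d \<in> A" "t < d"
    have "t < min d s" using d assms by simp
    then obtain d' where d': "d' \<in> A" "t < d'" "d' < min d s" using dense[OF assms(1) _ assms(3)] by blast
    have "(INF d\<in>{d\<in>A. t < d \<and> d < s}. L d) \<le> L d'" using d' by (intro cINF_lower bdd') auto
    also have "\<dots> \<le> L d" using d d' by (intro LIMSEQ_le[OF L L] exI[of _ 0] allI impI c_mono AH) auto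
    finally show "(INF d\<in>{d\<in>A. t < d \<and> d < s}. L d) \<le> L d" .
  qed
qed

text \<open>The level at \<open>t\<close> lies between the levels at times of \<open>A\<close> just
  before and just after \<open>t\<close>, and continuity closes the gap between their
  limits.\<close>

lemma tendsto_at_continuity:
  assumes t: "0 < t" "ereal t < T" and cont: "continuous (at t within horizon T) C"
  shows "(\<lambda>j. c j t) \<longlonglongrightarrow> C t"
proof (rule order_tendstoI)
  have tH: "t \<in> horizon T" using t by (auto simp: horizon_def)
  fix a assume a: "C t < a"
  obtain d where d: "d \<in> A" "t < d" "L d < a" using C_less[OF _ t(2) a] t by auto
  have "eventually (\<lambda>j. c j d < a) sequentially" by (rule order_tendstoD(2)[OF L[OF d(1)] d(3)])
  then show "eventually (\<lambda>j. c j t < a) sequentially"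
    by eventually_elim (use d c_mono[OF tH AH[OF d(1)]] in \<open>auto intro: le_less_trans\<close>)
next
  have tH: "t \<in> horizon T" using t by (auto simp: horizon_def)
  fix a assume a: "a < C t"
  \<comment> \<open>Times that approach \<open>t\<close> from the left without leaving the
    horizon.\<close>
  define s where "s k = t - t / real (Suc k)" for k
  have s: "0 \<le> s k" "s k < t" for k using t by (auto simp: s_def field_simps)
  have sH: "s k \<in> horizon T" for k using s[of k] by (intro horizon_le[OF tH]) auto
  have "s \<longlonglongrightarrow> t - 0"
    unfolding s_def by (intro tendsto_intros LIMSEQ_Suc[OF lim_const_over_n])
  then have "(\<lambda>k. C (s k)) \<longlonglongrightarrow> C t"
    using cont sH unfolding continuous_within_sequentially by (auto simp: o_def)
  then have "eventually (\<lambda>k. a < C (s k)) sequentially" using a by (rule order_tendstoD(1))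
  then obtain k where k: "a < C (s k)" by (auto simp: eventually_sequentially)
  have "ereal (s k) < T" using s[of k] t(2) less_trans[of "ereal (s k)" "ereal t" T] by simp
  then obtain d where d: "d \<in> A" "s k < d" "d < t" using dense[of "s k" t] s by blast
  have "a < L d" using k C_le[OF d(1,2)] by simp
  then have "eventually (\<lambda>j. a < c j d) sequentially" by (rule order_tendstoD(1)[OF L[OF d(1)]])
  then show "eventually (\<lambda>j. a < c j t) sequentially"
    by eventually_elim (use d c_mono[OF AH[OF d(1)] tH] in \<open>auto intro: less_le_trans\<close>)
qed

text \<open>A monotone path has countably many discontinuities, and the times 0 and T are
  negligible.\<close>

lemma AE_tendsto: "AE t in lborel. t \<in> horizon T \<longrightarrow> (\<lambda>j. c j t) \<longlonglongrightarrow> C t"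
proof -
  have "countable {t\<in>horizon T. \<not> continuous (at t within horizon T) C}"
    using good_path by (intro mono_on_ctble_discont) (simp add: good_path_def)
  then have "AE t in lborel. t \<notin> {t\<in>horizon T. \<not> continuous (at t within horizon T) C}"
    by (intro AE_not_in countable_imp_null_set_lborel)
  moreover have "AE t in lborel. t \<noteq> (0::real)" by (rule AE_lborel_singleton)
  moreover have "AE t in lborel. ereal t \<noteq> T"
  proof (cases T)
    case (real T')
    have "AE t in lborel. t \<noteq> T'" by (rule AE_lborel_singleton)
    then show ?thesis using real by auto
  qed auto
  ultimately show ?thesis
    by eventually_elim (auto simp: horizon_def intro!: tendsto_at_continuity)
qed

end

text \<open>Used to choose the end of a grid so that all its points, which are fixed multiples of
  the end, avoid an exceptional null set.\<close>

lemma AE_lborel_scale: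
  fixes c :: real
  assumes "AE t in lborel. P t" "0 < c"
  shows "AE t in lborel. P (c * t)"
proof -
  obtain A where A: "A \<in> null_sets lborel" "{t. \<not> P t} \<subseteq> A"
    using assms(1) by (auto elim!: AE_E3 AE_E simp: null_sets_def)
  have "emeasure lborel ((*) c -` A) = emeasure (distr lborel borel ((*) c)) A"
    using A by (subst emeasure_distr) auto
  also have "\<dots> = (\<integral>\<^sup>+t. ennreal (inverse \<bar>c\<bar>) * indicator A t \<partial>lborel)"
    using A assms(2) by (subst lborel_distr_mult) (auto simp: emeasure_density)
  also have "\<dots> = 0" using A by (subst nn_integral_cmult_indicator) auto
  finally have "(*) c -` A \<in> null_sets lborel"
    using A measurable_sets[of "(*) c" borel borel A] by (intro null_setsI) auto
  then show ?thesis by (rule AE_I') (use A in auto)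
qed

lemma tendsto_sets:
  fixes f :: "nat \<Rightarrow> 'b \<Rightarrow> real"
  assumes [measurable]: "\<And>j. f j \<in> borel_measurable A" "g \<in> borel_measurable A"
  shows "{z\<in>space A. (\<lambda>j. f j z) \<longlonglongrightarrow> g z} \<in> sets A"
proof -
  have "(\<lambda>j. f j z) \<longlonglongrightarrow> g z \<longleftrightarrow> (\<forall>m. \<exists>K. \<forall>k\<ge>K. \<bar>f k z - g z\<bar> < inverse (real (Suc m)))" for z
  proof
    assume "(\<lambda>j. f j z) \<longlonglongrightarrow> g z"
    from LIMSEQ_D[OF this] show "\<forall>m. \<exists>K. \<forall>k\<ge>K. \<bar>f k z - g z\<bar> < inverse (real (Suc m))" by force
  next
    assume *: "\<forall>m. \<exists>K. \<forall>k\<ge>K. \<bar>f k z - g z\<bar> < inverse (real (Suc m))"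
    show "(\<lambda>j. f j z) \<longlonglongrightarrow> g z"
    proof (rule LIMSEQ_I)
      fix e :: real assume "0 < e"
      from reals_Archimedean[OF this] obtain m where m: "inverse (real (Suc m)) < e" by blast
      from * obtain K where "\<forall>k\<ge>K. \<bar>f k z - g z\<bar> < inverse (real (Suc m))" by blast
      with m show "\<exists>K. \<forall>k\<ge>K. norm (f k z - g z) < e" by (intro exI[of _ K]) auto
    qed
  qed
  then show ?thesis by simp
qed

text \<open>Fatou's lemma for the counting measure.\<close>

lemma sum_liminf_le:
  fixes a :: "'i \<Rightarrow> nat \<Rightarrow> ennreal"
  assumes "finite I"
  shows "(\<Sum>i\<in>I. liminf (a i)) \<le> liminf (\<lambda>j. \<Sum>i\<in>I. a i j)"
  using nn_integral_liminf[of "\<lambda>j i. a i j" "count_space I"] assms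
  by (simp add: nn_integral_count_space_finite)

lemma liminf_real_le:
  assumes "0 < (p::real)" and "liminf (\<lambda>j. ennreal (p * d j)) < \<infinity>"
  shows "liminf (\<lambda>j. ennreal (d j)) < \<infinity>"
proof (rule ccontr)
  assume "\<not> ?thesis"
  then have top: "liminf (\<lambda>j. ennreal (d j)) = \<infinity>" by (simp add: not_less top_unique)
  have ge: "ennreal B \<le> liminf (\<lambda>j. ennreal (p * d j))" for B
  proof (rule Liminf_bounded)
    have "ennreal (B / p) < liminf (\<lambda>j. ennreal (d j))" unfolding top by simp
    then have "eventually (\<lambda>j. ennreal (B / p) < ennreal (d j)) sequentially" by (rule less_LiminfD)
    then show "eventually (\<lambda>j. ennreal B \<le> ennreal (p * d j)) sequentially"
    proof eventually_elim
      case (elim j)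
      then have "B / p < d j" by (metis ennreal_leI not_le)
      then have "B \<le> p * d j" using assms(1) by (simp add: field_simps)
      then show ?case by (rule ennreal_leI)
    qed
  qed
  obtain b where b: "0 \<le> b" "liminf (\<lambda>j. ennreal (p * d j)) = ennreal b"
    using assms(2) by (cases "liminf (\<lambda>j. ennreal (p * d j))") auto
  show False using ge[of "b + 1"] b by (simp del: ennreal_plus)
qed

context filtered_space
begin

text \<open>This is the right-continuity of the filtration.\<close>

lemma measurable_right_limit:
  assumes t: "t \<in> horizon T" "ereal t < T"
    and f: "\<And>s. s \<in> horizon T \<Longrightarrow> t < s \<Longrightarrow> f \<in> borel_measurable (F s)"
  shows "f \<in> borel_measurable (F t)"
proof (rule measurableI)
  fix B :: "'b set" assume B: "B \<in> sets borel"
  have "f -` B \<inter> space (F t) \<in> sets (F s)" if "s \<in> horizon T" "t < s" for s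
    using measurable_sets[OF f[OF that] B] space_F[OF t(1)] space_F[OF that(1)] by simp
  moreover have "sets (F t) = (\<Inter>s\<in>{s \<in> horizon T. t < s}. sets (F s))"
    using filt t by (auto simp: usual_filtration_def)
  ultimately show "f -` B \<inter> space (F t) \<in> sets (F t)" by auto
qed simp

end

section \<open>Maximizing sequences and their limits\<close>

context planner
begin

lemma feasible_zero: "feasible (\<lambda>i t \<omega>. 0) (\<lambda>t \<omega>. 0)"
proof -
  have z: "consumption (\<lambda>t \<omega>. 0)" by (rule increasing_consumption[OF increasing_zero])
  have "xcost (\<lambda>t \<omega>. 0) = 0" using xcost_lincomb(1)[OF z z, of 0 0] by simp
  then show ?thesis using z increasing_zero ccost_zero by (simp add: feasible_def)
qed

lemma near_maximizer:
  assumes e: "0 < (e::real)"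
  obtains x C where "feasible x C" "max_welfare \<le> welfare x C + ennreal e"
proof (cases "max_welfare = 0")
  \<comment> \<open>In \<open>ennreal\<close> no value lies below 0, so a maximum of 0 is treated
    apart; any feasible plan attains it.\<close>
  case True
  then show thesis using that[OF feasible_zero] by simp
next
  case False
  have "max_welfare - ennreal e < max_welfare"
    using False e max_welfare_finite by (intro ennreal_between) (auto simp: zero_less_iff_neq_zero)
  then obtain x C where f: "feasible x C" "max_welfare - ennreal e < welfare x C"
    unfolding max_welfare_def less_SUP_iff by auto
  then have "max_welfare \<le> welfare x C + ennreal e"
    using ennreal_minus_le_iff[of max_welfare "ennreal e" "welfare x C"] by (auto simp: add.commute less_imp_le)
  then show thesis using that f(1) by blast
qed

lemma close_in_measure:
  assumes e: "0 < (e::real)"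
  obtains d where "0 < d" "\<And>x C y D i. feasible x C \<Longrightarrow> feasible y D \<Longrightarrow>
    max_welfare \<le> welfare x C + ennreal d \<Longrightarrow> max_welfare \<le> welfare y D + ennreal d \<Longrightarrow> i \<in> {1..n} \<Longrightarrow>
    emeasure \<mu> {z\<in>space N. e \<le> dist (pt (x i) C z) (pt (y i) D z)} \<le> ennreal e"
proof -
  define Q where "Q i d \<longleftrightarrow> 0 < d \<and> (\<forall>x C y D. feasible x C \<longrightarrow> feasible y D \<longrightarrow>
    max_welfare \<le> welfare x C + ennreal d \<longrightarrow> max_welfare \<le> welfare y D + ennreal d \<longrightarrow>
    emeasure \<mu> {z\<in>space N. e \<le> dist (pt (x i) C z) (pt (y i) D z)} \<le> ennreal e)" for i d
  have "\<exists>d. Q i d" if i: "i \<in> {1..n}" for i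
  proof -
    obtain d where "0 < d" "\<And>x C y D. feasible x C \<Longrightarrow> feasible y D \<Longrightarrow>
      max_welfare \<le> welfare x C + ennreal d \<Longrightarrow> max_welfare \<le> welfare y D + ennreal d \<Longrightarrow>
      emeasure \<mu> {z\<in>space N. e \<le> dist (pt (x i) C z) (pt (y i) D z)} \<le> ennreal e"
      by (rule close_in_measure_single[OF e i]) (rule that)
    then show ?thesis by (auto simp: Q_def intro!: exI[of _ d])
  qed
  then obtain d where d: "\<And>i. i \<in> {1..n} \<Longrightarrow> Q i (d i)" by metis
  define m where "m = Min (d ` {1..n})"
  have ne: "d ` {1..n} \<noteq> {}" using n by auto
  have "m \<in> d ` {1..n}" unfolding m_def using ne by (intro Min_in) auto
  then have m: "0 < m" using d by (auto simp: Q_def)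
  have le: "a \<le> b + ennreal (d i)" if "a \<le> b + ennreal m" "i \<in> {1..n}" for a b i
  proof -
    have "m \<le> d i" using that(2) by (simp add: m_def)
    then show ?thesis using that(1) by (meson add_left_mono ennreal_leI order_trans)
  qed
  show thesis
    by (rule that[OF m]) (use d le in \<open>auto simp: Q_def\<close>)
qed

lemma convergent_maximizing_sequence:
  obtains X D where "\<And>j. feasible (X j) (D j)" "(\<lambda>j. welfare (X j) (D j)) \<longlonglongrightarrow> max_welfare"
    "\<And>i. i \<in> {1..n} \<Longrightarrow> AE z in N. convergent (\<lambda>j. X j i (snd z) (fst z))"
    "AE z in N. convergent (\<lambda>j. D j (snd z) (fst z))"
proof -
  define \<epsilon> where "\<epsilon> k = inverse (real (Suc k))" for k
  have \<epsilon>: "0 < \<epsilon> k" for k by (simp add: \<epsilon>_def)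
  have "\<exists>xC. feasible (fst xC) (snd xC) \<and> max_welfare \<le> welfare (fst xC) (snd xC) + ennreal (\<epsilon> k)" for k
    by (rule near_maximizer[OF \<epsilon>[of k]]) auto
  then obtain XC where XC: "\<And>k. feasible (fst (XC k)) (snd (XC k))"
    "\<And>k. max_welfare \<le> welfare (fst (XC k)) (snd (XC k)) + ennreal (\<epsilon> k)" by metis
  define X where "X k = fst (XC k)" for k
  define D where "D k = snd (XC k)" for k
  have f: "feasible (X k) (D k)" and near: "max_welfare \<le> welfare (X k) (D k) + ennreal (\<epsilon> k)" for k
    using XC by (auto simp: X_def D_def)
  \<comment> \<open>Index 0 stands for the aggregate contribution, so that a single extraction gives
    a subsequence common to it and all consumptions.\<close>
  define h where "h i k z = (if i = 0 then D k (snd z) (fst z) else X k i (snd z) (fst z))" for i k z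
  have c: "consumption (D k)" "i \<in> {1..n} \<Longrightarrow> consumption (X k i)" for k i
    using f[of k] increasing_consumption by (auto simp: feasible_def)
  have hm: "h i k \<in> borel_measurable N" if "i \<in> {0..n}" for i k
  proof (cases "i = 0")
    case False
    then show ?thesis using that consumption_measurable[OF c(2)[of i k]] by (simp add: h_def[abs_def])
  qed (use consumption_measurable[OF c(1)] in \<open>simp add: h_def[abs_def]\<close>)
  obtain \<kappa> :: "nat \<Rightarrow> nat" where \<kappa>: "strict_mono \<kappa>" "\<And>i. i \<in> {0..n} \<Longrightarrow> AE z in \<mu>. convergent (\<lambda>j. h i (\<kappa> j) z)"
  proof (rule AE_subseq_of_Cauchy_in_measure[of "{0..n}" h \<mu>])
    show "h i k \<in> borel_measurable \<mu>" if "i \<in> {0..n}" for i k using hm[OF that] by simp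
    fix e :: real assume e: "0 < e"
    obtain d where d: "0 < d" "\<And>x C y D i. feasible x C \<Longrightarrow> feasible y D \<Longrightarrow>
      max_welfare \<le> welfare x C + ennreal d \<Longrightarrow> max_welfare \<le> welfare y D + ennreal d \<Longrightarrow> i \<in> {1..n} \<Longrightarrow>
      emeasure \<mu> {z\<in>space N. e \<le> dist (pt (x i) C z) (pt (y i) D z)} \<le> ennreal e"
      by (rule close_in_measure[OF e]) (rule that)
    obtain K where K: "\<epsilon> K < d" using reals_Archimedean[OF d(1)] by (auto simp: \<epsilon>_def)
    have nd: "max_welfare \<le> welfare (X k) (D k) + ennreal d" if "K \<le> k" for k
    proof -
      have "\<epsilon> k \<le> \<epsilon> K" using that by (simp add: \<epsilon>_def le_imp_inverse_le)
      then have "ennreal (\<epsilon> k) \<le> ennreal d" using K by (intro ennreal_leI) auto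
      then show ?thesis using near[of k] by (meson add_left_mono order_trans)
    qed
    show "\<exists>K. \<forall>k\<ge>K. \<forall>l\<ge>K. \<forall>i\<in>{0..n}. emeasure \<mu> {z\<in>space \<mu>. e < \<bar>h i k z - h i l z\<bar>} \<le> ennreal e"
    proof (intro exI[of _ K] allI impI ballI)
      fix k l i assume kl: "K \<le> k" "K \<le> l" and i: "i \<in> {0..n}"
      \<comment> \<open>The aggregate contribution is a coordinate of every agent's point; for index
        0 the point of agent 1 is taken.\<close>
      define i' where "i' = (if i = 0 then 1 else i)"
      have i': "i' \<in> {1..n}" using i n by (auto simp: i'_def)
      note [measurable] = pt_measurable[OF c(2)[OF i', of k] c(1)[of k]] pt_measurable[OF c(2)[OF i', of l] c(1)[of l]]
      have "emeasure \<mu> {z\<in>space \<mu>. e < \<bar>h i k z - h i l z\<bar>} \<le>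
        emeasure \<mu> {z\<in>space N. e \<le> dist (pt (X k i') (D k) z) (pt (X l i') (D l) z)}"
      proof (rule emeasure_mono)
        have "\<bar>h i k z - h i l z\<bar> \<le> dist (pt (X k i') (D k) z) (pt (X l i') (D l) z)" for z
          using dist_fst_le[of "pt (X k i') (D k) z" "pt (X l i') (D l) z"]
            dist_snd_le[of "pt (X k i') (D k) z" "pt (X l i') (D l) z"]
          by (auto simp: h_def i'_def pt_def dist_real_def)
        then show "{z\<in>space \<mu>. e < \<bar>h i k z - h i l z\<bar>} \<subseteq> {z\<in>space N. e \<le> dist (pt (X k i') (D k) z) (pt (X l i') (D l) z)}"
          by (auto intro: order_trans less_imp_le)
      qed measurable
      also have "\<dots> \<le> ennreal e" using kl by (intro d(2) f nd i')
      finally show "emeasure \<mu> {z\<in>space \<mu>. e < \<bar>h i k z - h i l z\<bar>} \<le> ennreal e" .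
    qed
  qed (rule that)
  show thesis
  proof (rule that[of "\<lambda>j. X (\<kappa> j)" "\<lambda>j. D (\<kappa> j)"])
    show "feasible (X (\<kappa> j)) (D (\<kappa> j))" for j by (rule f)
    show "AE z in N. convergent (\<lambda>j. X (\<kappa> j) i (snd z) (fst z))" if "i \<in> {1..n}" for i
      using \<kappa>(2)[of i] that unfolding AE_\<mu> by (simp add: h_def)
    show "AE z in N. convergent (\<lambda>j. D (\<kappa> j) (snd z) (fst z))"
      using \<kappa>(2)[of 0] unfolding AE_\<mu> by (simp add: h_def)
    have "(\<lambda>k. welfare (X k) (D k)) \<longlonglongrightarrow> max_welfare"
    proof (rule tendsto_sandwich)
      have "\<epsilon> \<longlonglongrightarrow> 0" unfolding \<epsilon>_def by (rule LIMSEQ_inverse_real_of_nat)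
      then have "(\<lambda>k. max_welfare - ennreal (\<epsilon> k)) \<longlonglongrightarrow> max_welfare - ennreal 0"
        using max_welfare_finite by (intro tendsto_diff_ennreal tendsto_ennrealI tendsto_const) auto
      then show "(\<lambda>k. max_welfare - ennreal (\<epsilon> k)) \<longlonglongrightarrow> max_welfare" by simp
      show "\<forall>\<^sub>F k in sequentially. max_welfare - ennreal (\<epsilon> k) \<le> welfare (X k) (D k)"
        using near by (intro always_eventually allI) (simp add: ennreal_minus_le_iff add.commute)
      show "\<forall>\<^sub>F k in sequentially. welfare (X k) (D k) \<le> max_welfare"
        by (intro always_eventually allI welfare_le f)
    qed (rule tendsto_const)
    from LIMSEQ_subseq_LIMSEQ[OF this \<kappa>(1)]
    show "(\<lambda>j. welfare (X (\<kappa> j)) (D (\<kappa> j))) \<longlonglongrightarrow> max_welfare" by (simp add: o_def)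
  qed
qed

text \<open>At almost every fixed time the contributions converge almost surely. Countably many such
  times form a dense set, so one null set suffices, and off it the selection is made path by path.
  Countability also keeps the limit measurable.\<close>

lemma process_limit:
  assumes f: "\<And>j. feasible (X j) (D j)" and conv: "AE z in N. convergent (\<lambda>j. D j (snd z) (fst z))"
  obtains C where "increasing_process M F T C" "AE z in N. (\<lambda>j. D j (snd z) (fst z)) \<longlonglongrightarrow> C (snd z) (fst z)"
    "\<And>t \<omega>. ereal t = T \<Longrightarrow> \<omega> \<in> space M \<Longrightarrow> emeasure (stieltjes T (\<lambda>t. C t \<omega>)) {t} = 0"
proof -
  have D: "increasing_process M F T (D j)" for j using f[of j] by (simp add: feasible_def)
  have gp: "good_path T (\<lambda>t. D j t \<omega>)" if "\<omega> \<in> space M" for \<omega> j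
    using D[of j] that by (auto simp: increasing_process_def)
  have DF: "D j s \<in> borel_measurable (F t)" if "s \<in> horizon T" "t \<in> horizon T" "s \<le> t" for s t j
    using D[of j] measurable_F_mono[OF _ that] that by (auto simp: increasing_process_def adapted_def)
  note [measurable] = consumption_measurable[OF increasing_consumption[OF D]]
  define G where "G t \<longleftrightarrow> (AE \<omega> in M. convergent (\<lambda>j. D j t \<omega>))" for t
  have AE_G: "AE t in lborel. t \<in> horizon T \<longrightarrow> G t"
  proof -
    \<comment> \<open>Convergence is stated with \<open>lim\<close> as its limit, because
      \<open>tendsto_sets\<close> asks for a measurable limit function.\<close>
    have "AE z in N. (\<lambda>j. D j (snd z) (fst z)) \<longlonglongrightarrow> lim (\<lambda>j. D j (snd z) (fst z))"
      using conv by eventually_elim (simp add: convergent_LIMSEQ_iff)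
    then have "AE t in lborel. t \<in> horizon T \<longrightarrow> (AE \<omega> in M. (\<lambda>j. D j (snd (\<omega>, t)) (fst (\<omega>, t))) \<longlonglongrightarrow> lim (\<lambda>j. D j (snd (\<omega>, t)) (fst (\<omega>, t))))"
      by (intro AE_prod_time_swap tendsto_sets) measurable
    then show ?thesis unfolding G_def by eventually_elim (auto simp: convergent_LIMSEQ_iff)
  qed
  \<comment> \<open>One generic time between any two rationals gives a countable dense set.\<close>
  define I where "I = {(p, q). p \<in> \<rat> \<and> q \<in> \<rat> \<and> 0 \<le> p \<and> p < q \<and> ereal p < T}"
  have "\<exists>d. fst pq < d \<and> d < snd pq \<and> ereal d < T \<and> G d" if pq: "pq \<in> I" for pq
  proof -
    obtain b where b: "fst pq < b" "ereal b < T" using ereal_dense2[of "ereal (fst pq)" T] pq by (auto simp: I_def case_prod_beta)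
    have "fst pq < min (snd pq) b" using pq b by (auto simp: I_def case_prod_beta)
    from AE_lborel_Ioo[OF AE_G this] obtain d where d: "fst pq < d" "d < min (snd pq) b" "d \<in> horizon T \<longrightarrow> G d" by blast
    have "ereal d < ereal b" using d(2) by simp
    then have "ereal d < T" using b(2) by (rule less_trans)
    moreover have "d \<in> horizon T" using d(1) pq \<open>ereal d < T\<close> by (auto simp: I_def horizon_def case_prod_beta)
    ultimately show ?thesis using d by auto
  qed
  then obtain \<delta> where \<delta>: "\<And>pq. pq \<in> I \<Longrightarrow> fst pq < \<delta> pq \<and> \<delta> pq < snd pq \<and> ereal (\<delta> pq) < T \<and> G (\<delta> pq)" by metis
  define A where "A = \<delta> ` I"
  have "countable I" by (rule countable_subset[of _ "\<rat> \<times> \<rat>"]) (auto simp: I_def intro!: countable_SIGMA countable_rat)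
  then have cA: "countable A" by (simp add: A_def)
  have A: "0 < d \<and> ereal d < T" and AG: "G d" if "d \<in> A" for d
    using that \<delta> by (force simp: A_def I_def)+
  have dense: "\<exists>d\<in>A. a < d \<and> d < b" if ab: "0 \<le> a" "a < b" "ereal a < T" for a b
  proof -
    obtain b' where b': "a < b'" "ereal b' < T" using ereal_dense2[OF ab(3)] by auto
    obtain p where p: "p \<in> \<rat>" "a < p" "p < min b b'" using Rats_dense_in_real[of a "min b b'"] ab b' by auto
    obtain q where q: "q \<in> \<rat>" "p < q" "q < min b b'" using Rats_dense_in_real[OF p(3)] by auto
    have "ereal p < ereal b'" using p(3) by simp
    then have "ereal p < T" using b'(2) by (rule less_trans)
    then have "(p, q) \<in> I" using p q ab by (auto simp: I_def)
    then show ?thesis using \<delta>[of "(p, q)"] p q by (intro bexI[of _ "\<delta> (p, q)"]) (auto simp: A_def)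
  qed
  define good where "good \<omega> \<longleftrightarrow> (\<forall>d\<in>A. convergent (\<lambda>j. D j d \<omega>)) \<and>
    (\<forall>t. ereal t = T \<longrightarrow> liminf (\<lambda>j. ennreal (D j t \<omega>)) < \<infinity>)" for \<omega>
  have AE_good: "AE \<omega> in M. good \<omega>"
    unfolding good_def
  proof (rule AE_conjI)
    show "AE \<omega> in M. \<forall>d\<in>A. convergent (\<lambda>j. D j d \<omega>)"
      using AG cA by (subst AE_ball_countable) (auto simp: G_def)
    \<comment> \<open>Fatou's lemma and the wealth bound on the expected value of the level at T
      make its limit inferior finite almost surely.\<close>
    show "AE \<omega> in M. \<forall>t. ereal t = T \<longrightarrow> liminf (\<lambda>j. ennreal (D j t \<omega>)) < \<infinity>"
    proof (cases T)
      case (real T')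
      have T': "T' \<in> horizon T" "0 < T'" using T real by (auto simp: horizon_def)
      have [measurable]: "D j T' \<in> borel_measurable M" "\<psi>c T' \<in> borel_measurable M" for j
        using DF[OF T'(1) T'(1)] pc.psi_measurable[OF T'(1)] measurable_F_M[OF _ T'(1)] by auto
      have "(\<integral>\<^sup>+\<omega>. liminf (\<lambda>j. ennreal (\<psi>c T' \<omega> * D j T' \<omega>)) \<partial>M) \<le> liminf (\<lambda>j. \<integral>\<^sup>+\<omega>. ennreal (\<psi>c T' \<omega> * D j T' \<omega>) \<partial>M)"
        by (rule nn_integral_liminf) measurable
      also have "\<dots> \<le> liminf (\<lambda>j. ennreal wealth)"
        by (intro Liminf_mono always_eventually allI expected_level[OF f T'])
      also have "\<dots> < \<infinity>" by (simp add: Liminf_const)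
      finally have "AE \<omega> in M. liminf (\<lambda>j. ennreal (\<psi>c T' \<omega> * D j T' \<omega>)) \<noteq> \<infinity>"
        by (intro nn_integral_noteq_infinite) auto
      then show ?thesis
        using AE_space
      proof eventually_elim
        case (elim \<omega>)
        have "liminf (\<lambda>j. ennreal (\<psi>c T' \<omega> * D j T' \<omega>)) < \<infinity>"
          using elim(1) by (simp add: less_top)
        from liminf_real_le[OF pc.psi_pos[OF T'(1) elim(2)] this] show ?case
          using real by simp
      qed
    qed auto
  qed
  have PL: "path_limit T A (\<lambda>j t. D j t \<omega>)" if "\<omega> \<in> space M" "good \<omega>" for \<omega>
    using T gp[OF that(1)] A dense that(2) by unfold_locales (auto simp: good_def)
  define C where "C t \<omega> = (if good \<omega> then helly_limit T A (\<lambda>j t. D j t \<omega>) t else 0)" for t \<omega>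
  have C: "increasing_process M F T C"
    unfolding increasing_process_def adapted_def
  proof (intro conjI ballI)
    fix \<omega> assume \<omega>: "\<omega> \<in> space M"
    have "good_path T (\<lambda>t. 0)" by (auto simp: good_path_def right_continuous_on_def mono_on_def)
    then show "good_path T (\<lambda>t. C t \<omega>)"
      using path_limit.good_path[OF PL[OF \<omega>]] by (cases "good \<omega>") (auto simp: C_def)
  next
    fix t assume t: "t \<in> horizon T"
    have gF: "{\<omega>\<in>space (F s). good \<omega>} \<in> sets (F s)" if "s \<in> horizon T" for s
      using AE_sets_F[OF AE_good that] space_F[OF that] by simp
    show "C t \<in> borel_measurable (F t)"
    proof (cases "ereal t = T")
      case True
      note [measurable] = DF[OF t t order_refl]
      have "C t = (\<lambda>\<omega>. if good \<omega> then enn2real (liminf (\<lambda>j. ennreal (D j t \<omega>))) else 0)"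
        using True by (simp add: C_def[abs_def] helly_limit_def cong: if_cong)
      then show ?thesis using gF[OF t] by simp
    next
      case False
      then have t': "0 \<le> t" "ereal t < T" using t by (auto simp: horizon_def)
      show ?thesis
      \<comment> \<open>For each s > t the value is computed from times of \<open>A\<close> before
        \<open>s\<close> alone, hence it is known at \<open>s\<close>.\<close>
      proof (rule measurable_right_limit[OF t t'(2)])
        fix s assume s: "s \<in> horizon T" "t < s"
        have "(\<lambda>\<omega>. if good \<omega> then (INF d\<in>{d\<in>A. t < d \<and> d < s}. lim (\<lambda>j. D j d \<omega>)) else 0) \<in> borel_measurable (F s)"
        proof (intro measurable_If gF s)
          show "(\<lambda>\<omega>. INF d\<in>{d\<in>A. t < d \<and> d < s}. lim (\<lambda>j. D j d \<omega>)) \<in> borel_measurable (F s)"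
          proof (rule borel_measurable_cINF_real)
            show "countable {d\<in>A. t < d \<and> d < s}" by (rule countable_subset[OF _ cA]) auto
            fix d assume d: "d \<in> {d\<in>A. t < d \<and> d < s}"
            have [measurable]: "D j d \<in> borel_measurable (F s)" for j
              using d t' s by (intro DF s horizon_le[OF s(1)]) auto
            show "(\<lambda>\<omega>. lim (\<lambda>j. D j d \<omega>)) \<in> borel_measurable (F s)" by measurable
          qed
        qed simp
        also have "?this \<longleftrightarrow> C t \<in> borel_measurable (F s)"
        proof (rule measurable_cong)
          fix \<omega> assume "\<omega> \<in> space (F s)"
          then have \<omega>: "\<omega> \<in> space M" using space_F[OF s(1)] by simp
          show "(if good \<omega> then (INF d\<in>{d\<in>A. t < d \<and> d < s}. lim (\<lambda>j. D j d \<omega>)) else 0) = C t \<omega>"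
            using path_limit.C_local[OF PL[OF \<omega>] t'(1) s(2) t'(2)] path_limit.L_def[OF PL[OF \<omega>]]
            by (auto simp: C_def)
        qed
        finally show "C t \<in> borel_measurable (F s)" .
      qed
    qed
  qed
  note [measurable] = consumption_measurable[OF increasing_consumption[OF C]]
  have conv_C: "AE z in N. (\<lambda>j. D j (snd z) (fst z)) \<longlonglongrightarrow> C (snd z) (fst z)"
  proof (rule AE_prod_time_I)
    show "{z \<in> space N. (\<lambda>j. D j (snd z) (fst z)) \<longlonglongrightarrow> C (snd z) (fst z)} \<in> sets N"
      by (rule tendsto_sets) measurable
    show "AE \<omega> in M. AE t in lborel. t \<in> horizon T \<longrightarrow> (\<lambda>j. D j (snd (\<omega>, t)) (fst (\<omega>, t))) \<longlonglongrightarrow> C (snd (\<omega>, t)) (fst (\<omega>, t))"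
      using AE_good AE_space
    proof eventually_elim
      case (elim \<omega>)
      show ?case using path_limit.AE_tendsto[OF PL[OF elim(2,1)]] elim(1) by (simp add: C_def)
    qed
  qed
  show thesis
  \<comment> \<open>The value at T does not affect convergence almost everywhere, so a jump there is
    dropped to avoid its cost.\<close>
  proof (rule that[of "no_jump C"])
    show "increasing_process M F T (no_jump C)" by (rule no_jump(1)[OF C])
    show "AE z in N. (\<lambda>j. D j (snd z) (fst z)) \<longlonglongrightarrow> no_jump C (snd z) (fst z)"
      using conv_C no_jump(3)[OF C] by eventually_elim simp
    show "emeasure (stieltjes T (\<lambda>t. no_jump C t \<omega>)) {t} = 0" if "ereal t = T" "\<omega> \<in> space M" for t \<omega>
    proof -
      have "good_path T (\<lambda>t. C t \<omega>)" using C that by (auto simp: increasing_process_def)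
      from remove_jump(4)[OF this T that(1)] show ?thesis by (simp add: no_jump_def)
    qed
  qed
qed

text \<open>Two applications of Fatou's lemma: in \<open>k\<close> on a fixed grid, whose points are
  times of almost sure convergence, and then in the mesh. In between,
  \<open>grid_sum_le_upto\<close> bounds each grid cost of \<open>D k\<close> by its full
  cost.\<close>

lemma upto_limit_le:
  assumes f: "\<And>j. feasible (X j) (D j)" and C: "increasing_process M F T C"
    and S: "S \<in> horizon T" "0 < S"
    and lim: "\<And>m j. 0 < m \<Longrightarrow> 0 < j \<Longrightarrow> j \<le> m \<Longrightarrow> AE \<omega> in M. (\<lambda>k. D k (grid m S j) \<omega>) \<longlonglongrightarrow> C (grid m S j) \<omega>"
  shows "(\<integral>\<^sup>+\<omega>. stieltjes_upto T S (\<lambda>t. \<psi>c t \<omega>) (\<lambda>t. C t \<omega>) \<partial>M) \<le> liminf (\<lambda>k. ccost (D k))"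
proof -
  have D: "increasing_process M F T (D k)" for k using f[of k] by (simp add: feasible_def)
  let ?g = "\<lambda>E m \<omega>. ennreal (grid_sum (Suc m) S (\<lambda>t. \<psi>c t \<omega>) (\<lambda>t. E t \<omega>))"
  have gm: "?g E m \<in> borel_measurable M" if E: "increasing_process M F T E" for E m
  proof -
    have [measurable]: "\<psi>c (grid (Suc m) S j) \<in> borel_measurable M" "E (grid (Suc m) S j) \<in> borel_measurable M" if "j \<le> Suc m" for j
      using pc.psi_measurable E grid_horizon[OF S that] by (auto simp: increasing_process_def adapted_def intro: measurable_F_M)
    show ?thesis unfolding grid_sum_def grid_incr_def
      by (auto intro!: measurable_compose[OF _ measurable_ennreal] borel_measurable_sum borel_measurable_times borel_measurable_diff)
  qed
  have step: "(\<integral>\<^sup>+\<omega>. ?g C m \<omega> \<partial>M) \<le> liminf (\<lambda>k. ccost (D k))" for m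
  proof -
    have "AE \<omega> in M. \<forall>j\<in>{1..Suc m}. (\<lambda>k. D k (grid (Suc m) S j) \<omega>) \<longlonglongrightarrow> C (grid (Suc m) S j) \<omega>"
      by (intro AE_finite_allI lim) auto
    then have "AE \<omega> in M. ?g C m \<omega> = liminf (\<lambda>k. ?g (D k) m \<omega>)"
    proof eventually_elim
      case (elim \<omega>)
      have "(\<lambda>k. grid_incr (Suc m) S (\<lambda>t. D k t \<omega>) j) \<longlonglongrightarrow> grid_incr (Suc m) S (\<lambda>t. C t \<omega>) j" if "j < Suc m" for j
      \<comment> \<open>The first increment does not involve the value at 0, where convergence is
        not known.\<close>
      proof (cases "j = 0")
        case True
        have "1 \<in> {1..Suc m}" by simp
        from bspec[OF elim this] show ?thesis using True by (simp add: grid_incr_def)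
      next
        case False
        then have "Suc j \<in> {1..Suc m}" "j \<in> {1..Suc m}" using that by auto
        from tendsto_diff[OF bspec[OF elim this(1)] bspec[OF elim this(2)]] show ?thesis
          using False by (simp add: grid_incr_def)
      qed
      then have "(\<lambda>k. ?g (D k) m \<omega>) \<longlonglongrightarrow> ?g C m \<omega>"
        unfolding grid_sum_def by (intro tendsto_ennrealI tendsto_sum tendsto_mult tendsto_const) auto
      then show ?case by (rule lim_imp_Liminf[rotated, symmetric]) simp
    qed
    then have "(\<integral>\<^sup>+\<omega>. ?g C m \<omega> \<partial>M) = (\<integral>\<^sup>+\<omega>. liminf (\<lambda>k. ?g (D k) m \<omega>) \<partial>M)"
      by (rule nn_integral_cong_AE)
    also have "\<dots> \<le> liminf (\<lambda>k. \<integral>\<^sup>+\<omega>. ?g (D k) m \<omega> \<partial>M)"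
      by (intro nn_integral_liminf gm D)
    also have "\<dots> \<le> liminf (\<lambda>k. ccost (D k))"
    proof (intro Liminf_mono always_eventually allI)
      fix k
      have "(\<integral>\<^sup>+\<omega>. ?g (D k) m \<omega> \<partial>M) \<le> (\<integral>\<^sup>+\<omega>. stieltjes_upto T S (\<lambda>t. \<psi>c t \<omega>) (\<lambda>t. D k t \<omega>) \<partial>M)"
        by (rule pc.grid_sum_le_upto[OF D S]) simp
      also have "\<dots> \<le> ccost (D k)"
        unfolding ccost_def by (intro nn_integral_mono nonneg_integrand.upto_le_integral[OF pc.psi_integrand S(1)])
      finally show "(\<integral>\<^sup>+\<omega>. ?g (D k) m \<omega> \<partial>M) \<le> ccost (D k)" .
    qed
    finally show ?thesis .
  qed
  have "(\<integral>\<^sup>+\<omega>. stieltjes_upto T S (\<lambda>t. \<psi>c t \<omega>) (\<lambda>t. C t \<omega>) \<partial>M) \<le> (\<integral>\<^sup>+\<omega>. liminf (\<lambda>m. ?g C m \<omega>) \<partial>M)"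
  proof (rule nn_integral_mono)
    fix \<omega> assume \<omega>: "\<omega> \<in> space M"
    interpret nonneg_integrand T "\<lambda>t. \<psi>c t \<omega>" by (rule pc.psi_integrand[OF \<omega>])
    show "stieltjes_upto T S (\<lambda>t. \<psi>c t \<omega>) (\<lambda>t. C t \<omega>) \<le> liminf (\<lambda>m. ?g C m \<omega>)"
      using C \<omega> by (intro stieltjes_upto_le_liminf T rc S nn_upto[OF S(1)]) (auto simp: increasing_process_def)
  qed
  also have "\<dots> \<le> liminf (\<lambda>m. \<integral>\<^sup>+\<omega>. ?g C m \<omega> \<partial>M)"
    by (intro nn_integral_liminf gm C)
  also have "\<dots> \<le> liminf (\<lambda>m. liminf (\<lambda>k. ccost (D k)))"
    by (intro Liminf_mono always_eventually allI step)
  also have "\<dots> = liminf (\<lambda>k. ccost (D k))" by (simp add: Liminf_const)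
  finally show ?thesis .
qed

text \<open>An end point \<open>S\<close> is suitable if the process converges almost surely at all
  grid points S j / m. Each of the countably many ratios j / m excludes a null set of end points, so
  suitable ones can be found arbitrarily close to T.\<close>

lemma ccost_limit_le:
  assumes f: "\<And>j. feasible (X j) (D j)" and C: "increasing_process M F T C"
    and lim: "AE z in N. (\<lambda>j. D j (snd z) (fst z)) \<longlonglongrightarrow> C (snd z) (fst z)"
    and na: "\<And>t \<omega>. ereal t = T \<Longrightarrow> \<omega> \<in> space M \<Longrightarrow> emeasure (stieltjes T (\<lambda>t. C t \<omega>)) {t} = 0"
  shows "ccost C \<le> liminf (\<lambda>k. ccost (D k))"
proof -
  have D: "increasing_process M F T (D k)" for k using f[of k] by (simp add: feasible_def)
  note [measurable] = consumption_measurable[OF increasing_consumption[OF D]] consumption_measurable[OF increasing_consumption[OF C]]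
  define G where "G t \<longleftrightarrow> (AE \<omega> in M. (\<lambda>k. D k t \<omega>) \<longlonglongrightarrow> C t \<omega>)" for t
  have "AE t in lborel. t \<in> horizon T \<longrightarrow> (AE \<omega> in M. (\<lambda>j. D j (snd (\<omega>, t)) (fst (\<omega>, t))) \<longlonglongrightarrow> C (snd (\<omega>, t)) (fst (\<omega>, t)))"
    by (intro AE_prod_time_swap tendsto_sets lim) measurable
  then have G: "AE t in lborel. t \<in> horizon T \<longrightarrow> G t" by (simp add: G_def)
  have "AE S in lborel. \<forall>m\<in>{0<..}. \<forall>j\<in>{0<..}. grid m S j \<in> horizon T \<longrightarrow> G (grid m S j)"
  proof (subst AE_ball_countable, simp, intro ballI, subst AE_ball_countable, simp, intro ballI)
    fix m j :: nat assume "m \<in> {0<..}" "j \<in> {0<..}"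
    then have "0 < real j / real m" by simp
    from AE_lborel_scale[OF G this] show "AE S in lborel. grid m S j \<in> horizon T \<longrightarrow> G (grid m S j)"
      by (simp add: grid_def mult.commute)
  qed
  note GG = this
  \<comment> \<open>Levels strictly increasing to T. One suitable end point between each two
    consecutive levels gives an increasing sequence that stays below T.\<close>
  define lo where "lo k = (if T = \<infinity> then real k else real_of_ereal T * (real k / real (Suc k)))" for k
  have lo: "lo k < lo (Suc k)" "0 \<le> lo k" "ereal (lo k) < T" for k
  proof -
    show "lo k < lo (Suc k)" "0 \<le> lo k" "ereal (lo k) < T"
      using T by (cases T; auto simp: lo_def field_simps)+
  qed
  have lo_ex: "\<forall>\<^sub>F k in sequentially. t < lo k" if "0 \<le> t" "ereal t < T" for t
  proof (cases T)
    case (real T')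
    have "(\<lambda>k. T' * (real k / real (Suc k))) \<longlonglongrightarrow> T' * 1"
      by (intro tendsto_intros LIMSEQ_n_over_Suc_n)
    then show ?thesis using that real by (auto simp: lo_def dest: order_tendstoD(1)[where a = t])
  next
    case PInf
    have "\<forall>\<^sub>F k in sequentially. t < real k"
      using eventually_gt_at_top[of "nat \<lceil>t\<rceil>"] by eventually_elim linarith
    then show ?thesis using PInf by (simp add: lo_def)
  qed (use T in auto)
  have "\<exists>S. lo k < S \<and> S < lo (Suc k) \<and> (\<forall>m\<in>{0<..}. \<forall>j\<in>{0<..}. grid m S j \<in> horizon T \<longrightarrow> G (grid m S j))" for k
    by (rule AE_lborel_Ioo[OF GG lo(1)[of k]]) (intro exI conjI)
  then obtain S where S: "\<And>k. lo k < S k" "\<And>k. S k < lo (Suc k)"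
    and SG: "\<And>k. \<forall>m\<in>{0<..}. \<forall>j\<in>{0<..}. grid m (S k) j \<in> horizon T \<longrightarrow> G (grid m (S k) j)" by metis
  have ST: "ereal (S k) < T" for k
  proof -
    have "ereal (S k) < ereal (lo (Suc k))" using S(2)[of k] by simp
    then show ?thesis using lo(3) by (rule less_trans)
  qed
  have S0: "0 < S k" for k using S(1)[of k] lo(2)[of k] by simp
  have SH: "S k \<in> horizon T" for k using S0[of k] ST[of k] by (auto simp: horizon_def)
  have inc: "incseq S"
  proof (rule incseq_SucI)
    show "S k \<le> S (Suc k)" for k using S(2)[of k] S(1)[of "Suc k"] by linarith
  qed
  have upto: "(\<integral>\<^sup>+\<omega>. stieltjes_upto T (S k) (\<lambda>t. \<psi>c t \<omega>) (\<lambda>t. C t \<omega>) \<partial>M) \<le> liminf (\<lambda>k. ccost (D k))" for k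
  proof (rule upto_limit_le[OF f C SH S0])
    fix m j :: nat assume "0 < m" "0 < j" "j \<le> m"
    moreover from this have "grid m (S k) j \<in> horizon T" by (intro grid_horizon SH S0)
    ultimately have "G (grid m (S k) j)" using SG[of k] by auto
    then show "AE \<omega> in M. (\<lambda>k'. D k' (grid m (S k) j) \<omega>) \<longlonglongrightarrow> C (grid m (S k) j) \<omega>" by (simp add: G_def)
  qed
  have "ccost C = (\<integral>\<^sup>+\<omega>. liminf (\<lambda>k. stieltjes_upto T (S k) (\<lambda>t. \<psi>c t \<omega>) (\<lambda>t. C t \<omega>)) \<partial>M)"
    unfolding ccost_def
  proof (rule nn_integral_cong)
    fix \<omega> assume \<omega>: "\<omega> \<in> space M"
    have "(\<lambda>k. stieltjes_upto T (S k) (\<lambda>t. \<psi>c t \<omega>) (\<lambda>t. C t \<omega>)) \<longlonglongrightarrow> stieltjes_integral T (\<lambda>t. \<psi>c t \<omega>) (\<lambda>t. C t \<omega>)"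
    proof (rule nonneg_integrand.integral_LIMSEQ_no_atom[OF pc.psi_integrand[OF \<omega>]])
      show "good_path T (\<lambda>t. C t \<omega>)" using C \<omega> by (simp add: increasing_process_def)
      show "\<forall>\<^sub>F k in sequentially. t \<le> S k" if "0 \<le> t" "ereal t < T" for t
        using lo_ex[OF that]
      proof eventually_elim
        case (elim k)
        then show ?case using S(1)[of k] by linarith
      qed
      show "emeasure (stieltjes T (\<lambda>t. C t \<omega>)) {t} = 0" if "ereal t = T" for t by (rule na[OF that \<omega>])
    qed (rule inc SH S0 ST)+
    then show "stieltjes_integral T (\<lambda>t. \<psi>c t \<omega>) (\<lambda>t. C t \<omega>) = liminf (\<lambda>k. stieltjes_upto T (S k) (\<lambda>t. \<psi>c t \<omega>) (\<lambda>t. C t \<omega>))"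
      by (rule lim_imp_Liminf[rotated, symmetric]) simp
  qed
  also have "\<dots> \<le> liminf (\<lambda>k. \<integral>\<^sup>+\<omega>. stieltjes_upto T (S k) (\<lambda>t. \<psi>c t \<omega>) (\<lambda>t. C t \<omega>) \<partial>M)"
    by (intro nn_integral_liminf stieltjes_measurable(2)[OF C] SH S0)
  also have "\<dots> \<le> liminf (\<lambda>k'. liminf (\<lambda>k. ccost (D k)))"
    by (intro Liminf_mono always_eventually allI upto)
  also have "\<dots> = liminf (\<lambda>k. ccost (D k))" by (simp add: Liminf_const)
  finally show ?thesis .
qed

lemma xcost_limit_le:
  assumes x: "\<And>j. consumption (x j)" "consumption y"
    and lim: "AE z in N. (\<lambda>j. x j (snd z) (fst z)) \<longlonglongrightarrow> y (snd z) (fst z)"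
  shows "xcost y \<le> liminf (\<lambda>j. xcost (x j))"
proof -
  note [measurable] = consumption_measurable[OF x(1)] xcost_eq(3)[OF x(2)]
  have "xcost y = (\<integral>\<^sup>+z. liminf (\<lambda>j. ennreal (\<psi>x (snd z) (fst z)) * ennreal (x j (snd z) (fst z))) \<partial>N)"
    unfolding xcost_eq(1)[OF x(2)]
  proof (rule nn_integral_cong_AE)
    show "AE z in N. ennreal (\<psi>x (snd z) (fst z)) * ennreal (y (snd z) (fst z)) =
      liminf (\<lambda>j. ennreal (\<psi>x (snd z) (fst z)) * ennreal (x j (snd z) (fst z)))"
      using lim
    proof eventually_elim
      case (elim z)
      have "(\<lambda>j. ennreal (\<psi>x (snd z) (fst z)) * ennreal (x j (snd z) (fst z))) \<longlonglongrightarrow> ennreal (\<psi>x (snd z) (fst z)) * ennreal (y (snd z) (fst z))"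
        by (intro ennreal_tendsto_cmult tendsto_ennrealI elim) simp
      then show ?case by (rule lim_imp_Liminf[rotated, symmetric]) simp
    qed
  qed
  also have "\<dots> \<le> liminf (\<lambda>j. \<integral>\<^sup>+z. ennreal (\<psi>x (snd z) (fst z)) * ennreal (x j (snd z) (fst z)) \<partial>N)"
    by (rule nn_integral_liminf) measurable
  also have "\<dots> = liminf (\<lambda>j. xcost (x j))" by (simp add: xcost_eq(1)[OF x(1)])
  finally show ?thesis .
qed

lemma maximizer_exists:
  obtains x C where "feasible x C" "max_welfare \<le> welfare x C"
proof -
  obtain X D where f: "\<And>j. feasible (X j) (D j)" and V: "(\<lambda>j. welfare (X j) (D j)) \<longlonglongrightarrow> max_welfare"
    and Xc: "\<And>i. i \<in> {1..n} \<Longrightarrow> AE z in N. convergent (\<lambda>j. X j i (snd z) (fst z))"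
    and Dc: "AE z in N. convergent (\<lambda>j. D j (snd z) (fst z))"
    by (rule convergent_maximizing_sequence) (rule that)
  obtain C where C: "increasing_process M F T C" and CD: "AE z in N. (\<lambda>j. D j (snd z) (fst z)) \<longlonglongrightarrow> C (snd z) (fst z)"
    and na: "\<And>t \<omega>. ereal t = T \<Longrightarrow> \<omega> \<in> space M \<Longrightarrow> emeasure (stieltjes T (\<lambda>t. C t \<omega>)) {t} = 0"
    by (rule process_limit[OF f Dc]) (rule that)
  have D: "increasing_process M F T (D j)" for j using f[of j] by (simp add: feasible_def)
  have cX: "consumption (X j i)" if "i \<in> {1..n}" for i j using f[of j] that by (simp add: feasible_def)
  \<comment> \<open>The pointwise limit remains optional. The maximum with 0 ensures nonnegativity
    where the sequence diverges and \<open>lim\<close> is unspecified.\<close>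
  define x where "x i = (\<lambda>t \<omega>. max 0 (lim (\<lambda>j. X j i t \<omega>)))" for i
  have x: "consumption (x i)" if i: "i \<in> {1..n}" for i
  proof -
    have [measurable]: "(\<lambda>z. X j i (snd z) (fst z)) \<in> borel_measurable (optional_sigma M F T)" for j
      using cX[OF i, of j] by (simp add: consumption_def optional_process_def case_prod_unfold)
    have "(\<lambda>z. x i (snd z) (fst z)) \<in> borel_measurable (optional_sigma M F T)"
      unfolding x_def by measurable
    then show ?thesis by (auto simp: consumption_def optional_process_def case_prod_unfold x_def)
  qed
  have Xx: "AE z in N. (\<lambda>j. X j i (snd z) (fst z)) \<longlonglongrightarrow> x i (snd z) (fst z)" if i: "i \<in> {1..n}" for i
    using Xc[OF i] AE_space
  proof eventually_elim
    case (elim z)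
    then have l: "(\<lambda>j. X j i (snd z) (fst z)) \<longlonglongrightarrow> lim (\<lambda>j. X j i (snd z) (fst z))"
      by (simp add: convergent_LIMSEQ_iff)
    moreover have "0 \<le> lim (\<lambda>j. X j i (snd z) (fst z))"
      using cX[OF i] elim(2) by (intro LIMSEQ_le_const[OF l]) (auto simp: consumption_def space_prod_time)
    ultimately show ?case by (simp add: x_def)
  qed
  have cost: "(\<Sum>i=1..n. xcost (x i)) + ccost C \<le> ennreal wealth"
  proof -
    \<comment> \<open>All costs are gathered in one family, index 0 being the contributions, so that
      superadditivity of the limit inferior yields the joint budget constraint.\<close>
    define a where "a i j = (if i = 0 then ccost (D j) else xcost (X j i))" for i j
    have split: "(\<Sum>i\<in>{0..n}. g i) = (\<Sum>i=1..n. g i) + g 0" for g :: "nat \<Rightarrow> ennreal"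
      by (subst sum.atLeast_Suc_atMost) (auto simp: add.commute)
    have "(\<Sum>i=1..n. xcost (x i)) + ccost C \<le> (\<Sum>i=1..n. liminf (a i)) + liminf (a 0)"
    proof (intro add_mono sum_mono)
      have "a 0 = (\<lambda>j. ccost (D j))" by (simp add: a_def fun_eq_iff)
      then show "ccost C \<le> liminf (a 0)" using ccost_limit_le[OF f C CD na] by simp
      fix i assume i: "i \<in> {1..n}"
      then have "a i = (\<lambda>j. xcost (X j i))" by (simp add: a_def fun_eq_iff)
      then show "xcost (x i) \<le> liminf (a i)"
        using xcost_limit_le[OF cX[OF i] x[OF i] Xx[OF i]] by simp
    qed
    also have "\<dots> = (\<Sum>i\<in>{0..n}. liminf (a i))" by (rule split[symmetric])
    also have "\<dots> \<le> liminf (\<lambda>j. \<Sum>i\<in>{0..n}. a i j)" by (rule sum_liminf_le) simp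
    also have "\<dots> \<le> liminf (\<lambda>j. ennreal wealth)"
    proof (intro Liminf_mono always_eventually allI)
      fix j
      show "(\<Sum>i\<in>{0..n}. a i j) \<le> ennreal wealth"
        using f[of j] unfolding split by (simp add: a_def feasible_def)
    qed
    also have "\<dots> = ennreal wealth" by (simp add: Liminf_const)
    finally show ?thesis .
  qed
  have fx: "feasible x C" using x C cost by (simp add: feasible_def)
  have "max_welfare \<le> welfare x C"
  proof (rule welfare_upper_semicontinuous[OF f _ _ _ V])
    show "consumption (x i)" if "i \<in> {1..n}" for i by (rule x[OF that])
    show cC: "consumption C" by (rule increasing_consumption[OF C])
    fix i assume i: "i \<in> {1..n}"
    show "AE z in N. (\<lambda>k. util i (X k i) (D k) z) \<longlonglongrightarrow> util i (x i) C z"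
      using Xx[OF i] CD AE_space
    proof eventually_elim
      case (elim z)
      have "continuous_on quadrant (u i)" using u_regular[OF i] by (simp add: utility_regular_def)
      then have "(\<lambda>k. u i (X k i (snd z) (fst z), D k (snd z) (fst z))) \<longlonglongrightarrow> u i (x i (snd z) (fst z), C (snd z) (fst z))"
      proof (rule continuous_on_tendsto_compose)
        show "(\<lambda>k. (X k i (snd z) (fst z), D k (snd z) (fst z))) \<longlonglongrightarrow> (x i (snd z) (fst z), C (snd z) (fst z))"
          by (intro tendsto_Pair elim)
        show "(x i (snd z) (fst z), C (snd z) (fst z)) \<in> quadrant"
          by (rule quadrant_process[OF x[OF i] cC elim(3)])
        show "\<forall>\<^sub>F k in sequentially. (X k i (snd z) (fst z), D k (snd z) (fst z)) \<in> quadrant"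
          by (intro always_eventually allI quadrant_process[OF cX[OF i] increasing_consumption[OF D] elim(3)])
      qed
      then show ?case unfolding util_def by (intro tendsto_mult tendsto_const)
    qed
  qed
  then show thesis using that fx by blast
qed

section \<open>Transfer to the original planner problem\<close>

lemma V_SP_eq: "V_SP M F T \<psi>x \<psi>c r u n \<gamma> wealth = max_welfare"
proof (rule antisym)
  show "V_SP M F T \<psi>x \<psi>c r u n \<gamma> wealth \<le> max_welfare"
    unfolding V_SP_def
  proof (rule SUP_least)
    fix s assume "s \<in> planner_budget_set M F T \<psi>x \<psi>c n wealth"
    then have "(fst s, snd s) \<in> planner_budget_set M F T \<psi>x \<psi>c n wealth" by simp
    then obtain C where "feasible (fst s) C" "planner_objective M T r u n \<gamma> (fst s, snd s) = welfare (fst s) C"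
      by (rule normal_form) (rule that)
    then show "planner_objective M T r u n \<gamma> s \<le> max_welfare" using welfare_le by simp
  qed
  show "max_welfare \<le> V_SP M F T \<psi>x \<psi>c r u n \<gamma> wealth"
    unfolding max_welfare_def
  proof (rule SUP_least, clarify)
    fix x C assume "feasible x C"
    from from_normal_form[OF this] show "welfare x C \<le> V_SP M F T \<psi>x \<psi>c r u n \<gamma> wealth"
      unfolding V_SP_def by (metis (no_types, lifting) SUP_upper)
  qed
qed

lemma solution_exists:
  "\<exists>xs Cs. solves_planner M F T \<psi>x \<psi>c r u n \<gamma> wealth (xs, Cs)"
proof -
  obtain x C where f: "feasible x C" "max_welfare \<le> welfare x C" by (rule maximizer_exists)
  then have "welfare x C = max_welfare" using welfare_le by (intro antisym)
  with from_normal_form(1,2)[OF f(1)] show ?thesis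
    unfolding solves_planner_def V_SP_eq by auto
qed

lemma solution_unique:
  assumes "solves_planner M F T \<psi>x \<psi>c r u n \<gamma> wealth (xs, Cs)" "solves_planner M F T \<psi>x \<psi>c r u n \<gamma> wealth (x, C)"
  shows "i \<in> {1..n} \<Longrightarrow> AE (\<omega>, t) in N. xs i t \<omega> = x i t \<omega>"
    and "AE \<omega> in M. \<forall>t\<in>horizon T. (\<Sum>i=1..n. Cs i t \<omega>) = (\<Sum>i=1..n. C i t \<omega>)"
proof -
  have b: "(xs, Cs) \<in> planner_budget_set M F T \<psi>x \<psi>c n wealth" "(x, C) \<in> planner_budget_set M F T \<psi>x \<psi>c n wealth"
    and max: "planner_objective M T r u n \<gamma> (xs, Cs) = max_welfare" "planner_objective M T r u n \<gamma> (x, C) = max_welfare"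
    using assms unfolding solves_planner_def V_SP_eq by auto
  obtain Ds where Ds: "feasible xs Ds" "AE \<omega> in M. \<forall>t. (\<Sum>i=1..n. Cs i t \<omega>) = Ds t \<omega>"
    "planner_objective M T r u n \<gamma> (xs, Cs) = welfare xs Ds" by (rule normal_form[OF b(1)]) (rule that)
  obtain D where D: "feasible x D" "AE \<omega> in M. \<forall>t. (\<Sum>i=1..n. C i t \<omega>) = D t \<omega>"
    "planner_objective M T r u n \<gamma> (x, C) = welfare x D" by (rule normal_form[OF b(2)]) (rule that)
  have m: "max_welfare \<le> welfare xs Ds" "max_welfare \<le> welfare x D" using Ds(3) D(3) max by simp_all
  show "AE (\<omega>, t) in N. xs i t \<omega> = x i t \<omega>" if "i \<in> {1..n}"
    using maximizers_unique(1)[OF Ds(1) D(1) m that] by (simp add: case_prod_unfold)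
  show "AE \<omega> in M. \<forall>t\<in>horizon T. (\<Sum>i=1..n. Cs i t \<omega>) = (\<Sum>i=1..n. C i t \<omega>)"
    using maximizers_unique(2)[OF Ds(1) D(1) m] Ds(2) D(2) by eventually_elim simp
qed

end

theorem theorem3p1:
  fixes M :: "'a measure" and F :: "real \<Rightarrow> 'a measure" and T :: ereal
    and \<psi>x \<psi>c r :: "'a process" and n :: nat
    and u :: "nat \<Rightarrow> real \<times> real \<Rightarrow> real" and w \<gamma> :: "nat \<Rightarrow> real"
  assumes "prob_space M" and "0 < T" and "usual_filtration M F T"
    and "1 \<le> n"
    and "\<forall>i\<in>{1..n}. 0 < w i"
    and "\<forall>i\<in>{1..n}. 0 < \<gamma> i" and "(\<Sum>i=1..n. \<gamma> i) = 1"
    and "strictly_positive M T \<psi>x" and "strictly_positive M T \<psi>c"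
    and "Assumption_U M F T \<psi>x \<psi>c r u n w"
    and "Assumption_P M F T \<psi>x \<psi>c r"
  shows "(\<exists>xs Cs. solves_planner M F T \<psi>x \<psi>c r u n \<gamma> (\<Sum>i=1..n. w i) (xs, Cs)) \<and>
    (\<forall>xs Cs x C.
       solves_planner M F T \<psi>x \<psi>c r u n \<gamma> (\<Sum>i=1..n. w i) (xs, Cs) \<and>
       solves_planner M F T \<psi>x \<psi>c r u n \<gamma> (\<Sum>i=1..n. w i) (x, C) \<longrightarrow>
       (\<forall>i\<in>{1..n}. AE (\<omega>, t) in prod_time M T. xs i t \<omega> = x i t \<omega>) \<and>
       (AE \<omega> in M. \<forall>t\<in>horizon T. (\<Sum>i=1..n. Cs i t \<omega>) = (\<Sum>i=1..n. C i t \<omega>)))"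
proof -
  interpret prob_space M by fact
  interpret planner M F T \<psi>x \<psi>c r n u w \<gamma>
    using assms by unfold_locales auto
  show ?thesis
    unfolding wealth_def[symmetric]
  proof (intro conjI allI impI ballI, goal_cases)
    case 1
    show ?case by (rule solution_exists)
  next
    case (2 xs Cs x C i)
    then show ?case by (intro solution_unique(1)) auto
  next
    case (3 xs Cs x C)
    then show ?case by (intro solution_unique(2)) auto
  qed
qed

end
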